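(* Fix $\ell\ge1$ and a word $w\in\{+,-\}^{2\ell}$. Let $T_w(x_1,\dots,x_{2\ell-1})$ be the generating function of pure steep tilings of the oblique strip of width $2\ell$ with asymptotic data $w$ (up to translation by multiples of $(1,1)$), where the exponent of $x_i$ records the number of flips centered on the $i$-th diagonal in a shortest sequence of flips from the minimal tiling $T^w_{\min}$ to the tiling. Then $$T_w=\prod_{\substack{i<j\\ w_i=+,\ w_j=-\\ j-i\text{ odd}}}\left(1+x_ix_{i+1}\cdots x_{j-1}\right)\prod_{\substack{i<j\\ w_i=+,\ w_j=-\\ j-i\text{ even}}}\frac{1}{1-x_ix_{i+1}\cdots x_{j-1}}.$$
   Context: A domino is a closed $2\times1$ or $1\times2$ rectangle with integer corners. A tiling of the oblique strip of width $2\ell$ is a set of dominos with disjoint interiors whose union $R$ satisfies $\{|x-y-\ell|\le\ell-1\}\subseteq R\subseteq\{|x-y-\ell|\le\ell+1\}$. A horizontal (resp. vertical) domino is north-going (resp. east-going) if the sum of the coordinates of its top left corner is odd, and south-going (resp. west-going) otherwise. The tiling is steep if for some $B$ all dominos in $\{x+y>B\}$ are north- or east-going and all dominos in $\{x+y<-B\}$ are south- or west-going. Its asymptotic data is the word $w\in\{+,-\}^{2\ell}$ such that for each $k\in\{1,\dots,\ell\}$: for all large enough $x$ the unit square with bottom right corner $(x,x-2k)$ is covered by a north-going domino if $w_{2k-1}=+$ and an east-going one if $w_{2k-1}=-$; for all negative enough $x$ the unit square with top left corner $(x,x-2k+2)$ is covered by a west-going domino if $w_{2k}=+$ and a south-going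 one if $w_{2k}=-$. The tiling is pure if there are half-integers $a,b$ such that, for $x\in\mathbb{Z}+\frac12$, the unit square centered at $(x,x)$ is covered iff $x\ge a$, and the one centered at $(x,x-2\ell)$ is covered iff $x\le b$. A flip replaces two horizontal dominos forming a $2\times2$ square by two vertical dominos, or vice versa; it is centered on the $k$-th diagonal if the center of the square lies on $y=x-k$. Particle configuration: a site is a point $(x,y)\in(\mathbb{Z}+\frac12)^2$ with $0\le x-y\le2\ell$; it is occupied if covered by a south- or west-going domino or if uncovered on $y=x$, and empty if covered by a north- or east-going domino or if uncovered on $y=x-2\ell$. Let $c_0=0$, $c_{2k-1}=c_{2k-2}+[w_{2k-1}=+]$, $c_{2k}=c_{2k-1}+[w_{2k}=-]$. The minimal tiling $T^w_{\min}$ is the steep tiling with asymptotic data $w$ in which, for every $m\in\{0,\dots,2\ell\}$ and $x\in\mathbb{Z}+\frac12$, the site $(x,x-m)$ is occupied iff $x<c_m$. *)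

theory Defs
  imports "HOL-Analysis.Analysis" "HOL-Library.Multiset"
begin

section \<open>Formal power series in arbitrarily many variables\<close>

text \<open>
  A monomial is the finite multiset of its variables, so the exponent of the variable \<open>v\<close>
  in the monomial \<open>M\<close> is \<open>count M v\<close> and the product of monomials is the sum of multisets.
\<close>

typedef ('v, 'a) mfps = "UNIV :: ('v multiset \<Rightarrow> 'a) set"
  morphisms mfps_coeff Abs_mfps ..

lemma mfps_coeff_Abs [simp]: "mfps_coeff (Abs_mfps f) = f"
  by (simp add: Abs_mfps_inverse)

lemma mfps_eqI: "(\<And>M. mfps_coeff f M = mfps_coeff g M) \<Longrightarrow> f = g"
  by (metis ext mfps_coeff_inject)

lemma finite_submultisets: "finite {A. A \<subseteq># M}"
proof (induction M)
  case empty
  then show ?case by simp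
next
  case (add x M)
  have "{A. A \<subseteq># add_mset x M} \<subseteq> {A. A \<subseteq># M} \<union> add_mset x ` {A. A \<subseteq># M}"
  proof
    fix A assume "A \<in> {A. A \<subseteq># add_mset x M}"
    then have A: "A \<subseteq># add_mset x M" by simp
    show "A \<in> {A. A \<subseteq># M} \<union> add_mset x ` {A. A \<subseteq># M}"
    proof (cases "x \<in># A")
      case True
      then obtain B where "A = add_mset x B" by (metis insert_DiffM)
      with A show ?thesis by simp
    next
      case False
      have "count A a \<le> count M a" for a
        using mset_subset_eq_count[OF A, of a] False by (cases "a = x") (auto simp: not_in_iff)
      then show ?thesis by (simp add: mset_subset_eqI)
    qed
  qed
  then show ?case using add.IH by (meson finite_Un finite_imageI finite_subset)
qed

instantiation mfps :: (type, comm_ring_1) comm_ring_1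
begin

definition "0 = Abs_mfps (\<lambda>_. 0)"
definition "1 = Abs_mfps (\<lambda>M. if M = {#} then 1 else 0)"
definition "f + g = Abs_mfps (\<lambda>M. mfps_coeff f M + mfps_coeff g M)"
definition "f - g = Abs_mfps (\<lambda>M. mfps_coeff f M - mfps_coeff g M)"
definition "- f = Abs_mfps (\<lambda>M. - mfps_coeff f M)"
definition "f * g = Abs_mfps (\<lambda>M. \<Sum>A | A \<subseteq># M. mfps_coeff f A * mfps_coeff g (M - A))"

instance
proof
  fix f g h :: "('a, 'b) mfps"
  show "f * g * h = f * (g * h)"
  proof (rule mfps_eqI)
    fix M :: "'a multiset"
    let ?a = "mfps_coeff f" and ?b = "mfps_coeff g" and ?c = "mfps_coeff h"
    have "mfps_coeff (f * g * h) M
        = (\<Sum>(A, B) \<in> (SIGMA A:{A. A \<subseteq># M}. {B. B \<subseteq># A}). ?a B * ?b (A - B) * ?c (M - A))"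
      by (simp add: times_mfps_def sum_distrib_right sum.Sigma finite_submultisets)
    also have "\<dots> = (\<Sum>(A, B) \<in> (SIGMA A:{A. A \<subseteq># M}. {B. B \<subseteq># M - A}).
        ?a A * (?b B * ?c (M - A - B)))"
    proof (rule sum.reindex_bij_witness
        [where i = "\<lambda>(A, B). (A + B, A)" and j = "\<lambda>(A, B). (B, A - B)"])
      fix p :: "'a multiset \<times> 'a multiset"
      assume "p \<in> (SIGMA A:{A. A \<subseteq># M}. {B. B \<subseteq># A})"
      then obtain A B where p: "p = (A, B)" "A \<subseteq># M" "B \<subseteq># A" by blast
      obtain D where "M = A + D" using p(2) unfolding mset_subset_eq_exists_conv by blast
      moreover obtain C where "A = B + C" using p(3) unfolding mset_subset_eq_exists_conv by blast
      ultimately have "p = (B + C, B)" "M = B + C + D" using p(1) by simp_all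
      then show "(case case p of (A, B) \<Rightarrow> (B, A - B) of (A, B) \<Rightarrow> (A + B, A)) = p"
        "(case p of (A, B) \<Rightarrow> (B, A - B)) \<in> (SIGMA A:{A. A \<subseteq># M}. {B. B \<subseteq># M - A})"
        "(case case p of (A, B) \<Rightarrow> (B, A - B) of
           (A, B) \<Rightarrow> ?a A * (?b B * ?c (M - A - B))) =
         (case p of (A, B) \<Rightarrow> ?a B * ?b (A - B) * ?c (M - A))"
        by (simp_all add: mult.assoc add.assoc)
    next
      fix p :: "'a multiset \<times> 'a multiset"
      assume "p \<in> (SIGMA A:{A. A \<subseteq># M}. {B. B \<subseteq># M - A})"
      then obtain B C where p: "p = (B, C)" "B \<subseteq># M" "C \<subseteq># M - B" by blast
      obtain E where E: "M = B + E" using p(2) unfolding mset_subset_eq_exists_conv by blast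
      then have "C \<subseteq># E" using p(3) by simp
      then obtain D where "E = C + D" unfolding mset_subset_eq_exists_conv by blast
      with E have "p = (B, C)" "M = B + C + D" using p(1) by (simp_all add: add.assoc)
      then show "(case case p of (A, B) \<Rightarrow> (A + B, A) of (A, B) \<Rightarrow> (B, A - B)) = p"
        "(case p of (A, B) \<Rightarrow> (A + B, A)) \<in> (SIGMA A:{A. A \<subseteq># M}. {B. B \<subseteq># A})"
        by simp_all
    qed
    also have "\<dots> = mfps_coeff (f * (g * h)) M"
      by (simp add: times_mfps_def sum_distrib_left sum.Sigma finite_submultisets)
    finally show "mfps_coeff (f * g * h) M = mfps_coeff (f * (g * h)) M" .
  qed
  show "f * g = g * f"
  proof (rule mfps_eqI)
    fix M :: "'a multiset"
    show "mfps_coeff (f * g) M = mfps_coeff (g * f) M"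
      unfolding times_mfps_def mfps_coeff_Abs
    proof (rule sum.reindex_bij_witness[where i = "\<lambda>A. M - A" and j = "\<lambda>A. M - A"])
      fix A assume "A \<in> {A. A \<subseteq># M}"
      then have A: "A \<subseteq># M" by simp
      then have *: "M - (M - A) = A"
        unfolding mset_subset_eq_exists_conv by auto
      show "M - (M - A) = A" "M - (M - A) = A" by fact+
      show "M - A \<in> {A. A \<subseteq># M}" "M - A \<in> {A. A \<subseteq># M}" by simp_all
      show "mfps_coeff g (M - A) * mfps_coeff f (M - (M - A)) =
          mfps_coeff f A * mfps_coeff g (M - A)"
        by (simp only: * mult.commute)
    qed
  qed
  show "1 * f = f"
  proof (rule mfps_eqI)
    fix M :: "'a multiset"
    have "mfps_coeff (1 * f) M = (\<Sum>A | A \<subseteq># M. if A = {#} then mfps_coeff f M else 0)"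
      unfolding times_mfps_def mfps_coeff_Abs one_mfps_def by (rule sum.cong) auto
    also have "\<dots> = mfps_coeff f M"
      by (simp add: finite_submultisets)
    finally show "mfps_coeff (1 * f) M = mfps_coeff f M" .
  qed
  show "(f + g) * h = f * h + g * h"
    by (rule mfps_eqI) (simp add: times_mfps_def plus_mfps_def ring_distribs sum.distrib)
  show "(0::('a, 'b) mfps) \<noteq> 1"
  proof
    assume "(0::('a, 'b) mfps) = 1"
    then have "mfps_coeff (0::('a, 'b) mfps) {#} = mfps_coeff 1 {#}" by simp
    then show False by (simp add: zero_mfps_def one_mfps_def)
  qed
qed (rule mfps_eqI; simp add: zero_mfps_def plus_mfps_def minus_mfps_def uminus_mfps_def algebra_simps)+

end

definition mfps_inverse :: "('v, 'a::comm_ring_1) mfps \<Rightarrow> ('v, 'a) mfps" where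
  "mfps_inverse f = (if \<exists>g. f * g = 1 then THE g. f * g = 1 else 0)"

instantiation mfps :: (type, comm_ring_1) inverse
begin

definition "inverse = (mfps_inverse :: ('a, 'b) mfps \<Rightarrow> ('a, 'b) mfps)"
definition "f div g = f * mfps_inverse g" for f g :: "('a, 'b) mfps"

instance ..

end

lemma mfps_inverse_eqI:
  fixes f g :: "('v, 'a::comm_ring_1) mfps"
  assumes "f * g = 1"
  shows "inverse f = g"
proof -
  have "h = g" if "f * h = 1" for h
  proof -
    have "h = h * (f * g)" using assms by simp
    also have "\<dots> = (f * h) * g" by (simp only: ac_simps)
    also have "\<dots> = g" using that by simp
    finally show ?thesis .
  qed
  then show ?thesis
    using assms unfolding inverse_mfps_def mfps_inverse_def by (metis (mono_tags, lifting) the_equality)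
qed

definition mfps_X :: "'v \<Rightarrow> ('v, 'a::comm_ring_1) mfps" where
  "mfps_X v = Abs_mfps (\<lambda>M. if M = {#v#} then 1 else 0)"


section \<open>Dominos and tilings of the oblique strip\<close>

text \<open>A domino is encoded by its orientation and its lower left corner.\<close>

datatype domino = Hor int int | Ver int int

fun region :: "domino \<Rightarrow> (real \<times> real) set" where
  "region (Hor i j) = {of_int i..of_int i + 2} \<times> {of_int j..of_int j + 1}"
| "region (Ver i j) = {of_int i..of_int i + 1} \<times> {of_int j..of_int j + 2}"

fun top_left :: "domino \<Rightarrow> int \<times> int" where
  "top_left (Hor i j) = (i, j + 1)"
| "top_left (Ver i j) = (i, j + 2)"

fun horizontal :: "domino \<Rightarrow> bool" where
  "horizontal (Hor i j) = True"
| "horizontal (Ver i j) = False"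

definition odd_corner :: "domino \<Rightarrow> bool" where
  "odd_corner d \<longleftrightarrow> odd (fst (top_left d) + snd (top_left d))"

definition north_going :: "domino \<Rightarrow> bool" where
  "north_going d \<longleftrightarrow> horizontal d \<and> odd_corner d"

definition south_going :: "domino \<Rightarrow> bool" where
  "south_going d \<longleftrightarrow> horizontal d \<and> \<not> odd_corner d"

definition east_going :: "domino \<Rightarrow> bool" where
  "east_going d \<longleftrightarrow> \<not> horizontal d \<and> odd_corner d"

definition west_going :: "domino \<Rightarrow> bool" where
  "west_going d \<longleftrightarrow> \<not> horizontal d \<and> \<not> odd_corner d"

definition covered_region :: "domino set \<Rightarrow> (real \<times> real) set" where
  "covered_region T = (\<Union>d\<in>T. region d)"

definition tiling :: "nat \<Rightarrow> domino set \<Rightarrow> bool" where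
  "tiling l T \<longleftrightarrow>
     (\<forall>d\<in>T. \<forall>d'\<in>T. d \<noteq> d' \<longrightarrow> interior (region d) \<inter> interior (region d') = {}) \<and>
     {(x, y). \<bar>x - y - real l\<bar> \<le> real l - 1} \<subseteq> covered_region T \<and>
     covered_region T \<subseteq> {(x, y). \<bar>x - y - real l\<bar> \<le> real l + 1}"

definition steep :: "domino set \<Rightarrow> bool" where
  "steep T \<longleftrightarrow> (\<exists>B::real.
     (\<forall>d\<in>T. region d \<subseteq> {(x, y). x + y > B} \<longrightarrow> north_going d \<or> east_going d) \<and>
     (\<forall>d\<in>T. region d \<subseteq> {(x, y). x + y < - B} \<longrightarrow> south_going d \<or> west_going d))"

text \<open>
  \<open>cell i j\<close> is the unit square with lower left corner \<open>(i, j)\<close>. It is centered at the point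
  \<open>(i + 1/2, j + 1/2)\<close>, so integers \<open>i\<close> stand for the half-integers \<open>i + 1/2\<close> below, and
  \<open>cell i (i - m)\<close> is the square centered on the line \<open>y = x - m\<close>.
\<close>

definition cell :: "int \<Rightarrow> int \<Rightarrow> (real \<times> real) set" where
  "cell i j = {of_int i..of_int i + 1} \<times> {of_int j..of_int j + 1}"

definition covered :: "domino set \<Rightarrow> int \<Rightarrow> int \<Rightarrow> bool" where
  "covered T i j \<longleftrightarrow> cell i j \<subseteq> covered_region T"

definition covered_by :: "domino set \<Rightarrow> (domino \<Rightarrow> bool) \<Rightarrow> int \<Rightarrow> int \<Rightarrow> bool" where
  "covered_by T P i j \<longleftrightarrow> (\<exists>d\<in>T. P d \<and> cell i j \<subseteq> region d)"

datatype sign = Plus | Minus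

text \<open>Letters of a word are numbered from 1.\<close>

definition letter :: "sign list \<Rightarrow> nat \<Rightarrow> sign" where
  "letter w i = w ! (i - 1)"

text \<open>
  The square with bottom right corner \<open>(x, x - 2k)\<close> is \<open>cell (x - 1) (x - 2k)\<close>, and the square
  with top left corner \<open>(x, x - 2k + 2)\<close> is \<open>cell x (x - 2k + 1)\<close>.
\<close>

definition has_asymptotic_data :: "nat \<Rightarrow> sign list \<Rightarrow> domino set \<Rightarrow> bool" where
  "has_asymptotic_data l w T \<longleftrightarrow> (\<forall>k\<in>{1..l}.
     (\<forall>\<^sub>F x in at_top. covered_by T
        (case letter w (2 * k - 1) of Plus \<Rightarrow> north_going | Minus \<Rightarrow> east_going)
        (x - 1) (x - 2 * int k)) \<and>
     (\<forall>\<^sub>F x in at_bot. covered_by T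
        (case letter w (2 * k) of Plus \<Rightarrow> west_going | Minus \<Rightarrow> south_going)
        x (x - 2 * int k + 1)))"

definition pure :: "nat \<Rightarrow> domino set \<Rightarrow> bool" where
  "pure l T \<longleftrightarrow> (\<exists>a b :: int. \<forall>i.
     (covered T i i \<longleftrightarrow> i \<ge> a) \<and> (covered T i (i - 2 * int l) \<longleftrightarrow> i \<le> b))"

definition pure_steep_tilings :: "nat \<Rightarrow> sign list \<Rightarrow> domino set set" where
  "pure_steep_tilings l w = {T. tiling l T \<and> steep T \<and> has_asymptotic_data l w T \<and> pure l T}"

fun translate :: "int \<Rightarrow> domino \<Rightarrow> domino" where
  "translate n (Hor i j) = Hor (i + n) (j + n)"
| "translate n (Ver i j) = Ver (i + n) (j + n)"

definition translation_class :: "domino set \<Rightarrow> domino set set" where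
  "translation_class T = {translate n ` T | n. True}"

definition pure_steep_classes :: "nat \<Rightarrow> sign list \<Rightarrow> domino set set set" where
  "pure_steep_classes l w = translation_class ` pure_steep_tilings l w"


section \<open>The minimal tiling\<close>

definition occupied :: "domino set \<Rightarrow> int \<Rightarrow> int \<Rightarrow> bool" where
  "occupied T i j \<longleftrightarrow>
     covered_by T (\<lambda>d. south_going d \<or> west_going d) i j \<or> (i = j \<and> \<not> covered T i j)"

primrec charge :: "sign list \<Rightarrow> nat \<Rightarrow> int" where
  "charge w 0 = 0"
| "charge w (Suc m) = charge w m +
     of_bool (letter w (Suc m) = (if odd (Suc m) then Plus else Minus))"

text \<open>For integers \<open>i\<close> and \<open>c\<close>, the condition \<open>i + 1/2 < c\<close> is equivalent to \<open>i < c\<close>.\<close>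

definition min_tiling :: "nat \<Rightarrow> sign list \<Rightarrow> domino set" where
  "min_tiling l w = (THE T. tiling l T \<and> steep T \<and> has_asymptotic_data l w T \<and>
     (\<forall>m\<in>{0..2 * l}. \<forall>i. occupied T i (i - int m) \<longleftrightarrow> i < charge w m))"


section \<open>Flips and the generating function\<close>

text \<open>
  The \<open>2 \<times> 2\<close> square with lower left corner \<open>(i, j)\<close> has center \<open>(i + 1, j + 1)\<close>, which lies
  on the line \<open>y = x - (i - j)\<close>.
\<close>

definition flip :: "nat \<Rightarrow> domino set \<Rightarrow> domino set \<Rightarrow> bool" where
  "flip k T T' \<longleftrightarrow> (\<exists>i j. i - j = int k \<and>
     (let hs = {Hor i j, Hor i (j + 1)}; vs = {Ver i j, Ver (i + 1) j} in
        hs \<subseteq> T \<and> T' = (T - hs) \<union> vs \<or> vs \<subseteq> T \<and> T' = (T - vs) \<union> hs))"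

text \<open>The list records the diagonals on which the successive flips are centered.\<close>

inductive flip_seq :: "domino set \<Rightarrow> nat list \<Rightarrow> domino set \<Rightarrow> bool" where
  Nil: "flip_seq T [] T"
| Cons: "flip k T T' \<Longrightarrow> flip_seq T' ks T'' \<Longrightarrow> flip_seq T (k # ks) T''"

definition reaches_class :: "nat \<Rightarrow> sign list \<Rightarrow> nat list \<Rightarrow> domino set set \<Rightarrow> bool" where
  "reaches_class l w ks C \<longleftrightarrow> (\<exists>T\<in>C. flip_seq (min_tiling l w) ks T)"

definition flip_monomial :: "nat \<Rightarrow> sign list \<Rightarrow> domino set set \<Rightarrow> nat multiset \<Rightarrow> bool" where
  "flip_monomial l w C M \<longleftrightarrow> (\<exists>ks. reaches_class l w ks C \<and>
     (\<forall>ks'. reaches_class l w ks' C \<longrightarrow> length ks \<le> length ks') \<and> M = mset ks)"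

definition steep_gf :: "nat \<Rightarrow> sign list \<Rightarrow> (nat, int) mfps" where
  "steep_gf l w =
     Abs_mfps (\<lambda>M. int (card {C \<in> pure_steep_classes l w. flip_monomial l w C M}))"

end

theory Submission
  imports Defs
begin

text \<open>
  Reading the particles along the successive diagonals as Maya diagrams turns a pure steep tiling
  into a sequence of partitions that starts and ends with the empty one; the \<open>m\<close>-th step adds
  (letter \<open>+\<close>) or removes (letter \<open>-\<close>) a horizontal strip if \<open>m\<close> is odd and a vertical strip if
  \<open>m\<close> is even. A flip centered on the \<open>k\<close>-th diagonal adds or removes one box of the \<open>k\<close>-th
  partition, and as long as some partition is nonempty a suitably extremal box can be removed.
  Hence the exponent of \<open>x\<^sub>k\<close> is the size of the \<open>k\<close>-th partition.

  The product formula then reflects the commutation relations of vertex operators: exchanging an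
  adjacent pair \<open>+ -\<close> of letters changes one partition only, and a local bijection trades it for a
  partition in the exchanged position together with a number, which is arbitrary if the two steps
  have the same parity and \<open>0\<close> or \<open>1\<close> otherwise. When no inversion of the word is left, only the
  constant sequence of empty partitions remains, so sequences of partitions are in bijection with
  the assignments of such numbers to the inversions of the word.
\<close>

section \<open>Partitions and their strips\<close>

text \<open>The size of every single partition has to be controlled, not only their sum. This works
  because an exchange at position \<open>i\<close> that produces the number \<open>c\<close>
  satisfies \<open>weight (L i) + weight (L' i) = weight (L (i - 1)) + weight (L (i + 1)) +
  c\<close>, and the numbers on the inversions, each counted once on every diagonal from
  \<open>i\<close> to \<open>j - 1\<close>, satisfy the same relation. Both sides of the formula
  therefore agree diagonal by diagonal through all exchanges. The charges of the minimal tiling are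
  what turns strips into dominos: they shift the Maya diagrams so that each particle (even step) or
  hole (odd step) keeps its coordinate or gains 1, and these two moves are a vertical and a
  horizontal domino. Purity makes the outer diagrams half lines, that is, empty partitions. The
  sizes of the partitions bound the number of flips on each diagonal separately. Adding boxes one at
  a time attains all these bounds at once, so all shortest sequences flip every diagonal equally
  often.\<close>

definition is_partition :: "(nat \<Rightarrow> nat) \<Rightarrow> bool" where
  "is_partition p \<longleftrightarrow> antimono p \<and> (\<exists>N. \<forall>n\<ge>N. p n = 0)"

definition boxes :: "(nat \<Rightarrow> nat) \<Rightarrow> (nat \<times> nat) set" where
  "boxes p = {(i, j). j < p i}"

definition weight :: "(nat \<Rightarrow> nat) \<Rightarrow> nat" where
  "weight p = card (boxes p)"

definition conjugate :: "(nat \<Rightarrow> nat) \<Rightarrow> nat \<Rightarrow> nat" where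
  "conjugate p j = (LEAST i. p i \<le> j)"

definition hstrip :: "(nat \<Rightarrow> nat) \<Rightarrow> (nat \<Rightarrow> nat) \<Rightarrow> bool" where
  "hstrip p q \<longleftrightarrow> (\<forall>i. q (Suc i) \<le> p i \<and> p i \<le> q i)"

definition vstrip :: "(nat \<Rightarrow> nat) \<Rightarrow> (nat \<Rightarrow> nat) \<Rightarrow> bool" where
  "vstrip p q \<longleftrightarrow> (\<forall>i. p i \<le> q i \<and> q i \<le> Suc (p i))"

lemma partition_antimono: "is_partition p \<Longrightarrow> i \<le> j \<Longrightarrow> p j \<le> p i"
  by (simp add: is_partition_def antimonoD)

lemma partition_zero [simp]: "is_partition (\<lambda>_. 0)"
  by (simp add: is_partition_def antimono_def)

lemma partitionI: "(\<And>i. p (Suc i) \<le> p i) \<Longrightarrow> (\<And>n. n \<ge> N \<Longrightarrow> p n = 0) \<Longrightarrow> is_partition p"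
  unfolding is_partition_def antimono_iff_le_Suc by blast

text \<open>Both sides say that the box \<open>(i, j)\<close> lies in the diagram of
  \<open>p\<close>. Facts on conjugates are derived from this equivalence instead of the
  \<open>LEAST\<close> operator.\<close>

lemma less_conjugate_iff:
  assumes "is_partition p"
  shows "i < conjugate p j \<longleftrightarrow> j < p i"
proof -
  obtain N where "\<forall>n\<ge>N. p n = 0" using assms unfolding is_partition_def by blast
  then have "p N \<le> j" by simp
  then have "p (conjugate p j) \<le> j" unfolding conjugate_def by (rule LeastI)
  moreover have "j < p i" if "i < conjugate p j"
    using not_less_Least[OF that[unfolded conjugate_def]] by simp
  ultimately show ?thesis
    using partition_antimono[OF assms, of "conjugate p j" i] by linarith
qed

lemma le_conjugate_iff: "is_partition p \<Longrightarrow> conjugate p j \<le> i \<longleftrightarrow> p i \<le> j"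
  using less_conjugate_iff[of p i j] by (simp add: not_less[symmetric])

lemma partition_conjugate [intro, simp]:
  assumes "is_partition p"
  shows "is_partition (conjugate p)"
proof (rule partitionI[where N = "p 0"])
  show "conjugate p (Suc i) \<le> conjugate p i" for i
    unfolding le_conjugate_iff[OF assms] using le_conjugate_iff[OF assms, of i "conjugate p i"] by simp
  show "conjugate p n = 0" if "n \<ge> p 0" for n
    using that le_conjugate_iff[OF assms, of n 0] by simp
qed

lemma conjugate_conjugate [simp]:
  assumes "is_partition p"
  shows "conjugate (conjugate p) = p"
proof
  fix i
  have "x < conjugate (conjugate p) i \<longleftrightarrow> x < p i" for x
    by (simp add: less_conjugate_iff assms)
  then show "conjugate (conjugate p) i = p i" by (metis linorder_neqE_nat order_less_irrefl)
qed

lemma conjugate_zero [simp]: "conjugate (\<lambda>_. 0) = (\<lambda>_. 0)"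
  by (auto simp: conjugate_def)

lemma finite_boxes:
  assumes "is_partition p"
  shows "finite (boxes p)"
proof -
  have "boxes p \<subseteq> {..<conjugate p 0} \<times> {..<p 0}"
  proof
    fix x assume "x \<in> boxes p"
    then obtain i j where x: "x = (i, j)" "j < p i" by (auto simp: boxes_def)
    then have "0 < p i" "j < p 0" using partition_antimono[OF assms, of 0 i] by simp_all
    then show "x \<in> {..<conjugate p 0} \<times> {..<p 0}" using x less_conjugate_iff[OF assms] by simp
  qed
  then show ?thesis by (rule finite_subset) simp
qed

lemma weight_conjugate [simp]:
  assumes "is_partition p"
  shows "weight (conjugate p) = weight p"
proof -
  have "bij_betw prod.swap (boxes (conjugate p)) (boxes p)"
    by (rule bij_betw_byWitness[where f' = prod.swap])
      (auto simp: boxes_def less_conjugate_iff[OF assms])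
  then show ?thesis unfolding weight_def by (rule bij_betw_same_card)
qed

lemma weight_eq_sum:
  assumes "\<And>n. n \<ge> N \<Longrightarrow> p n = 0"
  shows "weight p = (\<Sum>n<N. p n)"
proof -
  have "j < p i \<longleftrightarrow> i < N \<and> j < p i" for i j
    using assms[of i] by (cases "i < N") simp_all
  then have "boxes p = (SIGMA n:{..<N}. {..<p n})"
    unfolding boxes_def by blast
  then show ?thesis by (simp add: weight_def)
qed

text \<open>By \<open>le_conjugate_iff\<close> each inequality between conjugates becomes one
  between rows of \<open>p\<close> and \<open>q\<close>, evaluated at the end of a column, and vice
  versa.\<close>

lemma hstrip_conjugate:
  assumes "is_partition p" "is_partition q"
  shows "hstrip p q \<longleftrightarrow> vstrip (conjugate p) (conjugate q)"
proof
  have p: "p (conjugate p i) \<le> i" and q: "q (conjugate q i) \<le> i" for i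
    using le_conjugate_iff[OF assms(1)] le_conjugate_iff[OF assms(2)] by blast+
  assume h: "hstrip p q"
  show "vstrip (conjugate p) (conjugate q)"
    unfolding vstrip_def le_conjugate_iff[OF assms(1)] le_conjugate_iff[OF assms(2)]
  proof (intro allI conjI)
    fix i
    have "p (conjugate q i) \<le> q (conjugate q i)" using h by (simp add: hstrip_def)
    then show "p (conjugate q i) \<le> i" using q[of i] by simp
    have "q (Suc (conjugate p i)) \<le> p (conjugate p i)" using h by (simp add: hstrip_def)
    then show "q (Suc (conjugate p i)) \<le> i" using p[of i] by simp
  qed
next
  have p: "conjugate p (p i) \<le> i" and q: "conjugate q (q i) \<le> i" for i
    using le_conjugate_iff[OF assms(1)] le_conjugate_iff[OF assms(2)] by blast+
  assume v: "vstrip (conjugate p) (conjugate q)"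
  show "hstrip p q"
    unfolding hstrip_def le_conjugate_iff[OF assms(1), symmetric] le_conjugate_iff[OF assms(2), symmetric]
  proof (intro allI conjI)
    fix i
    have "conjugate p (q i) \<le> conjugate q (q i)" using v by (simp add: vstrip_def)
    then show "conjugate p (q i) \<le> i" using q[of i] by simp
    have "conjugate q (p i) \<le> Suc (conjugate p (p i))" using v by (simp add: vstrip_def)
    then show "conjugate q (p i) \<le> Suc i" using p[of i] by simp
  qed
qed

definition strip :: "bool \<Rightarrow> (nat \<Rightarrow> nat) \<Rightarrow> (nat \<Rightarrow> nat) \<Rightarrow> bool" where
  "strip t p q \<longleftrightarrow> (if t then hstrip p q else vstrip p q)"

definition upper :: "bool \<Rightarrow> bool \<Rightarrow> (nat \<Rightarrow> nat) \<Rightarrow> (nat \<Rightarrow> nat) \<Rightarrow> (nat \<Rightarrow> nat) set" where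
  "upper s t p q = {r. is_partition r \<and> strip s p r \<and> strip t q r}"

text \<open>The kinds trade places with respect to \<open>upper\<close>: after the two letters are
  exchanged, the step of kind \<open>t\<close> comes first and leads from \<open>p\<close> down to
  \<open>r\<close>, and the step of kind \<open>s\<close> leads from \<open>r\<close> up to
  \<open>q\<close>.\<close>

definition lower :: "bool \<Rightarrow> bool \<Rightarrow> (nat \<Rightarrow> nat) \<Rightarrow> (nat \<Rightarrow> nat) \<Rightarrow> (nat \<Rightarrow> nat) set" where
  "lower s t p q = {r. is_partition r \<and> strip t r p \<and> strip s r q}"

text \<open>The exponents that occur in the factor of an inversion: all of them in the geometric
  series for equal kinds, only 0 and 1 in \<open>1 + x\<close> for different kinds.\<close>

definition extra :: "bool \<Rightarrow> nat set" where
  "extra e = (if e then UNIV else {0, 1})"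

text \<open>
  Row \<open>i + 1\<close> of an upper and row \<open>i\<close> of a lower partition range over the same interval, from
  \<open>b (i + 1)\<close> to \<open>t i\<close>; reflecting it exchanges the two, and row \<open>0\<close> of the upper partition
  is unbounded above.
\<close>

lemma upper_lower_bij_hh:
  assumes p: "is_partition p" and q: "is_partition q"
  shows "\<exists>f. bij_betw f (upper True True p q) (lower True True p q \<times> UNIV) \<and>
    (\<forall>r\<in>upper True True p q. weight r + weight (fst (f r)) = weight p + weight q + snd (f r))"
proof -
  define b where "b i = max (p i) (q i)" for i
  define t where "t i = min (p i) (q i)" for i
  define f where "f r = (\<lambda>i. b (Suc i) + t i - r (Suc i), r 0 - b 0)" for r :: "nat \<Rightarrow> nat"
  define h where "h = (\<lambda>(k, g) i. case i of 0 \<Rightarrow> b 0 + g | Suc i \<Rightarrow> b (Suc i) + t i - k i)"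
   
  obtain N1 where N1: "\<And>n. n \<ge> N1 \<Longrightarrow> p n = 0" using p by (auto simp: is_partition_def)
  obtain N2 where N2: "\<And>n. n \<ge> N2 \<Longrightarrow> q n = 0" using q by (auto simp: is_partition_def)
  define N where "N = max N1 N2"
  have N: "p n = 0" "q n = 0" "t n = 0" "b n = 0" if "n \<ge> N" for n
  proof -
    have "n \<ge> N1" "n \<ge> N2" using that by (simp_all add: N_def)
    then have "p n = 0" "q n = 0" using N1 N2 by blast+
    then show "p n = 0" "q n = 0" "t n = 0" "b n = 0" by (simp_all add: t_def b_def)
  qed
  have hs: "strip True p r \<and> strip True q r \<longleftrightarrow> (\<forall>i. b i \<le> r i \<and> r (Suc i) \<le> t i)" for r
    unfolding strip_def hstrip_def b_def t_def if_True max.bounded_iff min.bounded_iff by blast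
  have hs': "strip True r p \<and> strip True r q \<longleftrightarrow> (\<forall>i. b (Suc i) \<le> r i \<and> r i \<le> t i)" for r
    unfolding strip_def hstrip_def b_def t_def if_True max.bounded_iff min.bounded_iff by blast
  have up: "b 0 \<le> r 0" "b (Suc i) \<le> r (Suc i)" "r (Suc i) \<le> t i"
    if "r \<in> upper True True p q" for r i
    using that unfolding upper_def mem_Collect_eq hs by blast+
  have lo: "b (Suc i) \<le> r i" "r i \<le> t i"
    if "r \<in> lower True True p q" for r i
    using that unfolding lower_def mem_Collect_eq hs' by blast+
  have bt: "b (Suc i) \<le> b i" "t (Suc i) \<le> t i" "t i \<le> b i" for i
    using partition_antimono[OF p, of i "Suc i"] partition_antimono[OF q, of i "Suc i"]
    unfolding b_def t_def by linarith+
  \<comment> \<open>If one of the intervals is empty, so are both sides. Its nonemptiness is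
    therefore extracted from a member of either side; it keeps the natural number subtractions from
    being truncated.\<close>
  have tb: "b (Suc i) \<le> t i" if "r \<in> upper True True p q" for i r
    using up[OF that] by (meson le_trans)
  have tb': "b (Suc i) \<le> t i" if "r \<in> lower True True p q" for i r
    using lo[OF that] by (meson le_trans)
  have f_mem: "fst (f r) \<in> lower True True p q" if r: "r \<in> upper True True p q" for r
    unfolding lower_def
  proof (intro CollectI conjI)
    have *: "b (Suc i) \<le> fst (f r) i \<and> fst (f r) i \<le> t i" for i
      using up(2,3)[OF r, of i] tb[OF r, of i] by (auto simp: f_def)
    show "is_partition (fst (f r))"
    proof (rule partitionI[where N = N])
      show "fst (f r) (Suc i) \<le> fst (f r) i" for i
        using *[of "Suc i"] *[of i] tb[OF r, of i] bt(3)[of "Suc i"]  by linarith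
      show "fst (f r) n = 0" if "n \<ge> N" for n using *[of n] N(3)[OF that] by simp
    qed
    show "strip True (fst (f r)) p" "strip True (fst (f r)) q"
      using * hs'[of "fst (f r)"] by blast+
  qed
  have h_mem: "h (k, g) \<in> upper True True p q" if r: "k \<in> lower True True p q" for k g
    unfolding upper_def
  proof (intro CollectI conjI)
    have *: "b (Suc i) \<le> h (k, g) (Suc i) \<and> h (k, g) (Suc i) \<le> t i" for i
      using lo[OF r, of i] tb'[OF r, of i] by (auto simp: h_def)
    have **: "b i \<le> h (k, g) i" for i
      using *[of "i - 1"] by (cases i) (auto simp: h_def)
    show "is_partition (h (k, g))"
    proof (rule partitionI[where N = "Suc N"])
      show "h (k, g) (Suc i) \<le> h (k, g) i" for i
        using *[of i] **[of i] bt(3)[of i] by linarith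
      show "h (k, g) n = 0" if "n \<ge> Suc N" for n using *[of "n - 1"] N(3)[of "n - 1"] that by simp
    qed
    show "strip True p (h (k, g))" "strip True q (h (k, g))"
      using * ** hs[of "h (k, g)"] by blast+
  qed
  have "bij_betw f (upper True True p q) (lower True True p q \<times> UNIV)"
  proof (rule bij_betw_byWitness[where f' = h])
    show "\<forall>a\<in>upper True True p q. h (f a) = a"
    proof
      fix a assume a: "a \<in> upper True True p q"
      show "h (f a) = a"
      proof
        fix i show "h (f a) i = a i"
          using up(1)[OF a] up(2,3)[OF a, of "i - 1"] by (cases i) (auto simp: h_def f_def)
      qed
    qed
    show "\<forall>a'\<in>lower True True p q \<times> UNIV. f (h a') = a'"
    proof (clarify)
      fix k :: "nat \<Rightarrow> nat" and g :: nat
      assume k: "k \<in> lower True True p q"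
      have "b (Suc i) + t i - (b (Suc i) + t i - k i) = k i" for i
        using lo[OF k, of i] by simp
      then show "f (h (k, g)) = (k, g)" by (simp add: h_def f_def)
    qed
    show "f ` upper True True p q \<subseteq> lower True True p q \<times> UNIV"
      using f_mem by (simp add: image_subset_iff mem_Times_iff)
    show "h ` (lower True True p q \<times> UNIV) \<subseteq> upper True True p q"
      using h_mem by auto
  qed
  moreover have "weight r + weight (fst (f r)) = weight p + weight q + snd (f r)"
    if r: "r \<in> upper True True p q" for r
  proof -
    have rN: "r n = 0" if "n \<ge> Suc N" for n
      using up(3)[OF r, of "n - 1"] that N(3)[of "n - 1"] by simp
    \<comment> \<open>Row \<open>i + 1\<close> and its reflection add up to
      \<open>b (i + 1) + t i\<close>, row 0 contributes \<open>b 0\<close> plus the number, and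
      \<open>b i + t i = p i + q i\<close> since these are a maximum and a minimum.\<close>
    have rb: "r (Suc i) + (b (Suc i) + t i - r (Suc i)) = b (Suc i) + t i" for i
      using up(2,3)[OF r, of i] by linarith
    have "weight r + weight (fst (f r)) = (\<Sum>i<Suc N. r i) + (\<Sum>i<N. fst (f r) i)"
      using rN weight_eq_sum[of "Suc N" r] weight_eq_sum[of N "fst (f r)"] N by (simp add: f_def)
    also have "\<dots> = r 0 + (\<Sum>i<N. r (Suc i) + (b (Suc i) + t i - r (Suc i)))"
      by (simp only: sum.lessThan_Suc_shift sum.distrib f_def fst_conv add.assoc)
    also have "\<dots> = r 0 + (\<Sum>i<N. b (Suc i) + t i)"
      by (simp only: rb)
    also have "\<dots> = (\<Sum>i<Suc N. b i) + (\<Sum>i<N. t i) + snd (f r)"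
      unfolding sum.lessThan_Suc_shift sum.distrib using up(1)[OF r] by (simp add: f_def)
    also have "\<dots> = (\<Sum>i<N. b i + t i) + snd (f r)"
      by (simp add: sum.distrib N)
    also have "(\<Sum>i<N. b i + t i) = (\<Sum>i<N. p i + q i)"
      by (rule sum.cong) (auto simp: b_def t_def)
    also have "\<dots> = weight p + weight q"
      using N by (simp add: sum.distrib weight_eq_sum[of N])
    finally show ?thesis .
  qed
  ultimately show ?thesis by blast
qed

lemma conjugate_upper:
  assumes "is_partition p" "is_partition q"
  shows "bij_betw conjugate (upper False False p q) (upper True True (conjugate p) (conjugate q))"
  by (rule bij_betw_byWitness[where f' = conjugate])
    (auto simp: upper_def strip_def assms hstrip_conjugate)

lemma conjugate_lower:
  assumes "is_partition p" "is_partition q"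
  shows "bij_betw conjugate (lower True True (conjugate p) (conjugate q)) (lower False False p q)"
  by (rule bij_betw_byWitness[where f' = conjugate])
    (auto simp: lower_def strip_def assms hstrip_conjugate)

text \<open>Transposition turns vertical strips into horizontal ones and preserves weights, so the
  horizontal bijection is conjugated and its number kept.\<close>

lemma upper_lower_bij_vv:
  assumes p: "is_partition p" and q: "is_partition q"
  shows "\<exists>f. bij_betw f (upper False False p q) (lower False False p q \<times> UNIV) \<and>
    (\<forall>r\<in>upper False False p q. weight r + weight (fst (f r)) = weight p + weight q + snd (f r))"
proof -
  obtain f where f: "bij_betw f (upper True True (conjugate p) (conjugate q))
      (lower True True (conjugate p) (conjugate q) \<times> UNIV)"
    "\<And>r. r \<in> upper True True (conjugate p) (conjugate q) \<Longrightarrow>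
      weight r + weight (fst (f r)) = weight (conjugate p) + weight (conjugate q) + snd (f r)"
    using upper_lower_bij_hh[of "conjugate p" "conjugate q"] p q by auto
  have "bij_betw (map_prod conjugate id \<circ> (f \<circ> conjugate)) (upper False False p q)
      (lower False False p q \<times> UNIV)"
    by (rule bij_betw_trans[OF bij_betw_trans[OF conjugate_upper[OF p q] f(1)]
        bij_betw_map_prod[OF conjugate_lower[OF p q] bij_betw_id]])
  moreover have "weight r + weight (fst ((map_prod conjugate id \<circ> (f \<circ> conjugate)) r)) =
      weight p + weight q + snd ((map_prod conjugate id \<circ> (f \<circ> conjugate)) r)"
    if r: "r \<in> upper False False p q" for r
  proof -
    have c: "conjugate r \<in> upper True True (conjugate p) (conjugate q)"
      using conjugate_upper[OF p q] r by (auto simp: bij_betw_def)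
    then have "fst (f (conjugate r)) \<in> lower True True (conjugate p) (conjugate q)"
      using bij_betwE[OF f(1)] by (simp add: mem_Times_iff)
    then have "is_partition (fst (f (conjugate r)))" "is_partition r"
      using r by (auto simp: lower_def upper_def)
    then show ?thesis using f(2)[OF c] p q by simp
  qed
  ultimately show ?thesis by blast
qed


text \<open>One binary choice more on the upper side amounts to a number in \<open>{0, 1}\<close>;
  this is the origin of the factors \<open>1 + x\<close>.\<close>

lemma bij_betw_Pow_insert:
  assumes "z \<notin> B"
  shows "bij_betw (\<lambda>S. (S - {z}, of_bool (z \<in> S) :: nat)) (Pow (insert z B)) (Pow B \<times> {0, 1})"
  by (rule bij_betw_byWitness[where f' = "\<lambda>(S, g). if g = 1 then insert z S else S"])
    (use assms in \<open>auto split: if_splits\<close>)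

text \<open>
  For strips of different kinds every row has at most two possible values. The rows with a choice
  are \<open>A\<close> for the upper and \<open>B\<close> for the lower partition; they interlace, so \<open>A\<close> has
  exactly one element more, and the two sides are the power sets of \<open>A\<close> and \<open>B\<close>.
\<close>

lemma upper_lower_bij_hv:
  assumes p: "is_partition p" and q: "is_partition q"
  shows "\<exists>f. bij_betw f (upper True False p q) (lower True False p q \<times> {0, 1}) \<and>
    (\<forall>r\<in>upper True False p q. weight r + weight (fst (f r)) = weight p + weight q + snd (f r))"
proof (cases "\<forall>i. p i \<le> Suc (q i) \<and> q (Suc i) \<le> p i")
  \<comment> \<open>Any common neighbour, upper or lower, forces these inequalities, so without them
    both sides are empty.\<close>
  case False
  have "upper True False p q = {}"
  proof (rule ccontr)
    assume "upper True False p q \<noteq> {}"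
    then obtain r where r: "\<And>i. r (Suc i) \<le> p i \<and> p i \<le> r i \<and> q i \<le> r i \<and> r i \<le> Suc (q i)"
      by (auto simp: upper_def strip_def hstrip_def vstrip_def)
    have "p i \<le> Suc (q i) \<and> q (Suc i) \<le> p i" for i
      using r[of i] r[of "Suc i"] by linarith
    then show False using False by blast
  qed
  moreover have "lower True False p q = {}"
  proof (rule ccontr)
    assume "lower True False p q \<noteq> {}"
    then obtain r where r: "\<And>i. r i \<le> p i \<and> p i \<le> Suc (r i) \<and> q (Suc i) \<le> r i \<and> r i \<le> q i"
      by (auto simp: lower_def strip_def hstrip_def vstrip_def)
    have "p i \<le> Suc (q i) \<and> q (Suc i) \<le> p i" for i
      using r[of i] by linarith
    then show False using False by blast
  qed
  ultimately show ?thesis by (auto simp: bij_betw_def)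
next
  case True
  then have pq: "p i \<le> Suc (q i)" "q (Suc i) \<le> p i" for i by auto
  have pS: "p (Suc i) \<le> p i" and qS: "q (Suc i) \<le> q i" for i
    using partition_antimono[OF p, of i "Suc i"] partition_antimono[OF q, of i "Suc i"] by simp_all
  obtain N1 where N1: "\<forall>n\<ge>N1. p n = 0" using p unfolding is_partition_def by blast
  obtain N2 where N2: "\<forall>n\<ge>N2. q n = 0" using q unfolding is_partition_def by blast
  define N where "N = Suc (max N1 N2)"
  have N: "p n = 0" "q n = 0" if "Suc n \<ge> N" for n
    using that N1 N2 by (simp_all add: N_def)
  \<comment> \<open>Where \<open>e i\<close> fails, \<open>p i = q i + 1\<close> and row
    \<open>i\<close> is forced in the upper and in the lower partition. \<open>d i\<close> says that
    the bound \<open>p (i - 1)\<close> lets row \<open>i\<close> of an upper partition exceed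
    \<open>q i\<close>; \<open>d (Suc i)\<close> says that the bound \<open>q (Suc i)\<close> lets
    row \<open>i\<close> of a lower partition fall below \<open>p i\<close>.\<close>
  define e where "e i \<longleftrightarrow> p i \<le> q i" for i
  define d where "d i \<longleftrightarrow> i = 0 \<or> q i < p (i - 1)" for i
  define A where "A = {i. e i \<and> d i}"
  define B where "B = {i. e i \<and> d (Suc i)}"
  have not_d: "\<not> d n" if "n \<ge> N" for n
    using that N(1)[of "n - 1"] by (cases n) (auto simp: d_def N_def)
  have A_sub: "A \<subseteq> {..<N}" and B_sub: "B \<subseteq> {..<N}"
    using not_d le_SucI unfolding A_def B_def by (auto simp: not_le[symmetric])
  \<comment> \<open>The identity survives every row \<open>M\<close>: if \<open>e M\<close>, the row
    joins \<open>A\<close> when \<open>d M\<close> and joins \<open>B\<close> when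
    \<open>d (Suc M)\<close>; otherwise both \<open>d M\<close> and \<open>d (Suc M)\<close> hold
    and neither set grows. At \<open>N\<close> the term with \<open>d\<close> vanishes, which leaves
    one element more in \<open>A\<close> than in \<open>B\<close>.\<close>
  have card_eq: "card (A \<inter> {..<M}) + of_bool (d M) = card (B \<inter> {..<M}) + 1" for M
  proof (induction M)
    case 0
    then show ?case by (simp add: d_def)
  next
    case (Suc M)
    show ?case
    proof (cases "e M")
      case True
      then show ?thesis using Suc by (auto simp: lessThan_Suc Int_insert_right A_def B_def)
    next
      case False
      then have lt: "q M < p M" by (simp add: e_def)
      have "d M" using lt pS[of "M - 1"] by (cases M) (auto simp: d_def)
      moreover have "d (Suc M)" using lt qS[of M] by (simp add: d_def)
      ultimately show ?thesis
        using Suc False by (simp add: lessThan_Suc Int_insert_right A_def B_def)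
    qed
  qed
  have fin: "finite A" "finite B" using A_sub B_sub finite_subset by blast+
  obtain z where z: "z \<notin> B" using fin(2) ex_new_if_finite infinite_UNIV_nat by blast
  have "card A = card (insert z B)"
    using card_eq[of N] not_d[of N] z fin A_sub B_sub by (simp add: Int_absorb2)
  \<comment> \<open>Any bijection will do, because the weights depend only on the number of chosen
    rows.\<close>
  then obtain h where h: "bij_betw h A (insert z B)"
    using fin finite_same_card_bij by blast
  \<comment> \<open>\<open>r0\<close> is the least upper and \<open>k0\<close> the greatest lower
    partition. A subset of \<open>A\<close> raises rows of \<open>r0\<close> by one, a subset of
    \<open>B\<close> lowers rows of \<open>k0\<close> by one.\<close>
  define r0 where "r0 i = q i + of_bool (\<not> e i)" for i
  define k0 where "k0 i = p i - of_bool (\<not> e i)" for i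
  have ek: "k0 i + of_bool (\<not> e i) = p i" for i
    by (auto simp: k0_def e_def)
  have up_iff: "r \<in> upper True False p q \<longleftrightarrow>
      (\<forall>i. r0 i \<le> r i \<and> r i \<le> r0 i + of_bool (i \<in> A))" for r
  proof
    assume r: "r \<in> upper True False p q"
    have r: "r (Suc i) \<le> p i" "p i \<le> r i" "q i \<le> r i" "r i \<le> Suc (q i)" for i
      using r by (auto simp: upper_def strip_def hstrip_def vstrip_def)
    show "\<forall>i. r0 i \<le> r i \<and> r i \<le> r0 i + of_bool (i \<in> A)"
    proof
      fix i
      have "\<not> d i \<Longrightarrow> r i \<le> q i" using r(1)[of "i - 1"] by (auto simp: d_def not_less)
      then show "r0 i \<le> r i \<and> r i \<le> r0 i + of_bool (i \<in> A)"
        using r(2-4)[of i] by (auto simp: r0_def e_def A_def)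
    qed
  next
    assume r: "\<forall>i. r0 i \<le> r i \<and> r i \<le> r0 i + of_bool (i \<in> A)"
    have r1: "q i \<le> r i" "r i \<le> Suc (q i)" "p i \<le> r i" for i
      using r[rule_format, of i] pq(1)[of i] by (auto simp: r0_def e_def A_def of_bool_def split: if_splits)
    have r2: "r (Suc i) \<le> p i" for i
    proof (cases "d (Suc i)")
      case True
      then show ?thesis using r1(2)[of "Suc i"] by (simp add: d_def)
    next
      case False
      then have "e (Suc i)" using pS[of i] pq(2)[of i] by (simp add: d_def e_def)
      then show ?thesis using r[rule_format, of "Suc i"] False pq(2)[of i]
        by (simp add: r0_def A_def)
    qed
    have "is_partition r"
    proof (rule partitionI[where N = N])
      show "r (Suc i) \<le> r i" for i using r1(3)[of i] r2[of i] by simp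
      show "r n = 0" if "n \<ge> N" for n
        using r2[of "n - 1"] N(1)[of "n - 1"] that by (cases n) (auto simp: N_def)
    qed
    then show "r \<in> upper True False p q"
      using r1 r2 by (auto simp: upper_def strip_def hstrip_def vstrip_def)
  qed
  have lo_iff: "k \<in> lower True False p q \<longleftrightarrow>
      (\<forall>i. k i \<le> k0 i \<and> k0 i \<le> k i + of_bool (i \<in> B))" for k
  proof
    assume k: "k \<in> lower True False p q"
    have k: "k i \<le> p i" "p i \<le> Suc (k i)" "q (Suc i) \<le> k i" "k i \<le> q i" for i
      using k by (auto simp: lower_def strip_def hstrip_def vstrip_def)
    show "\<forall>i. k i \<le> k0 i \<and> k0 i \<le> k i + of_bool (i \<in> B)"
    proof
      fix i
      show "k i \<le> k0 i \<and> k0 i \<le> k i + of_bool (i \<in> B)"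
        using k[of i] by (auto simp: k0_def e_def B_def d_def)
    qed
  next
    assume k: "\<forall>i. k i \<le> k0 i \<and> k0 i \<le> k i + of_bool (i \<in> B)"
    have k1: "k i \<le> p i" "p i \<le> Suc (k i)" "k i \<le> q i" "q (Suc i) \<le> k i" for i
      using k[rule_format, of i] pq(1)[of i] pq(2)[of i] qS[of i]
      by (auto simp: k0_def e_def B_def d_def of_bool_def split: if_splits)
    have "is_partition k"
    proof (rule partitionI[where N = N])
      show "k (Suc i) \<le> k i" for i using k1(3)[of "Suc i"] k1(4)[of i] by simp
      show "k n = 0" if "n \<ge> N" for n using k1(1)[of n] N(1)[of n] that by simp
    qed
    then show "k \<in> lower True False p q"
      using k1 by (auto simp: lower_def strip_def hstrip_def vstrip_def)
  qed
  have k0_pos: "k0 i > 0" if "i \<in> B" for i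
    using that by (auto simp: B_def d_def k0_def)
  define \<alpha> where "\<alpha> r = {i \<in> A. r i = Suc (r0 i)}" for r
  define \<beta> where "\<beta> S i = k0 i - of_bool (i \<in> S)" for S i
  have \<alpha>: "bij_betw \<alpha> (upper True False p q) (Pow A)"
  proof (rule bij_betw_byWitness[where f' = "\<lambda>S i. r0 i + of_bool (i \<in> S)"])
    show "\<forall>r\<in>upper True False p q. (\<lambda>i. r0 i + of_bool (i \<in> \<alpha> r)) = r"
    proof (intro ballI ext)
      fix r i assume "r \<in> upper True False p q"
      then have "r0 i \<le> r i" "r i \<le> r0 i + of_bool (i \<in> A)" using up_iff by blast+
      then show "r0 i + of_bool (i \<in> \<alpha> r) = r i" by (cases "i \<in> A") (auto simp: \<alpha>_def)
    qed
    show "\<forall>S\<in>Pow A. \<alpha> (\<lambda>i. r0 i + of_bool (i \<in> S)) = S"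
      by (auto simp: \<alpha>_def split: if_splits)
    show "(\<lambda>S i. r0 i + of_bool (i \<in> S)) ` Pow A \<subseteq> upper True False p q"
      by (auto simp: up_iff)
  qed (auto simp: \<alpha>_def)
  have \<beta>: "bij_betw \<beta> (Pow B) (lower True False p q)"
  proof (rule bij_betw_byWitness[where f' = "\<lambda>k. {i \<in> B. k i \<noteq> k0 i}"])
    show "\<forall>S\<in>Pow B. {i \<in> B. \<beta> S i \<noteq> k0 i} = S"
    proof
      fix S assume "S \<in> Pow B"
      moreover have "\<beta> S i \<noteq> k0 i \<longleftrightarrow> i \<in> S" if "i \<in> B" for i
        using k0_pos[OF that] by (auto simp: \<beta>_def)
      ultimately show "{i \<in> B. \<beta> S i \<noteq> k0 i} = S" by blast
    qed
    show "\<forall>k\<in>lower True False p q. \<beta> {i \<in> B. k i \<noteq> k0 i} = k"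
    proof (intro ballI ext)
      fix k i assume "k \<in> lower True False p q"
      then have "k i \<le> k0 i" "k0 i \<le> k i + of_bool (i \<in> B)" using lo_iff by blast+
      then show "\<beta> {i \<in> B. k i \<noteq> k0 i} i = k i" by (cases "i \<in> B") (auto simp: \<beta>_def)
    qed
    show "\<beta> ` Pow B \<subseteq> lower True False p q"
      by (auto simp: lo_iff \<beta>_def)
  qed auto
  define \<gamma> where "\<gamma> S = (S - {z}, of_bool (z \<in> S) :: nat)" for S
  define f where "f = map_prod \<beta> id \<circ> (\<gamma> \<circ> (image h \<circ> \<alpha>))"
  have "bij_betw f (upper True False p q) (lower True False p q \<times> {0, 1})"
    unfolding f_def \<gamma>_def
    by (rule bij_betw_trans[OF bij_betw_trans[OF bij_betw_trans[OF \<alpha> bij_betw_Pow[OF h]]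
        bij_betw_Pow_insert[OF z]] bij_betw_map_prod[OF \<beta> bij_betw_id]])
  moreover have "weight r + weight (fst (f r)) = weight p + weight q + snd (f r)"
    if r: "r \<in> upper True False p q" for r
  proof -
    define S where "S = \<alpha> r"
    define S' where "S' = h ` S"
    have SA: "S \<subseteq> A" by (auto simp: S_def \<alpha>_def)
    then have S'B: "S' - {z} \<subseteq> B" using h by (auto simp: S'_def bij_betw_def)
    have finS: "finite S" "finite S'" using SA fin(1) finite_subset by (auto simp: S'_def)
    have "card S = card S'"
      unfolding S'_def using h SA by (metis bij_betw_def card_image inj_on_subset)
    also have "\<dots> = card (S' - {z}) + of_bool (z \<in> S')"
      using card_Suc_Diff1[OF finS(2), of z] by (cases "z \<in> S'") auto
    finally have cS: "card S = card (S' - {z}) + of_bool (z \<in> S')" .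
    have sum_ind: "(\<Sum>i<N. of_bool (i \<in> X)) = card X" if "X \<subseteq> {..<N}" for X
      using that by (simp add: Int_absorb1)
    have re: "r i = q i + of_bool (\<not> e i) + of_bool (i \<in> S)" for i
    proof -
      have "r0 i \<le> r i" "r i \<le> r0 i + of_bool (i \<in> A)" using r up_iff by blast+
      then show ?thesis by (cases "i \<in> A") (auto simp: S_def \<alpha>_def r0_def)
    qed
    have ke: "\<beta> (S' - {z}) i + of_bool (\<not> e i) + of_bool (i \<in> S' - {z}) = p i" for i
      using ek[of i] k0_pos[of i] S'B by (auto simp: \<beta>_def)
    have rn: "r n = 0" if "n \<ge> N" for n
      using re[of n] N[of n] that SA A_sub by (auto simp: e_def)
    have kn: "\<beta> (S' - {z}) n = 0" if "n \<ge> N" for n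
      using ke[of n] N[of n] that by simp
    \<comment> \<open>The number of rows where \<open>e\<close> fails enters the weights of
      \<open>r\<close> and of \<open>p\<close> alike and cancels; what remains is
      \<open>card S - card (S' - {z})\<close>, the number attached to \<open>r\<close>.\<close>
    have wr: "weight r = weight q + (\<Sum>i<N. of_bool (\<not> e i)) + card S"
      using N rn SA A_sub sum_ind[of S] by (simp add: weight_eq_sum[of N] re sum.distrib)
    have "weight p = (\<Sum>i<N. \<beta> (S' - {z}) i + of_bool (\<not> e i) + of_bool (i \<in> S' - {z}))"
      using N by (simp only: weight_eq_sum[of N] ke le_SucI)
    then have "weight p = weight (\<beta> (S' - {z})) + (\<Sum>i<N. of_bool (\<not> e i)) + card (S' - {z})"
      using kn S'B B_sub sum_ind[of "S' - {z}"] by (simp only: weight_eq_sum[of N] sum.distrib order_trans)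
    with wr cS show ?thesis by (simp add: f_def \<gamma>_def S'_def S_def)
  qed
  ultimately show ?thesis by blast
qed

lemma upper_lower_bij:
  assumes p: "is_partition p" and q: "is_partition q"
  shows "\<exists>f. bij_betw f (upper s t p q) (lower s t p q \<times> extra (s = t)) \<and>
    (\<forall>r\<in>upper s t p q. weight r + weight (fst (f r)) = weight p + weight q + snd (f r))"
proof -
  consider "s" "t" | "\<not> s" "\<not> t" | "s" "\<not> t" | "\<not> s" "t" by blast
  then show ?thesis
  proof cases
    case 1
    then show ?thesis using upper_lower_bij_hh[OF p q] by (simp add: extra_def)
  next
    case 2
    then show ?thesis using upper_lower_bij_vv[OF p q] by (simp add: extra_def)
  next
    case 3
    then show ?thesis using upper_lower_bij_hv[OF p q] by (simp add: extra_def)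
  next
    case 4
    have "upper False True p q = upper True False q p" "lower False True p q = lower True False q p"
      by (auto simp: upper_def lower_def)
    then show ?thesis using 4 upper_lower_bij_hv[OF q p] by (simp add: extra_def add.commute)
  qed
qed

section \<open>Sequences of partitions and fillings of inversions\<close>

definition signed_strip :: "bool \<times> bool \<Rightarrow> (nat \<Rightarrow> nat) \<Rightarrow> (nat \<Rightarrow> nat) \<Rightarrow> bool" where
  "signed_strip c p q \<longleftrightarrow> (if fst c then strip (snd c) p q else strip (snd c) q p)"

text \<open>The kind of a step is part of \<open>u\<close> and not read off the parity of
  \<open>m\<close>, because exchanging adjacent letters carries kinds to positions of the other
  parity. All values from \<open>n\<close> on are pinned to the empty partition, so a sequence is
  determined by its relevant part.\<close>

definition seqs :: "nat \<Rightarrow> (nat \<Rightarrow> bool \<times> bool) \<Rightarrow> (nat \<Rightarrow> nat \<Rightarrow> nat) set" where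
  "seqs n u = {L. (\<forall>m. is_partition (L m)) \<and> L 0 = (\<lambda>_. 0) \<and> (\<forall>m\<ge>n. L m = (\<lambda>_. 0)) \<and>
    (\<forall>m\<in>{1..n}. signed_strip (u m) (L (m - 1)) (L m))}"

definition inversions :: "nat \<Rightarrow> (nat \<Rightarrow> bool \<times> bool) \<Rightarrow> (nat \<times> nat) set" where
  "inversions n u = {(i, j). 1 \<le> i \<and> i < j \<and> j \<le> n \<and> fst (u i) \<and> \<not> fst (u j)}"

definition fillings :: "nat \<Rightarrow> (nat \<Rightarrow> bool \<times> bool) \<Rightarrow> (nat \<times> nat \<Rightarrow> nat) set" where
  "fillings n u = {g. \<forall>p. if p \<in> inversions n u
    then g p \<in> extra (snd (u (fst p)) = snd (u (snd p))) else g p = 0}"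

text \<open>The exponent of \<open>x_k\<close> in the product over all \<open>(i, j)\<close> in
  \<open>I\<close> of the \<open>g (i, j)\<close>-th powers of the monomials
  \<open>x_i ... x_(j-1)\<close>.\<close>

definition arc_weight :: "(nat \<times> nat \<Rightarrow> nat) \<Rightarrow> (nat \<times> nat) set \<Rightarrow> nat \<Rightarrow> nat" where
  "arc_weight g I k = (\<Sum>p\<in>I. of_bool (fst p \<le> k \<and> k < snd p) * g p)"

lemma finite_inversions: "finite (inversions n u)"
  by (rule finite_subset[of _ "{..n} \<times> {..n}"]) (auto simp: inversions_def)

text \<open>Starting from the plus of some inversion, the first minus after it has a plus
  immediately before it.\<close>

lemma inversions_adjacent:
  assumes "inversions n u \<noteq> {}"
  obtains i where "1 \<le> i" "i < n" "fst (u i)" "\<not> fst (u (Suc i))"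
proof -
  obtain a b where ab: "1 \<le> a" "a < b" "b \<le> n" "fst (u a)" "\<not> fst (u b)"
    using assms by (auto simp: inversions_def)
  define c where "c = (LEAST c. a < c \<and> \<not> fst (u c))"
  have c: "a < c" "\<not> fst (u c)" "c \<le> b"
    using LeastI[of "\<lambda>c. a < c \<and> \<not> fst (u c)" b] Least_le[of "\<lambda>c. a < c \<and> \<not> fst (u c)" b] ab
    by (auto simp: c_def)
  have "fst (u (c - 1))"
  proof (rule ccontr)
    assume *: "\<not> fst (u (c - 1))"
    then have "a < c - 1" using c(1) ab(4) by (metis Suc_pred' less_Suc_eq less_nat_zero_code not_gr_zero)
    then show False
      using not_less_Least[of "c - 1" "\<lambda>c. a < c \<and> \<not> fst (u c)"] * c(1) by (auto simp: c_def)
  qed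
  then show ?thesis using that[of "c - 1"] c ab by simp
qed

lemma signed_strip_zero [simp]: "signed_strip c (\<lambda>_. 0) (\<lambda>_. 0)"
  by (simp add: signed_strip_def strip_def hstrip_def vstrip_def)

lemma strip_le: "strip t p q \<Longrightarrow> p i \<le> q i"
  by (auto simp: strip_def hstrip_def vstrip_def split: if_splits)

text \<open>All minus letters precede all plus letters. If a plus occurs at or before
  \<open>m\<close>, the partitions only grow from \<open>m\<close> on, up to the empty last one;
  otherwise they only shrink from the empty first one down to \<open>m\<close>. In both cases the
  \<open>m\<close>-th partition lies inside an empty one.\<close>

lemma seqs_no_inversions:
  assumes "inversions n u = {}"
  shows "seqs n u = {\<lambda>_ _. 0}"
proof
  show "{\<lambda>_ _. 0} \<subseteq> seqs n u" by (auto simp: seqs_def)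
  show "seqs n u \<subseteq> {\<lambda>_ _. 0}"
  proof
    fix L assume L: "L \<in> seqs n u"
    have step: "signed_strip (u m) (L (m - 1)) (L m)" if "1 \<le> m" "m \<le> n" for m
      using L that by (simp add: seqs_def)
    have "L m = (\<lambda>_. 0)" for m
    proof (cases "m < n")
      case False
      then show ?thesis using L by (simp add: seqs_def)
    next
      case True
      show ?thesis
      proof (cases "\<exists>i. 1 \<le> i \<and> i \<le> m \<and> fst (u i)")
        case True
        then obtain i where i: "1 \<le> i" "i \<le> m" "fst (u i)" by blast
        have "L k x = 0" if "k \<le> n" "m \<le> k" for k x
          using that
        proof (induction rule: inc_induct)
          case base
          then show ?case using L by (simp add: seqs_def)
        next
          case (step k)
          have "(i, Suc k) \<notin> inversions n u" using assms by simp
          then have "fst (u (Suc k))" using i step \<open>m \<le> k\<close> by (auto simp: inversions_def)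
          then have "L k x \<le> L (Suc k) x"
            using \<open>\<And>m. 1 \<le> m \<Longrightarrow> m \<le> n \<Longrightarrow> signed_strip (u m) (L (m - 1)) (L m)\<close>[of "Suc k"] step
            by (auto simp: signed_strip_def dest: strip_le[where i = x])
          then show ?case using step by simp
        qed
        then show ?thesis using \<open>m < n\<close> by auto
      next
        case False
        have "L k x = 0" if "k \<le> m" for k x
          using that
        proof (induction k)
          case 0
          then show ?case using L by (simp add: seqs_def)
        next
          case (Suc k)
          have "\<not> fst (u (Suc k))" using False Suc by auto
          then have "L (Suc k) x \<le> L k x"
            using step[of "Suc k"] Suc \<open>m < n\<close> by (auto simp: signed_strip_def dest: strip_le[where i = x])
          then show ?case using Suc by simp
        qed
        then show ?thesis by auto
      qed
    qed
    then show "L \<in> {\<lambda>_ _. 0}" by auto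
  qed
qed

section \<open>Exchanging one adjacent pair of letters \<open>+ -\<close>\<close>

context
  fixes n i :: nat and u :: "nat \<Rightarrow> bool \<times> bool"
  assumes i: "1 \<le> i" "i < n" and plus: "fst (u i)" and minus: "\<not> fst (u (Suc i))"
begin

private abbreviation \<sigma> where "\<sigma> \<equiv> Transposition.transpose i (Suc i)"

private abbreviation e where "e \<equiv> extra (snd (u i) = snd (u (Suc i)))"

text \<open>The exchange alters the relative order of no pair of positions other than
  \<open>i\<close> and \<open>i + 1\<close>, and that pair reads \<open>- +\<close> in the exchanged
  word.\<close>

lemma inversions_swap:
  "inversions n u = insert (i, Suc i) (map_prod \<sigma> \<sigma> ` inversions n (u \<circ> \<sigma>))"
  "(i, Suc i) \<notin> map_prod \<sigma> \<sigma> ` inversions n (u \<circ> \<sigma>)"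
proof -
  have *: "map_prod \<sigma> \<sigma> p \<in> inversions n u \<and> map_prod \<sigma> \<sigma> p \<noteq> (i, Suc i)"
    if "p \<in> inversions n (u \<circ> \<sigma>)" for p
  proof -
    obtain a b where p: "p = (a, b)" by (cases p)
    have ab: "1 \<le> a" "a < b" "b \<le> n" "fst (u (\<sigma> a))" "\<not> fst (u (\<sigma> b))"
      using that p by (auto simp: inversions_def)
    have "a \<noteq> i" "b \<noteq> Suc i" using ab plus minus by auto
    then show ?thesis
      using ab i unfolding p by (auto simp: inversions_def Transposition.transpose_def)
  qed
  have **: "p \<in> map_prod \<sigma> \<sigma> ` inversions n (u \<circ> \<sigma>)"
    if "p \<in> inversions n u" "p \<noteq> (i, Suc i)" for p
  proof -
    obtain a b where p: "p = (a, b)" by (cases p)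
    have ab: "1 \<le> a" "a < b" "b \<le> n" "fst (u a)" "\<not> fst (u b)"
      using that p by (auto simp: inversions_def)
    have "a \<noteq> Suc i" "b \<noteq> i" using ab plus minus by auto
    then have "(\<sigma> a, \<sigma> b) \<in> inversions n (u \<circ> \<sigma>)"
      using ab i that(2) unfolding p by (auto simp: inversions_def Transposition.transpose_def)
    then show ?thesis unfolding p by (auto intro!: image_eqI[where x = "(\<sigma> a, \<sigma> b)"])
  qed
  have "(i, Suc i) \<in> inversions n u" using i plus minus by (auto simp: inversions_def)
  show "inversions n u = insert (i, Suc i) (map_prod \<sigma> \<sigma> ` inversions n (u \<circ> \<sigma>))"
  proof (intro subset_antisym subsetI)
    fix p assume "p \<in> inversions n u"
    then show "p \<in> insert (i, Suc i) (map_prod \<sigma> \<sigma> ` inversions n (u \<circ> \<sigma>))"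
      using **[of p] by (cases "p = (i, Suc i)") simp_all
  next
    fix p assume "p \<in> insert (i, Suc i) (map_prod \<sigma> \<sigma> ` inversions n (u \<circ> \<sigma>))"
    then show "p \<in> inversions n u"
    proof (elim insertE imageE)
      fix q assume "p = map_prod \<sigma> \<sigma> q" "q \<in> inversions n (u \<circ> \<sigma>)"
      then show ?thesis using *[of q] by simp
    qed (use \<open>(i, Suc i) \<in> inversions n u\<close> in simp)
  qed
  show "(i, Suc i) \<notin> map_prod \<sigma> \<sigma> ` inversions n (u \<circ> \<sigma>)"
  proof
    assume "(i, Suc i) \<in> map_prod \<sigma> \<sigma> ` inversions n (u \<circ> \<sigma>)"
    then obtain q where "(i, Suc i) = map_prod \<sigma> \<sigma> q" "q \<in> inversions n (u \<circ> \<sigma>)"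
      by (rule imageE)
    then show False using *[of q] by simp
  qed
qed

lemma map_swap_swap [simp]: "map_prod \<sigma> \<sigma> (map_prod \<sigma> \<sigma> p) = p"
  by (cases p) simp

lemma inj_map_swap: "inj_on (map_prod \<sigma> \<sigma>) X"
  by (rule inj_on_inverseI[where g = "map_prod \<sigma> \<sigma>"]) simp

lemma card_inversions_swap: "card (inversions n u) = Suc (card (inversions n (u \<circ> \<sigma>)))"
  using inversions_swap finite_inversions by (simp add: card_image[OF inj_map_swap])

private definition extend :: "(nat \<times> nat \<Rightarrow> nat) \<times> nat \<Rightarrow> nat \<times> nat \<Rightarrow> nat" where
  "extend = (\<lambda>(g, c) p. if p = (i, Suc i) then c else g (map_prod \<sigma> \<sigma> p))"

lemma mem_swap_image: "p \<in> map_prod \<sigma> \<sigma> ` X \<longleftrightarrow> map_prod \<sigma> \<sigma> p \<in> X"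
proof
  assume "map_prod \<sigma> \<sigma> p \<in> X"
  then show "p \<in> map_prod \<sigma> \<sigma> ` X"
    using image_eqI[of p "map_prod \<sigma> \<sigma>" "map_prod \<sigma> \<sigma> p"] by simp
qed auto

lemma mem_inversions_swap: "p \<in> inversions n (u \<circ> \<sigma>) \<longleftrightarrow>
    map_prod \<sigma> \<sigma> p \<in> inversions n u \<and> map_prod \<sigma> \<sigma> p \<noteq> (i, Suc i)"
  using inversions_swap mem_swap_image[of "map_prod \<sigma> \<sigma> p"] by auto

lemma extend_bij: "bij_betw extend (fillings n (u \<circ> \<sigma>) \<times> e) (fillings n u)"
\<comment> \<open>The pair that \<sigma> sends to \<open>(i, Suc i)\<close> is not an inversion of
  the exchanged word, so a filling must vanish there; the number found at \<open>(i, Suc i)\<close>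
  goes to the second component instead.\<close>
proof (rule bij_betw_byWitness[where f' = "\<lambda>g.
    (\<lambda>p. if map_prod \<sigma> \<sigma> p = (i, Suc i) then 0 else g (map_prod \<sigma> \<sigma> p), g (i, Suc i))"])
  show "extend ` (fillings n (u \<circ> \<sigma>) \<times> e) \<subseteq> fillings n u"
  proof (clarify)
    fix g c assume g: "g \<in> fillings n (u \<circ> \<sigma>)" and c: "c \<in> e"
    show "extend (g, c) \<in> fillings n u"
      unfolding fillings_def
    proof (intro CollectI allI)
      fix p :: "nat \<times> nat"
      have "if map_prod \<sigma> \<sigma> p \<in> inversions n (u \<circ> \<sigma>)
        then g (map_prod \<sigma> \<sigma> p) \<in> extra (snd (u (fst p)) = snd (u (snd p)))
        else g (map_prod \<sigma> \<sigma> p) = 0"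
        using g[unfolded fillings_def, simplified, rule_format, of "fst (map_prod \<sigma> \<sigma> p)" "snd (map_prod \<sigma> \<sigma> p)"]
        by (cases p) auto
      then show "if p \<in> inversions n u then extend (g, c) p \<in> extra (snd (u (fst p)) = snd (u (snd p)))
          else extend (g, c) p = 0"
        using c inversions_swap mem_swap_image[of p] by (auto simp: extend_def)
    qed
  qed
  show "(\<lambda>g. (\<lambda>p. if map_prod \<sigma> \<sigma> p = (i, Suc i) then 0 else g (map_prod \<sigma> \<sigma> p), g (i, Suc i))) `
      fillings n u \<subseteq> fillings n (u \<circ> \<sigma>) \<times> e"
  proof (clarify, intro conjI)
    fix g assume g: "g \<in> fillings n u"
    have gp: "if p \<in> inversions n u then g p \<in> extra (snd (u (fst p)) = snd (u (snd p)))
        else g p = 0" for p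
      using g unfolding fillings_def by blast
    show "(\<lambda>p. if map_prod \<sigma> \<sigma> p = (i, Suc i) then 0 else g (map_prod \<sigma> \<sigma> p)) \<in> fillings n (u \<circ> \<sigma>)"
      unfolding fillings_def
    proof (intro CollectI allI)
      fix p :: "nat \<times> nat"
      show "if p \<in> inversions n (u \<circ> \<sigma>)
        then (if map_prod \<sigma> \<sigma> p = (i, Suc i) then 0 else g (map_prod \<sigma> \<sigma> p))
          \<in> extra (snd ((u \<circ> \<sigma>) (fst p)) = snd ((u \<circ> \<sigma>) (snd p)))
        else (if map_prod \<sigma> \<sigma> p = (i, Suc i) then 0 else g (map_prod \<sigma> \<sigma> p)) = 0"
        using gp[of "map_prod \<sigma> \<sigma> p"] mem_inversions_swap[of p] by (auto split: if_splits)
    qed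
    show "g (i, Suc i) \<in> e"
      using gp[of "(i, Suc i)"] i plus minus by (auto simp: inversions_def)
  qed
  show "\<forall>gc\<in>fillings n (u \<circ> \<sigma>) \<times> e.
      (\<lambda>p. if map_prod \<sigma> \<sigma> p = (i, Suc i) then 0 else extend gc (map_prod \<sigma> \<sigma> p), extend gc (i, Suc i)) = gc"
  proof (clarify, intro conjI ext)
    fix g c p assume g: "g \<in> fillings n (u \<circ> \<sigma>)"
    have "map_prod \<sigma> \<sigma> p = (i, Suc i) \<Longrightarrow> p \<notin> inversions n (u \<circ> \<sigma>)"
      using mem_inversions_swap by blast
    moreover have "if p \<in> inversions n (u \<circ> \<sigma>)
        then g p \<in> extra (snd ((u \<circ> \<sigma>) (fst p)) = snd ((u \<circ> \<sigma>) (snd p))) else g p = 0"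
      using g unfolding fillings_def by blast
    ultimately have "map_prod \<sigma> \<sigma> p = (i, Suc i) \<Longrightarrow> g p = 0" by simp
    then show "(if map_prod \<sigma> \<sigma> p = (i, Suc i) then 0 else extend (g, c) (map_prod \<sigma> \<sigma> p)) = g p"
      by (auto simp: extend_def)
  qed (simp add: extend_def)
  show "\<forall>g\<in>fillings n u. extend (\<lambda>p. if map_prod \<sigma> \<sigma> p = (i, Suc i) then 0
      else g (map_prod \<sigma> \<sigma> p), g (i, Suc i)) = g"
    by (auto simp: extend_def)
qed

text \<open>The counterpart for fillings of the weight relation of the local bijection. An inversion
  of the exchanged word neither starts at \<open>i\<close> nor ends at \<open>i + 1\<close>; hence
  what it contributes at \<open>i\<close> before and after the exchange adds up to what it
  contributes at \<open>i - 1\<close> and \<open>i + 1\<close>. The new inversion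
  \<open>(i, Suc i)\<close> is counted only at \<open>i\<close> and adds \<open>c\<close>.\<close>

lemma arc_weight_extend:
  fixes g :: "nat \<times> nat \<Rightarrow> nat" and c :: nat
  defines "h \<equiv> arc_weight (extend (g, c)) (inversions n u)"
    and "h' \<equiv> arc_weight g (inversions n (u \<circ> \<sigma>))"
  shows "k \<noteq> i \<Longrightarrow> h k = h' k" and "h i + h' i = h' (i - 1) + h' (Suc i) + c"
proof -
  have *: "arc_weight (extend (g, c)) (inversions n u) k = of_bool (k = i) * c +
      (\<Sum>p\<in>inversions n (u \<circ> \<sigma>). of_bool (\<sigma> (fst p) \<le> k \<and> k < \<sigma> (snd p)) * g p)" for k
  proof -
    have "(\<Sum>p\<in>map_prod \<sigma> \<sigma> ` inversions n (u \<circ> \<sigma>).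
          of_bool (fst p \<le> k \<and> k < snd p) * extend (g, c) p) =
        (\<Sum>p\<in>inversions n (u \<circ> \<sigma>). of_bool (\<sigma> (fst p) \<le> k \<and> k < \<sigma> (snd p)) * g p)"
      unfolding sum.reindex[OF inj_map_swap, unfolded o_def]
    proof (rule sum.cong[OF refl])
      fix p assume "p \<in> inversions n (u \<circ> \<sigma>)"
      then have "extend (g, c) (map_prod \<sigma> \<sigma> p) = g p"
        using mem_inversions_swap[of p] by (auto simp: extend_def)
      then show "of_bool (fst (map_prod \<sigma> \<sigma> p) \<le> k \<and> k < snd (map_prod \<sigma> \<sigma> p)) * extend (g, c) (map_prod \<sigma> \<sigma> p) =
         of_bool (\<sigma> (fst p) \<le> k \<and> k < \<sigma> (snd p)) * g p"
        by (cases p) simp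
    qed
    moreover have "of_bool (fst (i, Suc i) \<le> k \<and> k < snd (i, Suc i)) = (of_bool (k = i) :: nat)"
      by auto
    moreover have "extend (g, c) (i, Suc i) = c" by (simp add: extend_def)
    ultimately show ?thesis
      unfolding arc_weight_def inversions_swap(1)
        sum.insert[OF finite_imageI[OF finite_inversions] inversions_swap(2)] by (simp only:)
  qed
  have ne: "fst p \<noteq> i" "snd p \<noteq> Suc i" "fst p < snd p" if "p \<in> inversions n (u \<circ> \<sigma>)" for p
    using that plus minus by (auto simp: inversions_def)
  show "h k = h' k" if "k \<noteq> i"
  proof -
    have "of_bool (\<sigma> (fst p) \<le> k \<and> k < \<sigma> (snd p)) = (of_bool (fst p \<le> k \<and> k < snd p) :: nat)"
      if "p \<in> inversions n (u \<circ> \<sigma>)" for p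
      using ne[OF that] \<open>k \<noteq> i\<close> by (auto simp: Transposition.transpose_def)
    then show ?thesis
      unfolding h_def h'_def * using that by (simp add: arc_weight_def)
  qed
  have "of_bool (\<sigma> (fst p) \<le> i \<and> i < \<sigma> (snd p)) * g p + of_bool (fst p \<le> i \<and> i < snd p) * g p =
      of_bool (fst p \<le> i - 1 \<and> i - 1 < snd p) * g p + of_bool (fst p \<le> Suc i \<and> Suc i < snd p) * g p"
    if "p \<in> inversions n (u \<circ> \<sigma>)" for p
    using ne[OF that] i by (auto simp: Transposition.transpose_def)
  then have "(\<Sum>p\<in>inversions n (u \<circ> \<sigma>). of_bool (\<sigma> (fst p) \<le> i \<and> i < \<sigma> (snd p)) * g p) +
    (\<Sum>p\<in>inversions n (u \<circ> \<sigma>). of_bool (fst p \<le> i \<and> i < snd p) * g p) =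
    (\<Sum>p\<in>inversions n (u \<circ> \<sigma>). of_bool (fst p \<le> i - 1 \<and> i - 1 < snd p) * g p) +
    (\<Sum>p\<in>inversions n (u \<circ> \<sigma>). of_bool (fst p \<le> Suc i \<and> Suc i < snd p) * g p)"
    unfolding sum.distrib[symmetric] by (rule sum.cong[OF refl])
  then show "h i + h' i = h' (i - 1) + h' (Suc i) + c"
    unfolding h_def h'_def * by (simp add: arc_weight_def)
qed

lemma seqs_swap:
  "\<exists>f. bij_betw f (seqs n u) (seqs n (u \<circ> \<sigma>) \<times> e) \<and>
    (\<forall>L\<in>seqs n u. (\<forall>k. k \<noteq> i \<longrightarrow> fst (f L) k = L k) \<and>
      weight (L i) + weight (fst (f L) i) = weight (L (i - 1)) + weight (L (Suc i)) + snd (f L))"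
proof -
  let ?s = "snd (u i)" and ?t = "snd (u (Suc i))"
  have "\<forall>p q. is_partition p \<and> is_partition q \<longrightarrow> (\<exists>f.
    bij_betw f (upper ?s ?t p q) (lower ?s ?t p q \<times> e) \<and>
    (\<forall>r\<in>upper ?s ?t p q. weight r + weight (fst (f r)) = weight p + weight q + snd (f r)))"
    using upper_lower_bij by blast
  then obtain \<phi> where \<phi>: "\<And>p q. is_partition p \<Longrightarrow> is_partition q \<Longrightarrow>
      bij_betw (\<phi> p q) (upper ?s ?t p q) (lower ?s ?t p q \<times> e)"
    "\<And>p q r. is_partition p \<Longrightarrow> is_partition q \<Longrightarrow> r \<in> upper ?s ?t p q \<Longrightarrow>
      weight r + weight (fst (\<phi> p q r)) = weight p + weight q + snd (\<phi> p q r)"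
    by metis
  define \<psi> where "\<psi> p q = the_inv_into (upper ?s ?t p q) (\<phi> p q)" for p q
  have \<psi>: "\<psi> p q x \<in> upper ?s ?t p q" "\<phi> p q (\<psi> p q x) = x"
    if "is_partition p" "is_partition q" "x \<in> lower ?s ?t p q \<times> e" for p q x
    using \<phi>(1)[OF that(1,2)] that(3) unfolding \<psi>_def
    by (metis bij_betw_def order_refl the_inv_into_into,
        metis bij_betw_def f_the_inv_into_f)
  have \<phi>\<psi>: "\<psi> p q (\<phi> p q r) = r" "\<phi> p q r \<in> lower ?s ?t p q \<times> e"
    if "is_partition p" "is_partition q" "r \<in> upper ?s ?t p q" for p q r
    using the_inv_into_f_f[OF bij_betw_imp_inj_on[OF \<phi>(1)[OF that(1,2)]] that(3)]
      bij_betwE[OF \<phi>(1)[OF that(1,2)], rule_format, OF that(3)]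
    unfolding \<psi>_def by blast+
  \<comment> \<open>The conditions that do not involve the \<open>i\<close>-th partition. They are
    the same for both words, so only membership in \<open>upper\<close> or \<open>lower\<close> over
    the two neighbours distinguishes the two sets of sequences, and the local bijection can be
    applied in place.\<close>
  define rest where "rest L \<longleftrightarrow> (\<forall>m. m \<noteq> i \<longrightarrow> is_partition (L m)) \<and> L 0 = (\<lambda>_. 0) \<and>
    (\<forall>m\<ge>n. L m = (\<lambda>_. 0)) \<and>
    (\<forall>m\<in>{1..n} - {i, Suc i}. signed_strip (u m) (L (m - 1)) (L m))" for L :: "nat \<Rightarrow> nat \<Rightarrow> nat"
  have split: "{1..n} = insert i (insert (Suc i) ({1..n} - {i, Suc i}))" using i by auto
  have seqs_u: "L \<in> seqs n u \<longleftrightarrow> rest L \<and> L i \<in> upper ?s ?t (L (i - 1)) (L (Suc i))" for L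
  proof -
    have "(\<forall>m\<in>{1..n}. signed_strip (u m) (L (m - 1)) (L m)) \<longleftrightarrow>
      (\<forall>m\<in>{1..n} - {i, Suc i}. signed_strip (u m) (L (m - 1)) (L m)) \<and>
      strip ?s (L (i - 1)) (L i) \<and> strip ?t (L (Suc i)) (L i)"
      by (subst split) (use plus minus in \<open>auto simp: signed_strip_def\<close>)
    moreover have "(\<forall>m. is_partition (L m)) \<longleftrightarrow> (\<forall>m. m \<noteq> i \<longrightarrow> is_partition (L m)) \<and> is_partition (L i)"
      by metis
    ultimately show ?thesis unfolding seqs_def rest_def upper_def mem_Collect_eq by argo
  qed
  have seqs_u': "L \<in> seqs n (u \<circ> \<sigma>) \<longleftrightarrow> rest L \<and> L i \<in> lower ?s ?t (L (i - 1)) (L (Suc i))" for L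
  proof -
    have "(\<forall>m\<in>{1..n}. signed_strip ((u \<circ> \<sigma>) m) (L (m - 1)) (L m)) \<longleftrightarrow>
      (\<forall>m\<in>{1..n} - {i, Suc i}. signed_strip (u m) (L (m - 1)) (L m)) \<and>
      strip ?t (L i) (L (i - 1)) \<and> strip ?s (L i) (L (Suc i))"
      by (subst split) (use plus minus in \<open>auto simp: signed_strip_def\<close>)
    moreover have "(\<forall>m. is_partition (L m)) \<longleftrightarrow> (\<forall>m. m \<noteq> i \<longrightarrow> is_partition (L m)) \<and> is_partition (L i)"
      by metis
    ultimately show ?thesis unfolding seqs_def rest_def lower_def mem_Collect_eq by argo
  qed
  have rest_upd: "rest (L(i := r)) \<longleftrightarrow> rest L" for L r
    using i unfolding rest_def by (auto simp: fun_upd_def)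
  have rest_p: "is_partition (L (i - 1))" "is_partition (L (Suc i))" if "rest L" for L
    using that i by (simp_all add: rest_def)
  have ne: "i - 1 \<noteq> i" "Suc i \<noteq> i" using i by auto
  define f where "f L = (let x = \<phi> (L (i - 1)) (L (Suc i)) (L i) in (L(i := fst x), snd x))" for L
  define h where "h = (\<lambda>(L, c). L(i := \<psi> (L (i - 1)) (L (Suc i)) (L i, c)))"
  have "bij_betw f (seqs n u) (seqs n (u \<circ> \<sigma>) \<times> e)"
  proof (rule bij_betw_byWitness[where f' = h])
    show "\<forall>L\<in>seqs n u. h (f L) = L"
      using \<phi>\<psi>(1) rest_p ne by (auto simp: seqs_u f_def h_def Let_def)
    show "\<forall>x\<in>seqs n (u \<circ> \<sigma>) \<times> e. f (h x) = x"
      using \<psi>(2) rest_p ne by (auto simp: seqs_u' f_def h_def Let_def)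
    show "f ` seqs n u \<subseteq> seqs n (u \<circ> \<sigma>) \<times> e"
    proof
      fix x assume "x \<in> f ` seqs n u"
      then obtain L where L: "rest L" "L i \<in> upper ?s ?t (L (i - 1)) (L (Suc i))" "x = f L"
        using seqs_u by blast
      show "x \<in> seqs n (u \<circ> \<sigma>) \<times> e"
        using \<phi>\<psi>(2)[OF rest_p[OF L(1)] L(2)] L(1) ne
        by (simp add: L(3) f_def Let_def mem_Times_iff seqs_u' rest_upd)
    qed
    show "h ` (seqs n (u \<circ> \<sigma>) \<times> e) \<subseteq> seqs n u"
    proof (clarify)
      fix L c assume "L \<in> seqs n (u \<circ> \<sigma>)" and c: "c \<in> e"
      then have L: "rest L" "L i \<in> lower ?s ?t (L (i - 1)) (L (Suc i))" using seqs_u' by blast+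
      show "h (L, c) \<in> seqs n u"
        using \<psi>(1)[OF rest_p[OF L(1)], of "(L i, c)"] L c ne
        by (simp add: h_def seqs_u rest_upd)
    qed
  qed
  moreover have "(\<forall>k. k \<noteq> i \<longrightarrow> fst (f L) k = L k) \<and>
      weight (L i) + weight (fst (f L) i) = weight (L (i - 1)) + weight (L (Suc i)) + snd (f L)"
    if "L \<in> seqs n u" for L
    using that \<phi>(2) rest_p by (auto simp: seqs_u f_def Let_def)
  ultimately show ?thesis by blast
qed

text \<open>Away from \<open>i\<close> nothing changes. At \<open>i\<close>, weight and arc weight
  satisfy the same linear relation, whose other terms agree by the assumption on
  \<open>f'\<close>.\<close>

lemma seqs_fillings_step:
  assumes f': "bij_betw f' (seqs n (u \<circ> \<sigma>)) (fillings n (u \<circ> \<sigma>))"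
    "\<And>L k. L \<in> seqs n (u \<circ> \<sigma>) \<Longrightarrow> weight (L k) = arc_weight (f' L) (inversions n (u \<circ> \<sigma>)) k"
  shows "\<exists>f. bij_betw f (seqs n u) (fillings n u) \<and>
    (\<forall>L\<in>seqs n u. \<forall>k. weight (L k) = arc_weight (f L) (inversions n u) k)"
proof -
  obtain s where s: "bij_betw s (seqs n u) (seqs n (u \<circ> \<sigma>) \<times> e)"
    "\<And>L k. L \<in> seqs n u \<Longrightarrow> k \<noteq> i \<Longrightarrow> fst (s L) k = L k"
    "\<And>L. L \<in> seqs n u \<Longrightarrow> weight (L i) + weight (fst (s L) i) =
        weight (L (i - 1)) + weight (L (Suc i)) + snd (s L)"
    using seqs_swap by blast
  define f where "f = extend \<circ> (map_prod f' id \<circ> s)"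
  have "bij_betw f (seqs n u) (fillings n u)"
    unfolding f_def
    by (rule bij_betw_trans[OF bij_betw_trans[OF s(1) bij_betw_map_prod[OF f'(1) bij_betw_id]] extend_bij])
  moreover have "weight (L k) = arc_weight (f L) (inversions n u) k" if L: "L \<in> seqs n u" for L k
  proof -
    obtain L' c where L': "s L = (L', c)" by fastforce
    then have mem: "L' \<in> seqs n (u \<circ> \<sigma>)" using bij_betwE[OF s(1)] L by fastforce
    have fL: "f L = extend (f' L', c)" by (simp add: f_def L')
    have eq: "L' k = L k" if "k \<noteq> i" for k using s(2)[OF L that] L' by simp
    show ?thesis
    proof (cases "k = i")
      case False
      then show ?thesis
        using arc_weight_extend(1)[of k "f' L'" c] f'(2)[OF mem, of k] eq[of k] fL by simp
    next
      case True
      have "weight (L i) + weight (L' i) = weight (L' (i - 1)) + weight (L' (Suc i)) + c"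
        using s(3)[OF L] L' eq[of "i - 1"] eq[of "Suc i"] i by simp
      then show ?thesis
        using arc_weight_extend(2)[of "f' L'" c] True fL by (simp add: f'(2)[OF mem])
    qed
  qed
  ultimately show ?thesis by blast
qed

end

theorem seqs_fillings:
  "\<exists>f. bij_betw f (seqs n u) (fillings n u) \<and>
    (\<forall>L\<in>seqs n u. \<forall>k. weight (L k) = arc_weight (f L) (inversions n u) k)"
proof (induction "card (inversions n u)" arbitrary: u)
  case 0
  then have e: "inversions n u = {}" using finite_inversions by simp
  then have "fillings n u = {\<lambda>_. 0}" by (auto simp: fillings_def)
  then have "bij_betw (\<lambda>_. \<lambda>_. 0) (seqs n u) (fillings n u)"
    unfolding seqs_no_inversions[OF e] by (simp add: bij_betw_def)
  moreover have "weight (\<lambda>_. 0) = 0" by (simp add: weight_def boxes_def)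
  ultimately show ?case
    using e by (intro exI[of _ "\<lambda>_ _. 0"]) (auto simp: arc_weight_def seqs_no_inversions)
next
  case (Suc c)
  then have "inversions n u \<noteq> {}" by auto
  then obtain i where i: "1 \<le> i" "i < n" "fst (u i)" "\<not> fst (u (Suc i))"
    by (rule inversions_adjacent)
  have "c = card (inversions n (u \<circ> Transposition.transpose i (Suc i)))"
    using card_inversions_swap[OF i] Suc(2) by simp
  from Suc(1)[OF this] show ?case using seqs_fillings_step[OF i] by blast
qed

section \<open>The product as a counting series\<close>

definition mfps_monom :: "'v multiset \<Rightarrow> ('v, 'a::comm_ring_1) mfps" where
  "mfps_monom A = Abs_mfps (\<lambda>M. if M = A then 1 else 0)"

text \<open>For nonempty \<open>A\<close>, the sum of the powers of the monomial \<open>A\<close>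
  with exponents in \<open>G\<close>, given by its coefficients because \<open>G\<close> may be
  infinite.\<close>

definition mfps_multiples :: "nat set \<Rightarrow> 'v multiset \<Rightarrow> ('v, 'a::comm_ring_1) mfps" where
  "mfps_multiples G A = Abs_mfps (\<lambda>M. if \<exists>r\<in>G. M = repeat_mset r A then 1 else 0)"

lemma mfps_coeff_monom_mult:
  "mfps_coeff (mfps_monom A * f) M = (if A \<subseteq># M then mfps_coeff f (M - A) else 0)"
proof -
  have "mfps_coeff (mfps_monom A * f) M =
      (\<Sum>B | B \<subseteq># M. if B = A then mfps_coeff f (M - A) else 0)"
    unfolding times_mfps_def mfps_coeff_Abs mfps_monom_def by (rule sum.cong) auto
  then show ?thesis using finite_submultisets[of M] by simp
qed

lemma mfps_monom_mult: "mfps_monom A * mfps_monom B = mfps_monom (A + B)"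
proof (rule mfps_eqI)
  fix M :: "'a multiset"
  have "A \<subseteq># M \<and> M - A = B \<longleftrightarrow> M = A + B" by auto
  then show "mfps_coeff (mfps_monom A * mfps_monom B) M = mfps_coeff (mfps_monom (A + B)) M"
    unfolding mfps_coeff_monom_mult by (auto simp: mfps_monom_def)
qed

lemma mfps_X_eq_monom: "mfps_X x = mfps_monom {#x#}"
  by (simp add: mfps_X_def mfps_monom_def)

lemma prod_mfps_X: "finite A \<Longrightarrow> prod mfps_X A = mfps_monom (mset_set A)"
proof (induction rule: finite_induct)
  case empty
  then show ?case by (simp add: one_mfps_def mfps_monom_def)
next
  case (insert x F)
  then show ?case by (simp add: mfps_X_eq_monom mfps_monom_mult)
qed

lemma one_plus_monom: "A \<noteq> {#} \<Longrightarrow> 1 + mfps_monom A = mfps_multiples {0, 1} A"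
  by (rule mfps_eqI) (auto simp: plus_mfps_def one_mfps_def mfps_monom_def mfps_multiples_def)

text \<open>The product telescopes: when \<open>A\<close> divides \<open>M\<close>, the multiset
  \<open>M\<close> is a multiple of \<open>A\<close> iff \<open>M - A\<close> is, so every
  coefficient cancels except the one at the empty multiset.\<close>

lemma inverse_one_minus_monom:
  fixes A :: "'v multiset"
  assumes "A \<noteq> {#}"
  shows "1 / (1 - mfps_monom A) = (mfps_multiples UNIV A :: ('v, 'a::comm_ring_1) mfps)"
proof -
  have "(1 - mfps_monom A) * mfps_multiples UNIV A = (1 :: ('v, 'a) mfps)"
  proof (rule mfps_eqI)
    fix M :: "'v multiset"
    let ?g = "mfps_multiples UNIV A :: ('v, 'a) mfps"
    have *: "mfps_coeff ((1 - mfps_monom A) * ?g) M =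
        mfps_coeff ?g M - (if A \<subseteq># M then mfps_coeff ?g (M - A) else 0)"
      unfolding left_diff_distrib mult_1_left mfps_coeff_monom_mult[symmetric]
      by (simp add: minus_mfps_def)
    show "mfps_coeff ((1 - mfps_monom A) * ?g) M = mfps_coeff 1 M"
    proof (cases "\<exists>r. M = repeat_mset r A")
      case True
      then obtain r where r: "M = repeat_mset r A" by blast
      show ?thesis
      proof (cases r)
        case 0
        then show ?thesis using r assms unfolding *
          by (auto simp: mfps_multiples_def one_mfps_def intro: exI[of _ 0])
      next
        case (Suc s)
        then have "A \<subseteq># M" "M - A = repeat_mset s A" "M \<noteq> {#}" using r assms by auto
        then show ?thesis using r unfolding * by (auto simp: mfps_multiples_def one_mfps_def)
      qed
    next
      case False
      have "\<nexists>r. M - A = repeat_mset r A" if "A \<subseteq># M"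
      proof
        assume "\<exists>r. M - A = repeat_mset r A"
        then obtain r where "M - A = repeat_mset r A" by blast
        then have "M = repeat_mset (Suc r) A" using that by (metis repeat_mset_Suc subset_mset.add_diff_inverse)
        then show False using False by blast
      qed
      moreover have "M \<noteq> {#}" using False by (metis repeat_mset_0)
      ultimately show ?thesis using False unfolding * by (auto simp: mfps_multiples_def one_mfps_def)
    qed
  qed
  from mfps_inverse_eqI[OF this] show ?thesis
    by (simp add: divide_mfps_def inverse_mfps_def)
qed

lemma repeat_mset_inject:
  assumes "A \<noteq> {#}"
  shows "inj (\<lambda>r. repeat_mset r A)"
proof (rule injI)
  fix r s assume "repeat_mset r A = repeat_mset s A"
  then have "r * size A = s * size A" by (metis size_repeat_mset)
  then show "r = s" using assms by simp
qed

text \<open>A monomial of the product arises by choosing an exponent \<open>g p\<close> in every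
  factor. Finiteness is proved along with the count, since \<open>card\<close> is 0 on infinite
  sets.\<close>

lemma coeff_prod_multiples:
  fixes A :: "'i \<Rightarrow> 'v multiset" and G :: "'i \<Rightarrow> nat set"
  assumes "finite I" "\<And>p. p \<in> I \<Longrightarrow> A p \<noteq> {#}"
  defines "S \<equiv> \<lambda>I M. {g. (\<forall>p. if p \<in> I then g p \<in> G p else g p = 0) \<and>
      (\<Sum>p\<in>I. repeat_mset (g p) (A p)) = M}"
  shows "finite (S I M) \<and>
    mfps_coeff (\<Prod>p\<in>I. mfps_multiples (G p) (A p)) M = int (card (S I M))"
  using assms(1,2)
proof (induction arbitrary: M rule: finite_induct)
  case empty
  have "S {} M = (if M = {#} then {\<lambda>_. 0} else {})" by (auto simp: S_def)
  then show ?case by (simp add: one_mfps_def)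
next
  case (insert x F)
  \<comment> \<open>The exponents of the new factor that fit into \<open>M\<close>. They are
    finitely many because \<open>A x\<close> is nonempty, so different exponents give different
    submultisets of \<open>M\<close>.\<close>
  define R where "R = {r \<in> G x. repeat_mset r (A x) \<subseteq># M}"
  let ?m = "\<lambda>r. repeat_mset r (A x)"
  have inj: "inj_on ?m X" for X
    using repeat_mset_inject[of "A x"] insert.prems inj_on_subset by blast
  have "?m ` R \<subseteq> {B. B \<subseteq># M}" by (auto simp: R_def)
  then have finR: "finite R" using finite_submultisets finite_subset inj finite_imageD by metis
  let ?P = "\<Prod>p\<in>F. mfps_multiples (G p) (A p) :: ('v, int) mfps"
  have "mfps_coeff (\<Prod>p\<in>insert x F. mfps_multiples (G p) (A p)) M =
      (\<Sum>B | B \<subseteq># M. (if \<exists>r\<in>G x. B = ?m r then 1 else 0) * mfps_coeff ?P (M - B))"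
    using insert.hyps by (simp add: times_mfps_def mfps_multiples_def)
  also have "\<dots> = (\<Sum>B\<in>?m ` R. mfps_coeff ?P (M - B))"
    by (rule sum.mono_neutral_cong_right) (auto simp: R_def finite_submultisets)
  also have "\<dots> = (\<Sum>r\<in>R. mfps_coeff ?P (M - ?m r))"
    by (simp add: sum.reindex[OF inj] o_def)
  also have "\<dots> = (\<Sum>r\<in>R. int (card (S F (M - ?m r))))"
    using insert by simp
  also have "\<dots> = int (card (SIGMA r:R. S F (M - ?m r)))"
    using insert finR by simp
  finally have 1: "mfps_coeff (\<Prod>p\<in>insert x F. mfps_multiples (G p) (A p)) M =
    int (card (SIGMA r:R. S F (M - ?m r)))" .
  \<comment> \<open>The exponent at \<open>x\<close> is split off and reset to 0, the value required
    outside \<open>F\<close>.\<close>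
  have "bij_betw (\<lambda>g. (g x, g(x := 0))) (S (insert x F) M) (SIGMA r:R. S F (M - ?m r))"
  proof (rule bij_betw_byWitness[where f' = "\<lambda>(r, g). g(x := r)"])
    show "(\<lambda>g. (g x, g(x := 0))) ` S (insert x F) M \<subseteq> (SIGMA r:R. S F (M - ?m r))"
    proof
      fix y assume "y \<in> (\<lambda>g. (g x, g(x := 0))) ` S (insert x F) M"
      then obtain g where g: "g \<in> S (insert x F) M" "y = (g x, g(x := 0))" by blast
      have sum: "(\<Sum>p\<in>F. repeat_mset ((g(x := 0)) p) (A p)) = (\<Sum>p\<in>F. repeat_mset (g p) (A p))"
        using insert.hyps by (intro sum.cong) auto
      have gp: "if p \<in> insert x F then g p \<in> G p else g p = 0" for p
        using g(1) unfolding S_def by blast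
      have gM: "?m (g x) + (\<Sum>p\<in>F. repeat_mset (g p) (A p)) = M"
        using g(1) insert.hyps unfolding S_def by simp
      have "g x \<in> R" using gp[of x] gM by (auto simp: R_def)
      moreover have "if p \<in> F then (g(x := 0)) p \<in> G p else (g(x := 0)) p = 0" for p
        using gp[of p] insert.hyps by auto
      moreover have "(\<Sum>p\<in>F. repeat_mset ((g(x := 0)) p) (A p)) = M - ?m (g x)"
        unfolding sum gM[symmetric] by simp
      ultimately have "g x \<in> R" "g(x := 0) \<in> S F (M - ?m (g x))"
        unfolding S_def by blast+
      then show "y \<in> (SIGMA r:R. S F (M - ?m r))" using g(2) by simp
    qed
    show "(\<lambda>(r, g). g(x := r)) ` (SIGMA r:R. S F (M - ?m r)) \<subseteq> S (insert x F) M"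
    proof (clarify)
      fix r g assume r: "r \<in> R" and g: "g \<in> S F (M - ?m r)"
      have sum: "(\<Sum>p\<in>F. repeat_mset ((g(x := r)) p) (A p)) = (\<Sum>p\<in>F. repeat_mset (g p) (A p))"
        using insert.hyps by (intro sum.cong) auto
      have gp: "if p \<in> F then g p \<in> G p else g p = 0" for p
        using g unfolding S_def by blast
      have "if p \<in> insert x F then (g(x := r)) p \<in> G p else (g(x := r)) p = 0" for p
        using gp[of p] r by (auto simp: R_def)
      moreover have "(\<Sum>p\<in>insert x F. repeat_mset ((g(x := r)) p) (A p)) = M"
        using insert.hyps sum g r by (simp add: S_def R_def)
      ultimately show "g(x := r) \<in> S (insert x F) M" unfolding S_def by blast
    qed
    show "\<forall>a\<in>S (insert x F) M. (case (a x, a(x := 0)) of (r, g) \<Rightarrow> g(x := r)) = a" by simp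
    show "\<forall>a\<in>SIGMA r:R. S F (M - ?m r).
        ((case a of (r, g) \<Rightarrow> g(x := r)) x, (case a of (r, g) \<Rightarrow> g(x := r))(x := 0)) = a"
    proof
      fix a assume "a \<in> (SIGMA r:R. S F (M - ?m r))"
      then obtain r g where a: "a = (r, g)" "g \<in> S F (M - ?m r)" by blast
      then have "g x = 0" using insert.hyps(2) unfolding S_def by auto
      then show "((case a of (r, g) \<Rightarrow> g(x := r)) x, (case a of (r, g) \<Rightarrow> g(x := r))(x := 0)) = a"
        by (simp add: a(1) fun_upd_idem)
    qed
  qed
  note bij = this
  have "finite (SIGMA r:R. S F (M - ?m r))" using finR insert by blast
  then show ?case using 1 bij_betw_same_card[OF bij] bij_betw_finite[OF bij] by simp
qed

lemma count_sum_arcs: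
  fixes g :: "nat \<times> nat \<Rightarrow> nat"
  assumes "finite I"
  shows "count (\<Sum>p\<in>I. repeat_mset (g p) (mset_set {fst p..<snd p})) k = arc_weight g I k"
  unfolding arc_weight_def count_sum
  by (rule sum.cong) (auto simp: count_mset_set')

text \<open>The two products run over complementary sets of inversions and merge into one product of
  series of multiples. A filling chooses the power taken from each factor, and
  \<open>count_sum_arcs\<close> identifies the exponents of the chosen monomial.\<close>

lemma coeff_arc_product:
  fixes M :: "nat multiset" and n :: nat and u :: "nat \<Rightarrow> bool \<times> bool"
  defines "S \<equiv> {g \<in> fillings n u. \<forall>k. arc_weight g (inversions n u) k = count M k}"
  shows "finite S"
    and "mfps_coeff ((\<Prod>(i, j)\<in>{(i, j) \<in> inversions n u. snd (u i) \<noteq> snd (u j)}.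
        1 + (\<Prod>k = i..<j. mfps_X k)) *
      (\<Prod>(i, j)\<in>{(i, j) \<in> inversions n u. snd (u i) = snd (u j)}.
        1 / (1 - (\<Prod>k = i..<j. mfps_X k)))) M = int (card S)"
proof -
  let ?A = "\<lambda>p. mset_set {fst p..<snd p}"
  let ?G = "\<lambda>p. extra (snd (u (fst p)) = snd (u (snd p)))"
  let ?I = "inversions n u"
  let ?I1 = "{(i, j) \<in> ?I. snd (u i) \<noteq> snd (u j)}" and ?I2 = "{(i, j) \<in> ?I. snd (u i) = snd (u j)}"
  have ne: "?A p \<noteq> {#}" if "p \<in> ?I" for p
    using that by (auto simp: inversions_def mset_set_empty_iff)
  have S: "S = {g. (\<forall>p. if p \<in> ?I then g p \<in> ?G p else g p = 0) \<and>
      (\<Sum>p\<in>?I. repeat_mset (g p) (?A p)) = M}"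
    unfolding S_def fillings_def multiset_eq_iff count_sum_arcs[OF finite_inversions] by simp
  have 1: "(\<Prod>(i, j)\<in>?I1. 1 + (\<Prod>k = i..<j. mfps_X k)) =
      (\<Prod>p\<in>?I1. mfps_multiples (?G p) (?A p) :: (nat, int) mfps)"
  proof (rule prod.cong[OF refl])
    fix p assume p: "p \<in> ?I1"
    obtain i j where ij: "p = (i, j)" by (cases p)
    have G: "?G p = {0, 1}" using p by (auto simp: extra_def)
    have "p \<in> ?I" using p by blast
    from ne[OF this] have "mset_set {i..<j} \<noteq> {#}" by (simp only: ij fst_conv snd_conv not_False_eq_True)
    then show "(case p of (i, j) \<Rightarrow> 1 + (\<Prod>k = i..<j. mfps_X k)) =
        (mfps_multiples (?G p) (?A p) :: (nat, int) mfps)"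
      by (simp only: G) (simp only: ij case_prod_conv fst_conv snd_conv prod_mfps_X finite_atLeastLessThan not_False_eq_True one_plus_monom)
  qed
  have 2: "(\<Prod>(i, j)\<in>?I2. 1 / (1 - (\<Prod>k = i..<j. mfps_X k))) =
      (\<Prod>p\<in>?I2. mfps_multiples (?G p) (?A p) :: (nat, int) mfps)"
  proof (rule prod.cong[OF refl])
    fix p assume p: "p \<in> ?I2"
    obtain i j where ij: "p = (i, j)" by (cases p)
    have G: "?G p = UNIV" using p by (auto simp: extra_def)
    have "p \<in> ?I" using p by blast
    from ne[OF this] have "mset_set {i..<j} \<noteq> {#}" by (simp only: ij fst_conv snd_conv not_False_eq_True)
    then show "(case p of (i, j) \<Rightarrow> 1 / (1 - (\<Prod>k = i..<j. mfps_X k))) =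
        (mfps_multiples (?G p) (?A p) :: (nat, int) mfps)"
      by (simp only: G) (simp only: ij case_prod_conv fst_conv snd_conv prod_mfps_X finite_atLeastLessThan not_False_eq_True inverse_one_minus_monom)
  qed
  have I: "?I = ?I1 \<union> ?I2" "?I1 \<inter> ?I2 = {}" by auto
  have fin: "finite ?I1" "finite ?I2"
    by (rule finite_subset[OF _ finite_inversions[of n u]], blast)+
  have "(\<Prod>(i, j)\<in>?I1. 1 + (\<Prod>k = i..<j. mfps_X k)) *
      (\<Prod>(i, j)\<in>?I2. 1 / (1 - (\<Prod>k = i..<j. mfps_X k))) =
      (\<Prod>p\<in>?I. mfps_multiples (?G p) (?A p) :: (nat, int) mfps)"
    unfolding 1 2 prod.union_disjoint[OF fin I(2), symmetric] I(1)[symmetric] by (rule refl)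
  then show "finite S" "mfps_coeff ((\<Prod>(i, j)\<in>?I1. 1 + (\<Prod>k = i..<j. mfps_X k)) *
      (\<Prod>(i, j)\<in>?I2. 1 / (1 - (\<Prod>k = i..<j. mfps_X k)))) M = int (card S)"
    using coeff_prod_multiples[of ?I ?A ?G M, OF finite_inversions ne] unfolding S by simp_all
qed

section \<open>Tilings and dominos between consecutive diagonals\<close>

fun cells :: "domino \<Rightarrow> (int \<times> int) set" where
  "cells (Hor i j) = {(i, j), (i + 1, j)}"
| "cells (Ver i j) = {(i, j), (i, j + 1)}"

lemma half_le [simp]:
  "real_of_int i \<le> real_of_int a + 1 / 2 \<longleftrightarrow> i \<le> a"
  "real_of_int a + 1 / 2 \<le> real_of_int i + 1 \<longleftrightarrow> a \<le> i"
  "real_of_int a + 1 / 2 \<le> real_of_int i + 2 \<longleftrightarrow> a \<le> i + 1"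
  "real_of_int i < real_of_int a + 1 / 2 \<longleftrightarrow> i \<le> a"
  "real_of_int a + 1 / 2 < real_of_int i + 1 \<longleftrightarrow> a \<le> i"
  "real_of_int a + 1 / 2 < real_of_int i + 2 \<longleftrightarrow> a \<le> i + 1"
  by linarith+

lemma interior_region:
  "interior (region (Hor i j)) = {of_int i<..<of_int i + 2} \<times> {of_int j<..<of_int j + 1}"
  "interior (region (Ver i j)) = {of_int i<..<of_int i + 1} \<times> {of_int j<..<of_int j + 2}"
  by (simp_all add: interior_Times interior_atLeastAtMost_real)

lemma center_in_region: "(of_int a + 1 / 2, of_int b + 1 / 2) \<in> region d \<longleftrightarrow> (a, b) \<in> cells d"
  by (cases d) auto

lemma center_in_interior:
  "(of_int a + 1 / 2, of_int b + 1 / 2) \<in> interior (region d) \<longleftrightarrow> (a, b) \<in> cells d"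
  by (cases d) (auto simp only: interior_region, auto)

lemma floor_in_cells: "(x, y) \<in> interior (region d) \<Longrightarrow> (\<lfloor>x\<rfloor>, \<lfloor>y\<rfloor>) \<in> cells d"
  by (cases d) (auto simp only: interior_region mem_Times_iff greaterThanLessThan_iff fst_conv snd_conv
      cells.simps insert_iff empty_iff prod.inject simp_thms; linarith)+

lemma center_in_cell: "(of_int a + 1 / 2, of_int b + 1 / 2) \<in> cell a b"
  by (simp add: cell_def)

lemma cell_subset_region_iff: "cell a b \<subseteq> region d \<longleftrightarrow> (a, b) \<in> cells d"
proof
  assume "cell a b \<subseteq> region d"
  then show "(a, b) \<in> cells d" using center_in_cell center_in_region by blast
next
  assume "(a, b) \<in> cells d"
  then show "cell a b \<subseteq> region d"
    by (cases d) (auto simp: cell_def)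
qed

lemma covered_iff: "covered T a b \<longleftrightarrow> (\<exists>d\<in>T. (a, b) \<in> cells d)"
proof
  assume "covered T a b"
  then have "(of_int a + 1 / 2, of_int b + 1 / 2) \<in> covered_region T"
    using center_in_cell by (auto simp: covered_def)
  then show "\<exists>d\<in>T. (a, b) \<in> cells d"
    by (auto simp: covered_region_def center_in_region)
next
  assume "\<exists>d\<in>T. (a, b) \<in> cells d"
  then show "covered T a b"
    unfolding covered_def covered_region_def using cell_subset_region_iff by blast
qed

lemma covered_by_iff: "covered_by T P a b \<longleftrightarrow> (\<exists>d\<in>T. P d \<and> (a, b) \<in> cells d)"
  by (simp add: covered_by_def cell_subset_region_iff)

text \<open>The center of a common square lies in both interiors; conversely the floors of a common
  interior point name a common square.\<close>

lemma interiors_disjoint_iff: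
  "interior (region d) \<inter> interior (region d') = {} \<longleftrightarrow> cells d \<inter> cells d' = {}"
proof
  assume d: "interior (region d) \<inter> interior (region d') = {}"
  show "cells d \<inter> cells d' = {}"
  proof (rule ccontr)
    assume "cells d \<inter> cells d' \<noteq> {}"
    then obtain a b where "(a, b) \<in> cells d" "(a, b) \<in> cells d'" by (metis IntE ex_in_conv surj_pair)
    then show False using d center_in_interior by (metis IntI empty_iff)
  qed
next
  assume d: "cells d \<inter> cells d' = {}"
  show "interior (region d) \<inter> interior (region d') = {}"
  proof (rule ccontr)
    assume "interior (region d) \<inter> interior (region d') \<noteq> {}"
    then obtain x y where "(x, y) \<in> interior (region d)" "(x, y) \<in> interior (region d')"
      by (metis IntE ex_in_conv surj_pair)
    then show False using d floor_in_cells by (metis IntI empty_iff)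
  qed
qed

text \<open>The strip is given by \<open>1 \<le> x - y \<le> 2 * l - 1\<close>. Squares with
  \<open>a - b\<close> in this range have their centers in it, and taking floors changes
  \<open>x - y\<close> by less than 1, so every point of the strip lies in such a square.\<close>

lemma strip_covered_iff:
  "{(x, y). \<bar>x - y - real l\<bar> \<le> real l - 1} \<subseteq> covered_region T \<longleftrightarrow>
    (\<forall>a b. 1 \<le> a - b \<and> a - b \<le> 2 * int l - 1 \<longrightarrow> (\<exists>d\<in>T. (a, b) \<in> cells d))"
proof
  assume sub: "{(x, y). \<bar>x - y - real l\<bar> \<le> real l - 1} \<subseteq> covered_region T"
  show "\<forall>a b. 1 \<le> a - b \<and> a - b \<le> 2 * int l - 1 \<longrightarrow> (\<exists>d\<in>T. (a, b) \<in> cells d)"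
  proof (intro allI impI)
    fix a b :: int assume ab: "1 \<le> a - b \<and> a - b \<le> 2 * int l - 1"
    then have "real_of_int (a - b) \<ge> 1" "real_of_int (a - b) \<le> real_of_int (2 * int l - 1)"
      by (simp, simp only: of_int_le_iff)
    then have "\<bar>(of_int a + 1 / 2) - (of_int b + 1 / 2) - real l\<bar> \<le> real l - 1"
      by (simp add: abs_le_iff)
    then have "(of_int a + 1 / 2, of_int b + 1 / 2) \<in> covered_region T" using sub by blast
    then show "\<exists>d\<in>T. (a, b) \<in> cells d" by (auto simp: covered_region_def center_in_region)
  qed
next
  assume cov: "\<forall>a b. 1 \<le> a - b \<and> a - b \<le> 2 * int l - 1 \<longrightarrow> (\<exists>d\<in>T. (a, b) \<in> cells d)"
  show "{(x, y). \<bar>x - y - real l\<bar> \<le> real l - 1} \<subseteq> covered_region T"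
  proof (clarify)
    fix x y :: real assume xy: "\<bar>x - y - real l\<bar> \<le> real l - 1"
    have "1 \<le> \<lfloor>x\<rfloor> - \<lfloor>y\<rfloor> \<and> \<lfloor>x\<rfloor> - \<lfloor>y\<rfloor> \<le> 2 * int l - 1"
      using xy by linarith
    then have "covered T \<lfloor>x\<rfloor> \<lfloor>y\<rfloor>" using cov covered_iff by blast
    moreover have "(x, y) \<in> cell \<lfloor>x\<rfloor> \<lfloor>y\<rfloor>"
      unfolding cell_def by (simp add: less_imp_le)
    ultimately show "(x, y) \<in> covered_region T" by (auto simp: covered_def)
  qed
qed

fun in_strip :: "nat \<Rightarrow> domino \<Rightarrow> bool" where
  "in_strip l (Hor i j) \<longleftrightarrow> 0 \<le> i - j \<and> i - j < 2 * int l"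
| "in_strip l (Ver i j) \<longleftrightarrow> 1 \<le> i - j \<and> i - j \<le> 2 * int l"

text \<open>On a domino \<open>x - y\<close> is extremal at the top left and the bottom right
  corner.\<close>

lemma in_strip_iff:
  "region d \<subseteq> {(x, y). \<bar>x - y - real l\<bar> \<le> real l + 1} \<longleftrightarrow> in_strip l d"
proof (cases d)
  case (Hor i j)
  show ?thesis
  proof
    assume sub: "region d \<subseteq> {(x, y). \<bar>x - y - real l\<bar> \<le> real l + 1}"
    have "(of_int i, of_int j + 1) \<in> region d" "(of_int i + 2, of_int j) \<in> region d"
      using Hor by simp_all
    then have "\<bar>of_int i - (of_int j + 1) - real l\<bar> \<le> real l + 1"
      "\<bar>of_int i + 2 - of_int j - real l\<bar> \<le> real l + 1" using sub by blast+
    then show "in_strip l d" using Hor by simp linarith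
  next
    assume "in_strip l d"
    then have "0 \<le> i - j" "i - j + 1 \<le> 2 * int l" using Hor by simp_all
    then have "real_of_int 0 \<le> real_of_int (i - j)"
      "real_of_int (i - j + 1) \<le> real_of_int (2 * int l)" unfolding of_int_le_iff .
    then show "region d \<subseteq> {(x, y). \<bar>x - y - real l\<bar> \<le> real l + 1}"
      using Hor by (auto simp: abs_le_iff)
  qed
next
  case (Ver i j)
  show ?thesis
  proof
    assume sub: "region d \<subseteq> {(x, y). \<bar>x - y - real l\<bar> \<le> real l + 1}"
    have "(of_int i, of_int j + 2) \<in> region d" "(of_int i + 1, of_int j) \<in> region d"
      using Ver by simp_all
    then have "\<bar>of_int i - (of_int j + 2) - real l\<bar> \<le> real l + 1"
      "\<bar>of_int i + 1 - of_int j - real l\<bar> \<le> real l + 1" using sub by blast+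
    then show "in_strip l d" using Ver by simp linarith
  next
    assume "in_strip l d"
    then have "1 \<le> i - j" "i - j \<le> 2 * int l" using Ver by simp_all
    then have "real_of_int 1 \<le> real_of_int (i - j)"
      "real_of_int (i - j) \<le> real_of_int (2 * int l)" unfolding of_int_le_iff .
    then show "region d \<subseteq> {(x, y). \<bar>x - y - real l\<bar> \<le> real l + 1}"
      using Ver by (auto simp: abs_le_iff)
  qed
qed

lemma tiling_iff_cells:
  "tiling l T \<longleftrightarrow> (\<forall>d\<in>T. \<forall>d'\<in>T. d \<noteq> d' \<longrightarrow> cells d \<inter> cells d' = {}) \<and>
    (\<forall>a b. 1 \<le> a - b \<and> a - b \<le> 2 * int l - 1 \<longrightarrow> (\<exists>d\<in>T. (a, b) \<in> cells d)) \<and>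
    (\<forall>d\<in>T. in_strip l d)"
proof -
  have "covered_region T \<subseteq> X \<longleftrightarrow> (\<forall>d\<in>T. region d \<subseteq> X)" for X
    unfolding covered_region_def by (rule UN_subset_iff)
  then show ?thesis
    unfolding tiling_def interiors_disjoint_iff strip_covered_iff in_strip_iff[symmetric] by simp
qed

text \<open>
  The domino joining position \<open>x\<close> on the diagonal \<open>y = x - (m - 1)\<close> to position \<open>x'\<close> on the
  diagonal \<open>y = x - m\<close>; it is only meaningful for \<open>x' = x\<close> and \<open>x' = x + 1\<close>.
\<close>

definition step_domino :: "nat \<Rightarrow> int \<Rightarrow> int \<Rightarrow> domino" where
  "step_domino m x x' = (if x' = x then Ver x (x - int m) else Hor x (x - int m + 1))"

definition link :: "domino set \<Rightarrow> nat \<Rightarrow> int \<Rightarrow> int \<Rightarrow> bool" where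
  "link T m x x' \<longleftrightarrow> (x' = x \<or> x' = x + 1) \<and> step_domino m x x' \<in> T"

lemma cells_step_domino:
  "x' = x \<or> x' = x + 1 \<Longrightarrow> cells (step_domino m x x') = {(x, x - int m + 1), (x', x' - int m)}"
  by (auto simp: step_domino_def)

lemma step_domino_inject:
  assumes "x' = x \<or> x' = x + 1" "z' = z \<or> z' = z + 1"
  shows "step_domino m x x' = step_domino n z z' \<longleftrightarrow> m = n \<and> x = z \<and> x' = z'"
  using assms by (auto simp: step_domino_def)

lemma in_strip_step_domino:
  assumes "in_strip l d"
  obtains m x x' where "m \<in> {1..2 * l}" "x' = x \<or> x' = x + 1" "d = step_domino m x x'"
proof (cases d)
  case (Hor i j)
  then have "0 \<le> i - j" "i - j < 2 * int l" using assms by simp_all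
  then obtain m where "m \<in> {1..2 * l}" "j = i - int m + 1"
    by (intro that[of "nat (i - j + 1)"]) auto
  then show ?thesis using Hor that[of m "i + 1" i] by (simp add: step_domino_def)
next
  case (Ver i j)
  then have "1 \<le> i - j" "i - j \<le> 2 * int l" using assms by simp_all
  then obtain m where "m \<in> {1..2 * l}" "j = i - int m"
    by (intro that[of "nat (i - j)"]) auto
  then show ?thesis using Ver that[of m i i] by (simp add: step_domino_def)
qed

text \<open>In both orientations the top left corner is \<open>(x, x - m + 2)\<close>, so its parity
  is that of \<open>m\<close>.\<close>

lemma going_step_domino:
  assumes "x' = x \<or> x' = x + 1"
  shows "north_going (step_domino m x x') \<longleftrightarrow> x' = x + 1 \<and> odd m"
    "east_going (step_domino m x x') \<longleftrightarrow> x' = x \<and> odd m"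
    "south_going (step_domino m x x') \<longleftrightarrow> x' = x + 1 \<and> even m"
    "west_going (step_domino m x x') \<longleftrightarrow> x' = x \<and> even m"
  using assms by (auto simp: step_domino_def north_going_def east_going_def south_going_def
      west_going_def odd_corner_def)

text \<open>A square on diagonal \<open>m\<close> can only be the right end of a link
  \<open>m\<close> or the left end of a link \<open>m + 1\<close>. The three exclusions say that no
  square is used twice, and the last condition covers the inner diagonals.\<close>

lemma tiling_iff_links:
  "tiling l T \<longleftrightarrow>
    (\<forall>d\<in>T. \<exists>m\<in>{1..2 * l}. \<exists>x x'. d = step_domino m x x' \<and> link T m x x') \<and>
    (\<forall>m x x' z. link T m x x' \<and> link T m x z \<longrightarrow> x' = z) \<and>
    (\<forall>m x x' z. link T m x x' \<and> link T m z x' \<longrightarrow> x = z) \<and>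
    (\<forall>m x x' z. link T m x x' \<longrightarrow> \<not> link T (Suc m) x' z) \<and>
    (\<forall>m\<in>{1..<2 * l}. \<forall>x. (\<exists>z. link T m z x) \<or> (\<exists>z. link T (Suc m) x z))" (is "_ \<longleftrightarrow> ?R")
proof
  assume t: "tiling l T"
  have disj: "d = d'" if "d \<in> T" "d' \<in> T" "c \<in> cells d" "c \<in> cells d'" for d d' c
    using t that unfolding tiling_iff_cells by blast
  have strip: "in_strip l d" if "d \<in> T" for d using t that unfolding tiling_iff_cells by blast
  have 1: "\<exists>m\<in>{1..2 * l}. \<exists>x x'. d = step_domino m x x' \<and> link T m x x'" if "d \<in> T" for d
    using in_strip_step_domino[OF strip[OF that]] that unfolding link_def by metis
  have shared: "m = n \<and> x = z \<and> x' = z'"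
    if "link T m x x'" "link T n z z'" "c \<in> {(x, x - int m + 1), (x', x' - int m)}"
      "c \<in> {(z, z - int n + 1), (z', z' - int n)}" for m n x x' z z' c
    using that disj[of "step_domino m x x'" "step_domino n z z'" c]
      cells_step_domino[of x' x m] cells_step_domino[of z' z n] step_domino_inject[of x' x z' z m n]
    unfolding link_def by simp
  have 2: "x' = z" if "link T m x x'" "link T m x z" for m x x' z
    using shared[OF that, of "(x, x - int m + 1)"] by simp
  have 3: "x = z" if "link T m x x'" "link T m z x'" for m x x' z
    using shared[OF that, of "(x', x' - int m)"] by simp
  have 4: "\<not> link T (Suc m) x' z" if "link T m x x'" for m x x' z
    using shared[OF that, of "Suc m" x' z "(x', x' - int m)"] by auto
  have 5: "(\<exists>z. link T m z x) \<or> (\<exists>z. link T (Suc m) x z)" if m: "m \<in> {1..<2 * l}" for m x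
  proof -
    have "1 \<le> x - (x - int m) \<and> x - (x - int m) \<le> 2 * int l - 1" using m by auto
    then obtain d where d: "d \<in> T" "(x, x - int m) \<in> cells d"
      using t unfolding tiling_iff_cells by blast
    from 1[OF d(1)] obtain n z z' where n: "d = step_domino n z z'" "link T n z z'" by blast
    then have "(x, x - int m) \<in> {(z, z - int n + 1), (z', z' - int n)}"
      using d(2) cells_step_domino[of z' z n] by (simp add: link_def)
    then have "x = z \<and> Suc m = n \<or> x = z' \<and> m = n" by auto
    then show ?thesis using n(2) by blast
  qed
  show ?R using 1 2 3 4 5 by meson
next
  assume R: ?R
  have R1: "\<exists>m\<in>{1..2 * l}. \<exists>x x'. d = step_domino m x x' \<and> link T m x x'" if "d \<in> T" for d
    using R[THEN conjunct1] that by (rule bspec)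
  have R2: "link T m x x' \<Longrightarrow> link T m x z \<Longrightarrow> x' = z" for m x x' z
    using R[THEN conjunct2, THEN conjunct1] by blast
  have R3: "link T m x x' \<Longrightarrow> link T m z x' \<Longrightarrow> x = z" for m x x' z
    using R[THEN conjunct2, THEN conjunct2, THEN conjunct1] by blast
  have R4: "link T m x x' \<Longrightarrow> \<not> link T (Suc m) x' z" for m x x' z
    using R[THEN conjunct2, THEN conjunct2, THEN conjunct2, THEN conjunct1] by blast
  have R5: "(\<exists>z. link T m z x) \<or> (\<exists>z. link T (Suc m) x z)" if "m \<in> {1..<2 * l}" for m x
    using R[THEN conjunct2, THEN conjunct2, THEN conjunct2, THEN conjunct2] that by blast
  show "tiling l T"
    unfolding tiling_iff_cells
  proof (intro conjI ballI allI impI)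
    fix d assume "d \<in> T"
    then obtain m x x' where m: "m \<in> {1..2 * l}" "d = step_domino m x x'" "link T m x x'"
      using R1 by blast
    then show "in_strip l d" by (auto simp: step_domino_def link_def)
  next
    fix d d' assume d: "d \<in> T" "d' \<in> T" "d \<noteq> d'"
    obtain m x x' where m: "d = step_domino m x x'" "link T m x x'"
      using R1[OF d(1)] by blast
    obtain n z z' where n: "d' = step_domino n z z'" "link T n z z'"
      using R1[OF d(2)] by blast
    have c: "cells d = {(x, x - int m + 1), (x', x' - int m)}"
      "cells d' = {(z, z - int n + 1), (z', z' - int n)}"
      using m n cells_step_domino by (simp_all add: link_def)
    have False if "(x, x - int m + 1) = (z, z - int n + 1)"
    proof -
      have "m = n" "x = z" using that by auto
      then have "x' = z'" using R2[of m x x' z'] m(2) n(2) by simp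
      then show False using d m n \<open>m = n\<close> \<open>x = z\<close> by simp
    qed
    moreover have False if "(x', x' - int m) = (z', z' - int n)"
    proof -
      have "m = n" "x' = z'" using that by auto
      then have "x = z" using R3[of m x x' z] m(2) n(2) by simp
      then show False using d m n \<open>m = n\<close> \<open>x' = z'\<close> by simp
    qed
    moreover have False if "(x, x - int m + 1) = (z', z' - int n)"
    proof -
      have "m = Suc n" "x = z'" using that by auto
      then show False using R4[of n z z' x'] m(2) n(2) by simp
    qed
    moreover have False if "(x', x' - int m) = (z, z - int n + 1)"
    proof -
      have "n = Suc m" "x' = z" using that by auto
      then show False using R4[of m x x' z'] m(2) n(2) by simp
    qed
    ultimately show "cells d \<inter> cells d' = {}" unfolding c by blast
  next
    fix a b :: int assume ab: "1 \<le> a - b \<and> a - b \<le> 2 * int l - 1"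
    define m where "m = nat (a - b)"
    have m: "m \<in> {1..<2 * l}" "b = a - int m" using ab by (auto simp: m_def)
    then consider z where "link T m z a" | z where "link T (Suc m) a z" using R5 by blast
    then show "\<exists>d\<in>T. (a, b) \<in> cells d"
    proof cases
      case (1 z)
      then show ?thesis using m(2) cells_step_domino[of a z m]
        by (intro bexI[of _ "step_domino m z a"]) (auto simp: link_def)
    next
      case (2 z)
      then show ?thesis using m(2) cells_step_domino[of z a "Suc m"]
        by (intro bexI[of _ "step_domino (Suc m) a z"]) (auto simp: link_def)
    qed
  qed
qed

lemma tiling_domino_link:
  "tiling l T \<Longrightarrow> d \<in> T \<Longrightarrow> \<exists>m\<in>{1..2 * l}. \<exists>x x'. d = step_domino m x x' \<and> link T m x x'"
  by (drule tiling_iff_links[THEN iffD1], drule conjunct1, erule bspec)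

lemma link_unique_right: "tiling l T \<Longrightarrow> link T m x x' \<Longrightarrow> link T m x z \<Longrightarrow> x' = z"
  by (drule tiling_iff_links[THEN iffD1], drule conjunct2, drule conjunct1, blast)

lemma link_unique_left: "tiling l T \<Longrightarrow> link T m x x' \<Longrightarrow> link T m z x' \<Longrightarrow> x = z"
  by (drule tiling_iff_links[THEN iffD1], drule conjunct2, drule conjunct2, drule conjunct1, blast)

lemma link_not_consecutive: "tiling l T \<Longrightarrow> link T m x x' \<Longrightarrow> \<not> link T (Suc m) x' z"
  by (drule tiling_iff_links[THEN iffD1], drule conjunct2, drule conjunct2, drule conjunct2, drule conjunct1, blast)

lemma link_exists:
  "tiling l T \<Longrightarrow> 1 \<le> m \<Longrightarrow> m < 2 * l \<Longrightarrow> (\<exists>z. link T m z x) \<or> (\<exists>z. link T (Suc m) x z)"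
  by (drule tiling_iff_links[THEN iffD1], (drule conjunct2)+) simp

lemma covered_by_links:
  assumes "tiling l T"
  shows "covered_by T P x (x - int m) \<longleftrightarrow>
    (\<exists>z. link T m z x \<and> P (step_domino m z x)) \<or>
    (\<exists>z. link T (Suc m) x z \<and> P (step_domino (Suc m) x z))"
proof
  assume "covered_by T P x (x - int m)"
  then obtain d where d: "d \<in> T" "P d" "(x, x - int m) \<in> cells d" by (auto simp: covered_by_iff)
  obtain n z z' where n: "d = step_domino n z z'" "link T n z z'"
    using tiling_domino_link[OF assms d(1)] by blast
  then have "(x, x - int m) \<in> {(z, z - int n + 1), (z', z' - int n)}"
    using d(3) cells_step_domino[of z' z n] by (simp add: link_def)
  then have "x = z \<and> Suc m = n \<or> x = z' \<and> m = n" by auto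
  then show "(\<exists>z. link T m z x \<and> P (step_domino m z x)) \<or>
      (\<exists>z. link T (Suc m) x z \<and> P (step_domino (Suc m) x z))"
    using n d(2) by blast
next
  assume "(\<exists>z. link T m z x \<and> P (step_domino m z x)) \<or>
      (\<exists>z. link T (Suc m) x z \<and> P (step_domino (Suc m) x z))"
  then show "covered_by T P x (x - int m)"
    using cells_step_domino[of x _ m] cells_step_domino[of _ x "Suc m"]
    by (auto simp: covered_by_iff link_def)
qed

lemma covered_links:
  assumes "tiling l T"
  shows "covered T x (x - int m) \<longleftrightarrow> (\<exists>z. link T m z x) \<or> (\<exists>z. link T (Suc m) x z)"
  using covered_by_links[OF assms, of "\<lambda>_. True"] by (simp add: covered_iff covered_by_iff)

lemma link_bounds:
  assumes "tiling l T" "link T m x x'"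
  shows "m \<in> {1..2 * l}"
proof -
  have "step_domino m x x' \<in> T" using assms(2) by (simp add: link_def)
  then obtain n z z' where n: "n \<in> {1..2 * l}" "step_domino m x x' = step_domino n z z'" "link T n z z'"
    using tiling_domino_link[OF assms(1)] by blast
  then show ?thesis using assms(2) step_domino_inject[of x' x z' z m n] by (simp add: link_def)
qed

text \<open>South- and west-going dominos are the links with even number, so an occupied site is the
  right end of one if \<open>m\<close> is even and the left end of one if \<open>m\<close> is odd.
  The last case is the convention for uncovered sites on \<open>y = x\<close>.\<close>

lemma occupied_links:
  assumes "tiling l T"
  shows "occupied T x (x - int m) \<longleftrightarrow> (even m \<and> (\<exists>z. link T m z x)) \<or>
    (odd m \<and> (\<exists>z. link T (Suc m) x z)) \<or> (m = 0 \<and> \<not> (\<exists>z. link T 1 x z))"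
proof -
  have sw: "south_going (step_domino n z z') \<or> west_going (step_domino n z z') \<longleftrightarrow> even n"
    if "link T n z z'" for n z z'
    using going_step_domino[of z' z n] that by (auto simp: link_def)
  have "covered_by T (\<lambda>d. south_going d \<or> west_going d) x (x - int m) \<longleftrightarrow>
      (even m \<and> (\<exists>z. link T m z x)) \<or> (odd m \<and> (\<exists>z. link T (Suc m) x z))"
    unfolding covered_by_links[OF assms] using sw by (metis even_Suc)
  moreover have "\<not> link T 0 z x" for z using link_bounds[OF assms, of 0 z x] by auto
  ultimately show ?thesis
    unfolding occupied_def using covered_links[OF assms, of x m] by (cases "m = 0") auto
qed

section \<open>Tilings and sequences of partitions\<close>

definition word_steps :: "sign list \<Rightarrow> nat \<Rightarrow> bool \<times> bool" where
  "word_steps w m = (letter w m = Plus, odd m)"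

text \<open>
  For even \<open>m\<close> the \<open>n\<close>-th particle, from the right, of the Maya diagram of \<open>p\<close>, and for odd \<open>m\<close>
  its \<open>n\<close>-th hole, from the left: a domino between the diagonals \<open>m - 1\<close> and \<open>m\<close> transports
  a particle if \<open>m\<close> is even and a hole if \<open>m\<close> is odd.
\<close>

definition pos :: "nat \<Rightarrow> (nat \<Rightarrow> nat) \<Rightarrow> nat \<Rightarrow> int" where
  "pos m p n = (if even m then int (p n) - int n - 1 else int n - int (conjugate p n))"

text \<open>Each domino joins objects of equal index \<open>n\<close> on neighbouring diagonals.
  \<open>a\<close> is the translation, and the charge places the Maya diagram on its
  diagonal.\<close>

definition tiling_of :: "nat \<Rightarrow> sign list \<Rightarrow> int \<Rightarrow> (nat \<Rightarrow> nat \<Rightarrow> nat) \<Rightarrow> domino set" where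
  "tiling_of l w a L = {step_domino m (a + charge w (m - 1) + pos m (L (m - 1)) n)
    (a + charge w m + pos m (L m) n) | m n. m \<in> {1..2 * l}}"

section \<open>Maya diagrams of partitions\<close>

lemma pos_less_iff:
  assumes "is_partition p"
  shows "pos m p i < pos m p j \<longleftrightarrow> (if even m then j < i else i < j)"
proof -
  have "pos m p i < pos m p j" if "if even m then j < i else i < j" for i j
    using that partition_antimono[OF assms, of j i] partition_antimono[OF partition_conjugate[OF assms], of i j]
    by (auto simp: pos_def split: if_splits)
  then show ?thesis by (smt (verit) linorder_neqE_nat)
qed

lemma inj_pos: "is_partition p \<Longrightarrow> inj (pos m p)"
  by (rule injI) (metis linorder_neqE_nat order_less_irrefl pos_less_iff)

text \<open>Particles and holes are complementary sets of integers; consecutive \<open>m\<close> use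
  the two descriptions in turn.\<close>

lemma range_pos_Suc:
  assumes "is_partition p"
  shows "x \<in> range (pos (Suc m) p) \<longleftrightarrow> x \<notin> range (pos m p)"
proof -
  have conjugate: "n < conjugate p j \<longleftrightarrow> j < p n" for n j
    by (rule less_conjugate_iff[OF assms])
  have ne: "int (p n) - int n - 1 \<noteq> int j - int (conjugate p j)" for n j
    using conjugate[of n j] by (cases "j < p n") auto
  have cov: "(\<exists>n. x = int (p n) - int n - 1) \<or> (\<exists>j. x = int j - int (conjugate p j))"
  proof -
    \<comment> \<open>For the first row \<open>n\<close> with \<open>p n \<le> x + n + 1\<close>,
      equality makes \<open>x\<close> the \<open>n\<close>-th particle. Otherwise column
      \<open>j = x + n\<close> has height exactly \<open>n\<close>, which makes \<open>x\<close> the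
      \<open>j\<close>-th hole.\<close>
    define P where "P n \<longleftrightarrow> int (p n) \<le> x + int n + 1" for n
    obtain N where N: "\<forall>n\<ge>N. p n = 0" using assms unfolding is_partition_def by blast
    have "P (max N (nat (- x)))" using N by (simp add: P_def)
    define n where "n = (LEAST n. P n)"
    have n: "P n" unfolding n_def by (rule LeastI) fact
    show ?thesis
    proof (cases "int (p n) = x + int n + 1")
      case True
      then have "x = int (p n) - int n - 1" by simp
      then show ?thesis by blast
    next
      case False
      define j where "j = nat (x + int n)"
      have j: "int j = x + int n" "p n \<le> j" using False n by (auto simp: j_def P_def)
      then have "conjugate p j \<le> n" using conjugate[of n j] by simp
      moreover have "n \<le> conjugate p j"
      proof (cases n)
        case (Suc k)
        then have "\<not> P k" using not_less_Least[of k P] by (simp add: n_def)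
        then have "j < p k" using j(1) Suc by (simp add: P_def)
        then show ?thesis using conjugate[of k j] Suc by simp
      qed simp
      ultimately have "x = int j - int (conjugate p j)" using j(1) by simp
      then show ?thesis by blast
    qed
  qed
  have "(\<exists>n. x = int (p n) - int n - 1) \<longleftrightarrow> \<not> (\<exists>j. x = int j - int (conjugate p j))"
    using ne cov by metis
  then show ?thesis by (cases "even m") (simp_all add: pos_def image_iff)
qed

lemma range_strict_mono_eq:
  fixes f g :: "nat \<Rightarrow> 'a::linorder"
  assumes f: "strict_mono f" and g: "strict_mono g" and eq: "range f = range g"
  shows "f = g"
proof
  fix n
  show "f n = g n"
  proof (induction n rule: less_induct)
    case (less n)
    obtain m where m: "f n = g m" using eq by (metis rangeE rangeI)
    obtain k where k: "g n = f k" using eq by (metis rangeE rangeI)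
    have "\<not> m < n" using less[of m] m f by (metis order_less_irrefl strict_mono_less)
    moreover have "\<not> k < n" using less[of k] k g by (metis order_less_irrefl strict_mono_less)
    ultimately have "g n \<le> g m" "f n \<le> f k"
      using strict_mono_less_eq[OF f, of n k] strict_mono_less_eq[OF g, of n m] by simp_all
    then show ?case using m k by simp
  qed
qed

lemma strict_mono_pos: "is_partition p \<Longrightarrow> strict_mono (\<lambda>n. - pos 0 p n)"
  by (simp add: strict_mono_def pos_less_iff)

lemma range_pos_0_inject:
  assumes "is_partition p" "is_partition q" "range (pos 0 p) = range (pos 0 q)"
  shows "p = q"
proof -
  have "range (\<lambda>n. - pos 0 p n) = range (\<lambda>n. - pos 0 q n)"
    using assms(3) by (metis image_image)
  then have "(\<lambda>n. - pos 0 p n) = (\<lambda>n. - pos 0 q n)"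
    using range_strict_mono_eq strict_mono_pos assms by blast
  then show ?thesis by (auto simp: fun_eq_iff pos_def)
qed

text \<open>Enumerating the half line downwards gives \<open>p n - n - 1 = b - n\<close> for every
  \<open>n\<close>; a row of length 0 then forces \<open>b = - 1\<close>, and all rows
  vanish.\<close>

lemma range_pos_0_atMost:
  assumes p: "is_partition p" and eq: "range (pos 0 p) = {..b}"
  shows "p = (\<lambda>_. 0)"
proof -
  have "range (\<lambda>n. - pos 0 p n) = range (\<lambda>n. int n - b)"
  proof -
    have "range (\<lambda>n. - pos 0 p n) = uminus ` {..b}" unfolding eq[symmetric] by (simp add: image_image)
    also have "\<dots> = range (\<lambda>n. int n - b)"
    proof (intro subset_antisym subsetI)
      fix y assume "y \<in> uminus ` {..b}"
      then have "y = int (nat (y + b)) - b" by auto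
      then show "y \<in> range (\<lambda>n. int n - b)" by blast
    next
      fix y assume "y \<in> range (\<lambda>n. int n - b)"
      then obtain n where "y = - (b - int n)" by auto
      then show "y \<in> uminus ` {..b}" by (intro image_eqI[of _ _ "b - int n"]) auto
    qed
    finally show ?thesis .
  qed
  moreover have "strict_mono (\<lambda>n. int n - b)" by (simp add: strict_mono_def)
  ultimately have *: "- pos 0 p n = int n - b" for n
    using range_strict_mono_eq[OF strict_mono_pos[OF p]] by metis
  obtain N where "p N = 0" using p unfolding is_partition_def by blast
  then have "b = - 1" using *[of N] by (simp add: pos_def)
  then show ?thesis using * by (auto simp: pos_def)
qed

lemma range_pos_zero: "x \<in> range (pos m (\<lambda>_. 0)) \<longleftrightarrow> (if even m then x < 0 else 0 \<le> x)"
proof -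
  have 1: "x \<in> range (pos (Suc 0) (\<lambda>_. 0)) \<longleftrightarrow> 0 \<le> x" for x
    by (auto simp: pos_def image_iff intro: exI[of _ "nat x"])
  have "range (pos m p) = range (pos (if even m then 0 else 1) p)" for p
    by (simp add: pos_def[abs_def])
  then show ?thesis using 1[of x] range_pos_Suc[of "\<lambda>_. 0" x 0] by auto
qed

lemma charge_step:
  "1 \<le> m \<Longrightarrow> charge w m = charge w (m - 1) + of_bool (letter w m = (if odd m then Plus else Minus))"
  by (cases m) auto

lemma not_Plus [simp]: "x \<noteq> Plus \<longleftrightarrow> x = Minus"
  by (cases x) auto

text \<open>This is the reason for the charges. A vertical strip changes each row by at most one, a
  horizontal one each column. An added vertical or a removed horizontal strip moves particles or
  holes by 0 or 1 to the right; in the two other cases they move left, and exactly then the charge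
  increases by 1, so that the total move is again 0 or 1.\<close>

lemma signed_strip_pos:
  assumes "is_partition p" "is_partition q" "1 \<le> m"
  shows "signed_strip (word_steps w m) p q \<longleftrightarrow>
    (\<forall>n. charge w m + pos m q n = charge w (m - 1) + pos m p n \<or>
      charge w m + pos m q n = charge w (m - 1) + pos m p n + 1)"
proof -
  have v: "vstrip x y \<longleftrightarrow> (\<forall>n. int (y n) = int (x n) \<or> int (y n) = int (x n) + 1)" for x y
    unfolding vstrip_def by (intro all_cong1) linarith
  have v': "vstrip y x \<longleftrightarrow> (\<forall>n. int (y n) = int (x n) \<or> int (y n) + 1 = int (x n))" for x y
    unfolding vstrip_def by (intro all_cong1) linarith
  show ?thesis
  proof (cases "even m")
    case True
    show ?thesis
    proof (cases "letter w m")
      case Plus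
      then show ?thesis using True unfolding charge_step[OF assms(3)] signed_strip_def word_steps_def strip_def
        by (simp add: pos_def v) (intro all_cong1, linarith)
    next
      case Minus
      then show ?thesis using True unfolding charge_step[OF assms(3)] signed_strip_def word_steps_def strip_def
        by (simp add: pos_def v') (intro all_cong1, linarith)
    qed
  next
    case False
    show ?thesis
    proof (cases "letter w m")
      case Plus
      then show ?thesis using False unfolding charge_step[OF assms(3)] signed_strip_def word_steps_def strip_def
        by (simp add: pos_def hstrip_conjugate assms v) (intro all_cong1, linarith)
    next
      case Minus
      then show ?thesis using False unfolding charge_step[OF assms(3)] signed_strip_def word_steps_def strip_def
        by (simp add: pos_def hstrip_conjugate assms v') (intro all_cong1, linarith)
    qed
  qed
qed

abbreviation admissible :: "nat \<Rightarrow> sign list \<Rightarrow> (nat \<Rightarrow> nat \<Rightarrow> nat) set" where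
  "admissible l w \<equiv> seqs (2 * l) (word_steps w)"

lemma admissible_iff:
  "L \<in> admissible l w \<longleftrightarrow> (\<forall>m. is_partition (L m)) \<and> L 0 = (\<lambda>_. 0) \<and> (\<forall>m\<ge>2 * l. L m = (\<lambda>_. 0)) \<and>
    (\<forall>m\<in>{1..2 * l}. \<forall>n. charge w m + pos m (L m) n = charge w (m - 1) + pos m (L (m - 1)) n \<or>
      charge w m + pos m (L m) n = charge w (m - 1) + pos m (L (m - 1)) n + 1)"
proof -
  have "(\<forall>m\<in>{1..2 * l}. signed_strip (word_steps w m) (L (m - 1)) (L m)) \<longleftrightarrow>
    (\<forall>m\<in>{1..2 * l}. \<forall>n. charge w m + pos m (L m) n = charge w (m - 1) + pos m (L (m - 1)) n \<or>
      charge w m + pos m (L m) n = charge w (m - 1) + pos m (L (m - 1)) n + 1)"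
    if "\<forall>m. is_partition (L m)"
    using that by (intro ball_cong refl signed_strip_pos) auto
  then show ?thesis unfolding seqs_def mem_Collect_eq by blast
qed

lemma zero_admissible: "(\<lambda>_ _. 0) \<in> admissible l w"
  by (simp add: seqs_def)

section \<open>The tiling of an admissible sequence\<close>

context
  fixes l :: nat and w :: "sign list" and a :: int and L :: "nat \<Rightarrow> nat \<Rightarrow> nat"
  assumes L: "L \<in> admissible l w"
begin

lemma admissible_partition: "is_partition (L m)"
  using L by (simp add: admissible_iff)

lemma admissible_zero: "L 0 = (\<lambda>_. 0)" "m \<ge> 2 * l \<Longrightarrow> L m = (\<lambda>_. 0)"
  using L by (simp_all add: admissible_iff)

lemma admissible_step:
  assumes "m \<in> {1..2 * l}"
  shows "a + charge w m + pos m (L m) n = a + charge w (m - 1) + pos m (L (m - 1)) n \<or>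
      a + charge w m + pos m (L m) n = a + charge w (m - 1) + pos m (L (m - 1)) n + 1"
proof -
  have "charge w m + pos m (L m) n = charge w (m - 1) + pos m (L (m - 1)) n \<or>
      charge w m + pos m (L m) n = charge w (m - 1) + pos m (L (m - 1)) n + 1"
    using L assms unfolding admissible_iff by blast
  then show ?thesis by linarith
qed

lemma link_tiling_of:
  "link (tiling_of l w a L) m x x' \<longleftrightarrow> m \<in> {1..2 * l} \<and>
    (\<exists>n. x = a + charge w (m - 1) + pos m (L (m - 1)) n \<and> x' = a + charge w m + pos m (L m) n)"
proof
  assume lk: "link (tiling_of l w a L) m x x'"
  then obtain k n where kn: "k \<in> {1..2 * l}" "step_domino m x x' =
      step_domino k (a + charge w (k - 1) + pos k (L (k - 1)) n) (a + charge w k + pos k (L k) n)"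
    by (auto simp: link_def tiling_of_def)
  have "x' = x \<or> x' = x + 1" using lk by (simp add: link_def)
  from step_domino_inject[OF this admissible_step[OF kn(1), of n], of m k] kn
  show "m \<in> {1..2 * l} \<and>
    (\<exists>n. x = a + charge w (m - 1) + pos m (L (m - 1)) n \<and> x' = a + charge w m + pos m (L m) n)"
    by blast
next
  assume "m \<in> {1..2 * l} \<and>
    (\<exists>n. x = a + charge w (m - 1) + pos m (L (m - 1)) n \<and> x' = a + charge w m + pos m (L m) n)"
  then obtain n where m: "m \<in> {1..2 * l}" and n: "x = a + charge w (m - 1) + pos m (L (m - 1)) n"
    "x' = a + charge w m + pos m (L m) n" by blast
  show "link (tiling_of l w a L) m x x'"
    using admissible_step[OF m, of n] m unfolding link_def n tiling_of_def by blast
qed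

lemma ex_link_left:
  "(\<exists>z. link (tiling_of l w a L) m x z) \<longleftrightarrow>
    m \<in> {1..2 * l} \<and> x - a - charge w (m - 1) \<in> range (pos m (L (m - 1)))"
proof -
  have "(\<exists>z. link (tiling_of l w a L) m x z) \<longleftrightarrow>
      m \<in> {1..2 * l} \<and> (\<exists>n. x = a + charge w (m - 1) + pos m (L (m - 1)) n)"
    unfolding link_tiling_of by blast
  moreover have "x = a + charge w (m - 1) + pos m (L (m - 1)) n \<longleftrightarrow>
      x - a - charge w (m - 1) = pos m (L (m - 1)) n" for n by linarith
  ultimately show ?thesis by (simp add: image_iff)
qed

lemma ex_link_right:
  "(\<exists>z. link (tiling_of l w a L) m z x) \<longleftrightarrow>
    m \<in> {1..2 * l} \<and> x - a - charge w m \<in> range (pos m (L m))"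
proof -
  have "(\<exists>z. link (tiling_of l w a L) m z x) \<longleftrightarrow>
      m \<in> {1..2 * l} \<and> (\<exists>n. x = a + charge w m + pos m (L m) n)"
    unfolding link_tiling_of by blast
  moreover have "x = a + charge w m + pos m (L m) n \<longleftrightarrow>
      x - a - charge w m = pos m (L m) n" for n by linarith
  ultimately show ?thesis by (simp add: image_iff)
qed

text \<open>Links are unique at their ends because \<open>pos\<close> is injective. The right ends
  of links \<open>m\<close> and the left ends of links \<open>m + 1\<close> are the particles and
  holes of the same partition in some order, hence complementary.\<close>

lemma tiling_tiling_of: "tiling l (tiling_of l w a L)"
  unfolding tiling_iff_links
proof (intro conjI ballI allI impI)
  fix d assume "d \<in> tiling_of l w a L"
  then obtain m n where m: "m \<in> {1..2 * l}" and d: "d = step_domino m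
      (a + charge w (m - 1) + pos m (L (m - 1)) n) (a + charge w m + pos m (L m) n)"
    by (auto simp: tiling_of_def)
  have "link (tiling_of l w a L) m (a + charge w (m - 1) + pos m (L (m - 1)) n) (a + charge w m + pos m (L m) n)"
    unfolding link_tiling_of using m by blast
  then show "\<exists>m\<in>{1..2 * l}. \<exists>x x'. d = step_domino m x x' \<and> link (tiling_of l w a L) m x x'"
    using m d by blast
next
  fix m x x' z assume "link (tiling_of l w a L) m x x' \<and> link (tiling_of l w a L) m x z"
  then show "x' = z"
    unfolding link_tiling_of using injD[OF inj_pos[OF admissible_partition]] by fastforce
next
  fix m x x' z assume "link (tiling_of l w a L) m x x' \<and> link (tiling_of l w a L) m z x'"
  then show "x = z"
    unfolding link_tiling_of using injD[OF inj_pos[OF admissible_partition]] by fastforce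
next
  fix m x x' z assume "link (tiling_of l w a L) m x x'"
  then have "x' - a - charge w m \<in> range (pos m (L m))" using ex_link_right by blast
  then have "x' - a - charge w m \<notin> range (pos (Suc m) (L m))"
    using range_pos_Suc[OF admissible_partition] by blast
  then show "\<not> link (tiling_of l w a L) (Suc m) x' z"
    using ex_link_left[of "Suc m" x'] by auto
next
  fix m x assume "m \<in> {1..<2 * l}"
  then show "(\<exists>z. link (tiling_of l w a L) m z x) \<or> (\<exists>z. link (tiling_of l w a L) (Suc m) x z)"
    unfolding ex_link_left ex_link_right using range_pos_Suc[OF admissible_partition] by auto
qed

lemma occupied_tiling_of:
  assumes "1 \<le> l" "m \<le> 2 * l"
  shows "occupied (tiling_of l w a L) x (x - int m) \<longleftrightarrow> x - a - charge w m \<in> range (pos 0 (L m))"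
proof -
  have ev: "range (pos m p) = range (pos 0 p)" if "even m" for p using that by (simp add: pos_def[abs_def])
  have od: "range (pos (Suc m) p) = range (pos 0 p)" if "odd m" for p using that by (simp add: pos_def[abs_def])
  consider "m = 0" | "even m" "m \<noteq> 0" | "odd m" by blast
  then show ?thesis
  proof cases
    case 1
    then show ?thesis
      using assms range_pos_Suc[OF admissible_partition, of x 0 0] range_pos_Suc[OF admissible_partition, of "x - a" 0 0]
      unfolding occupied_links[OF tiling_tiling_of] ex_link_left ex_link_right by simp
  next
    case 2
    then show ?thesis
      using assms ev unfolding occupied_links[OF tiling_tiling_of] ex_link_left ex_link_right by auto
  next
    case 3
    then have "Suc m \<le> 2 * l" using assms(2) by presburger
    then show ?thesis
      using 3 od unfolding occupied_links[OF tiling_tiling_of] ex_link_left ex_link_right by (auto simp: odd_pos)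
  qed
qed

lemma pure_tiling_of:
  assumes "1 \<le> l"
  shows "pure l (tiling_of l w a L)"
  unfolding pure_def
proof (intro exI allI conjI)
  fix i
  show "covered (tiling_of l w a L) i i \<longleftrightarrow> i \<ge> a"
    using covered_links[OF tiling_tiling_of, of i 0] assms
    unfolding ex_link_left ex_link_right by (simp add: admissible_zero range_pos_zero)
  show "covered (tiling_of l w a L) i (i - 2 * int l) \<longleftrightarrow> i \<le> a + charge w (2 * l) - 1"
    using covered_links[OF tiling_tiling_of, of i "2 * l"] assms
    unfolding ex_link_left ex_link_right by (auto simp add: admissible_zero range_pos_zero)
qed

lemma charge_bounds: "0 \<le> charge w m" "charge w m \<le> int m"
  by (induction m) auto

text \<open>Links with even number start at particles, whose positions are bounded above, and links
  with odd number at holes, whose positions are bounded below.\<close>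

lemma steep_tiling_of: "steep (tiling_of l w a L)"
proof -
  define K where "K = (\<Sum>m\<le>2 * l. int (L m 0) + int (conjugate (L m) 0))"
  have K: "int (L m n) \<le> K" "int (conjugate (L m) n) \<le> K" if "m \<le> 2 * l" for m n
  proof -
    have "int (L m 0) + int (conjugate (L m) 0) \<le> K"
      unfolding K_def using that by (intro member_le_sum) auto
    moreover have "L m n \<le> L m 0" "conjugate (L m) n \<le> conjugate (L m) 0"
      using partition_antimono[OF admissible_partition, of 0 n m]
        partition_antimono[OF partition_conjugate[OF admissible_partition], of 0 n m] by simp_all
    ultimately show "int (L m n) \<le> K" "int (conjugate (L m) n) \<le> K" by linarith+
  qed
  \<comment> \<open>Chosen so that the lower left corner of a domino has coordinate sum at most
    \<open>B\<close> for even \<open>m\<close> and at least \<open>- B\<close> for odd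
    \<open>m\<close>.\<close>
  define B where "B = 2 * (\<bar>a\<bar> + 2 * int l + K) + 2 * int l + 4"
  have corner: "(of_int i, of_int j) \<in> region d \<and> (of_int i + 1, of_int j + 1) \<in> region d"
    if "d = Hor i j \<or> d = Ver i j" for d i j
    using that by auto
  show ?thesis
    unfolding steep_def
  proof (intro exI[of _ "real_of_int B"] conjI ballI impI)
    fix d assume d: "d \<in> tiling_of l w a L" "region d \<subseteq> {(x, y). real_of_int B < x + y}"
    then obtain m x x' where m: "m \<in> {1..2 * l}" "d = step_domino m x x'" "link (tiling_of l w a L) m x x'"
      using tiling_domino_link[OF tiling_tiling_of] by blast
    then obtain n where n: "x = a + charge w (m - 1) + pos m (L (m - 1)) n"
      using link_tiling_of by blast
    have "odd m"
    proof
      assume "even m"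
      then have "pos m (L (m - 1)) n \<le> K"
        using K(1)[of "m - 1" n] m(1) by (simp add: pos_def le_diff_conv)
      then have "x \<le> a + 2 * int l + K"
        using n charge_bounds(2)[of "m - 1"] m(1) by auto
      moreover have "B < x + (x - int m + 1)"
      proof -
        obtain j where j: "d = Hor x j \<or> d = Ver x j" "j \<le> x - int m + 1"
          using m(2) by (cases "x' = x") (auto simp: step_domino_def)
        have "real_of_int B < of_int x + of_int j" using corner[OF j(1)] d(2) by blast
        then have "B < x + j" by linarith
        then show ?thesis using j(2) by simp
      qed
      ultimately show False using m(1) by (auto simp: B_def)
    qed
    then show "north_going d \<or> east_going d"
      using m going_step_domino[of x' x m] by (auto simp: link_def)
  next
    fix d assume d: "d \<in> tiling_of l w a L" "region d \<subseteq> {(x, y). x + y < - real_of_int B}"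
    then obtain m x x' where m: "m \<in> {1..2 * l}" "d = step_domino m x x'" "link (tiling_of l w a L) m x x'"
      using tiling_domino_link[OF tiling_tiling_of] by blast
    then obtain n where n: "x = a + charge w (m - 1) + pos m (L (m - 1)) n"
      using link_tiling_of by blast
    have "even m"
    proof (rule ccontr)
      assume "odd m"
      then have "pos m (L (m - 1)) n \<ge> - K"
        using K(2)[of "m - 1" n] m(1) by (simp add: pos_def le_diff_conv)
      then have "x \<ge> a - K"
        using n charge_bounds(1)[of "m - 1"] by linarith
      moreover have "x + (x - int m) < - B"
      proof -
        obtain j where j: "d = Hor x j \<or> d = Ver x j" "j \<ge> x - int m"
          using m(2) by (cases "x' = x") (auto simp: step_domino_def)
        have "of_int x + of_int j < - real_of_int B" using corner[OF j(1)] d(2) by blast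
        then have "x + j < - B" by linarith
        then show ?thesis using j(2) by simp
      qed
      ultimately show False using m(1) by (auto simp: B_def)
    qed
    then show "south_going d \<or> west_going d"
      using m going_step_domino[of x' x m] by (auto simp: link_def)
  qed
qed

text \<open>Far out the rows or columns have length 0, so particles and holes move by the increment
  of the charge, which records the letter.\<close>

lemma data_tiling_of: "has_asymptotic_data l w (tiling_of l w a L)"
  unfolding has_asymptotic_data_def
proof (intro ballI conjI)
  fix k assume k: "k \<in> {1..l}"
  let ?T = "tiling_of l w a L"
  have zero: "\<exists>N. \<forall>n\<ge>N. p n = 0" if "is_partition p" for p
    using that unfolding is_partition_def by blast
  show "\<forall>\<^sub>F x in at_top. covered_by ?T (case letter w (2 * k - 1) of Plus \<Rightarrow> north_going | Minus \<Rightarrow> east_going)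
      (x - 1) (x - 2 * int k)"
  proof -
    define m where "m = 2 * k - 1"
    have m: "odd m" "m \<in> {1..2 * l}" "m \<ge> 1" "int m = 2 * int k - 1" using k by (auto simp: m_def)
    obtain N1 where N1: "\<forall>n\<ge>N1. conjugate (L m) n = 0" using zero[OF partition_conjugate[OF admissible_partition]] by blast
    obtain N2 where N2: "\<forall>n\<ge>N2. conjugate (L (m - 1)) n = 0" using zero[OF partition_conjugate[OF admissible_partition]] by blast
    have "covered_by ?T (case letter w m of Plus \<Rightarrow> north_going | Minus \<Rightarrow> east_going) (x - 1) (x - 2 * int k)"
      if x: "x \<ge> a + charge w m + int N1 + int N2 + 1" for x
    proof -
      define y where "y = x - 1"
      define n where "n = nat (y - a - charge w m)"
      have n: "int n = y - a - charge w m" "n \<ge> N1" "n \<ge> N2" using x by (auto simp: n_def y_def)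
      define z where "z = a + charge w (m - 1) + int n"
      have "link ?T m z y"
        unfolding link_tiling_of using m n N1 N2 by (auto simp: z_def pos_def intro!: exI[of _ n])
      moreover have "y = z + of_bool (letter w m = Plus)"
        using n(1) charge_step[OF m(3), of w] m(1) by (simp add: z_def)
      ultimately have "\<exists>z. link ?T m z y \<and>
          (case letter w m of Plus \<Rightarrow> north_going | Minus \<Rightarrow> east_going) (step_domino m z y)"
        using m(1) going_step_domino[of y z m] by (intro exI[of _ z]) (cases "letter w m"; simp)
      then have "covered_by ?T (case letter w m of Plus \<Rightarrow> north_going | Minus \<Rightarrow> east_going) y (y - int m)"
        using covered_by_links[OF tiling_tiling_of] by blast
      then show ?thesis using m(4) by (simp add: y_def)
    qed
    then show ?thesis unfolding eventually_at_top_linorder m_def by blast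
  qed
  show "\<forall>\<^sub>F x in at_bot. covered_by ?T (case letter w (2 * k) of Plus \<Rightarrow> west_going | Minus \<Rightarrow> south_going)
      x (x - 2 * int k + 1)"
  proof -
    define m where "m = 2 * k"
    have m: "even m" "m \<in> {1..2 * l}" "m \<ge> 1" "int (m - 1) = 2 * int k - 1" "Suc (m - 1) = m"
      using k by (auto simp: m_def)
    obtain N1 where N1: "\<forall>n\<ge>N1. L m n = 0" using zero[OF admissible_partition] by blast
    obtain N2 where N2: "\<forall>n\<ge>N2. L (m - 1) n = 0" using zero[OF admissible_partition] by blast
    have "covered_by ?T (case letter w m of Plus \<Rightarrow> west_going | Minus \<Rightarrow> south_going) x (x - 2 * int k + 1)"
      if x: "x \<le> a + charge w (m - 1) - int N1 - int N2 - 1" for x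
    proof -
      define n where "n = nat (a + charge w (m - 1) - 1 - x)"
      have n: "int n = a + charge w (m - 1) - 1 - x" "n \<ge> N1" "n \<ge> N2" using x by (auto simp: n_def)
      define z where "z = a + charge w m - int n - 1"
      have "link ?T m x z"
        unfolding link_tiling_of using m n N1 N2 by (auto simp: z_def pos_def intro!: exI[of _ n])
      moreover have "z = x + of_bool (letter w m = Minus)"
        using n(1) charge_step[OF m(3), of w] m(1) by (simp add: z_def)
      ultimately have "\<exists>z. link ?T m x z \<and>
          (case letter w m of Plus \<Rightarrow> west_going | Minus \<Rightarrow> south_going) (step_domino m x z)"
        using m(1) going_step_domino[of z x m] by (intro exI[of _ z]) (cases "letter w m"; simp)
      then have "covered_by ?T (case letter w m of Plus \<Rightarrow> west_going | Minus \<Rightarrow> south_going) x (x - int (m - 1))"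
        using covered_by_links[OF tiling_tiling_of, of _ x "m - 1"] m(5) by simp
      moreover have "x - int (m - 1) = x - 2 * int k + 1" using m(4) by simp
      ultimately show ?thesis by (simp only:)
    qed
    then show ?thesis unfolding eventually_at_bot_linorder m_def by blast
  qed
qed

end

section \<open>From a tiling back to its partitions\<close>

context
  fixes l :: nat and w :: "sign list" and T :: "domino set" and a b :: int
  assumes tiling: "tiling l T" and data: "has_asymptotic_data l w T" and l: "1 \<le> l"
    and pure_left: "\<And>i. covered T i i \<longleftrightarrow> i \<ge> a"
    and pure_right: "\<And>i. covered T i (i - 2 * int l) \<longleftrightarrow> i \<le> b"
begin

text \<open>Far out the asymptotic data prescribes the type of the domino at one end of the link,
  and by disjointness this domino is the link itself. Its move is therefore the increment of the
  charge, which makes \<open>charge w m\<close> the right normalization on diagonal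
  \<open>m\<close>.\<close>

lemma eventually_link:
  assumes m: "m \<in> {1..2 * l}" and p: "is_partition p"
    and lk: "\<And>n. link T m (a + charge w (m - 1) + pos m p n) (y n)"
  shows "\<exists>N. \<forall>n\<ge>N. y n = a + charge w m + (if even m then - int n - 1 else int n)"
proof (cases "even m")
  case False
  define k where "k = (m + 1) div 2"
  have k: "k \<in> {1..l}" "m = 2 * k - 1" "int m = 2 * int k - 1" using m False by (auto simp: k_def elim!: oddE)
  obtain N where N: "\<forall>n\<ge>N. conjugate p n = 0"
    using partition_conjugate[OF p] unfolding is_partition_def by blast
  obtain Z where Z: "\<And>x. x \<ge> Z \<Longrightarrow> covered_by T
      (case letter w m of Plus \<Rightarrow> north_going | Minus \<Rightarrow> east_going) (x - 1) (x - 2 * int k)"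
    using data k(1) unfolding has_asymptotic_data_def k(2) eventually_at_top_linorder by blast
  have "y n = a + charge w m + int n" if n: "n \<ge> N + nat (Z - a - charge w (m - 1))" for n
  proof -
    define x where "x = a + charge w (m - 1) + pos m p n"
    have xn: "x = a + charge w (m - 1) + int n" using False N n by (simp add: x_def pos_def)
    have lkx: "link T m x (y n)" using lk by (simp add: x_def)
    then have yx: "y n = x \<or> y n = x + 1" by (simp add: link_def)
    have "y n + 1 \<ge> Z" using yx n xn by linarith
    moreover have "y n + 1 - 1 = y n" "y n + 1 - 2 * int k = y n - int m" using k(3) by simp_all
    ultimately have "covered_by T (case letter w m of Plus \<Rightarrow> north_going | Minus \<Rightarrow> east_going)
        (y n) (y n - int m)" using Z by metis
    then obtain z where "link T m z (y n)"
      "(case letter w m of Plus \<Rightarrow> north_going | Minus \<Rightarrow> east_going) (step_domino m z (y n))"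
      using covered_by_links[OF tiling] link_not_consecutive[OF tiling lkx] by blast
    moreover from this have "z = x" using link_unique_left[OF tiling] lkx by blast
    ultimately have "y n = x + of_bool (letter w m = Plus)"
      using going_step_domino[OF yx, of m] by (cases "letter w m") simp_all
    then show ?thesis using xn charge_step[of m w] m False by simp
  qed
  then show ?thesis using False by auto
next
  case True
  define k where "k = m div 2"
  have k: "k \<in> {1..l}" "m = 2 * k" "Suc (m - 1) = m" "int (m - 1) = 2 * int k - 1" using m True by (auto simp: k_def elim!: evenE)
  obtain N where N: "\<forall>n\<ge>N. p n = 0" using p unfolding is_partition_def by blast
  obtain Z where Z: "\<And>x. x \<le> Z \<Longrightarrow> covered_by T
      (case letter w m of Plus \<Rightarrow> west_going | Minus \<Rightarrow> south_going) x (x - 2 * int k + 1)"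
    using data k(1) unfolding has_asymptotic_data_def k(2) eventually_at_bot_linorder by blast
  have "y n = a + charge w m - int n - 1" if n: "n \<ge> N + nat (a + charge w (m - 1) - Z)" for n
  proof -
    define x where "x = a + charge w (m - 1) + pos m p n"
    have xn: "x = a + charge w (m - 1) - int n - 1" using True N n by (simp add: x_def pos_def)
    have lkx: "link T m x (y n)" using lk by (simp add: x_def)
    then have yx: "y n = x \<or> y n = x + 1" by (simp add: link_def)
    have "x \<le> Z" using n xn by linarith
    moreover have "x - 2 * int k + 1 = x - int (m - 1)" using k(4) by simp
    ultimately have "covered_by T (case letter w m of Plus \<Rightarrow> west_going | Minus \<Rightarrow> south_going)
        x (x - int (m - 1))" using Z by metis
    moreover have "\<not> link T (m - 1) z x" for z
      using link_not_consecutive[OF tiling, of "m - 1" z x "y n"] lkx k(3) by auto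
    ultimately obtain z where "link T m x z"
      "(case letter w m of Plus \<Rightarrow> west_going | Minus \<Rightarrow> south_going) (step_domino m x z)"
      using covered_by_links[OF tiling, of _ x "m - 1"] k(3) by auto
    moreover from this have "z = y n" using link_unique_right[OF tiling] lkx by blast
    ultimately have "y n = x + of_bool (letter w m = Minus)"
      using going_step_domino[OF yx, of m] by (cases "letter w m") simp_all
    then show ?thesis using xn charge_step[of m w] m True by simp
  qed
  then show ?thesis using True by (intro exI[of _ "N + nat (a + charge w (m - 1) - Z)"]) auto
qed

text \<open>Links move by 0 or 1 and never share an end, so they preserve order: the right ends form
  again a strictly monotone sequence that is eventually the one of the empty partition.\<close>

lemma extend_links:
  assumes m: "m \<in> {1..2 * l}" and p: "is_partition p"
    and src: "\<And>x. (\<exists>z. link T m x z) \<longleftrightarrow> x - a - charge w (m - 1) \<in> range (pos m p)"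
  shows "\<exists>q. is_partition q \<and> (\<forall>x x'. link T m x x' \<longleftrightarrow>
    (\<exists>n. x = a + charge w (m - 1) + pos m p n \<and> x' = a + charge w m + pos m q n))"
proof -
  define X where "X n = a + charge w (m - 1) + pos m p n" for n
  have "\<exists>y. link T m (X n) y" for n
    using src[of "X n"] by (simp add: X_def)
  then obtain Y where Y: "\<And>n. link T m (X n) (Y n)" by metis
  then have YX: "Y n = X n \<or> Y n = X n + 1" for n by (simp add: link_def)
  have inj: "Y i = Y j \<Longrightarrow> i = j" for i j
    using link_unique_left[OF tiling Y, of "X i" j] Y[of i] injD[OF inj_pos[OF p], of m i j]
    by (simp add: X_def)
  obtain N where N: "\<And>n. n \<ge> N \<Longrightarrow> Y n = a + charge w m + (if even m then - int n - 1 else int n)"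
    using eventually_link[OF m p, of Y] Y unfolding X_def by blast
  \<comment> \<open>The displacement of the \<open>n\<close>-th right end from its place in the
    empty diagram: the length of row \<open>n\<close> for particles and of column \<open>n\<close>
    for holes. Being antitone and eventually 0, it is nonnegative.\<close>
  define q' where "q' n = (if even m then Y n - a - charge w m + int n + 1
    else a + charge w m + int n - Y n)" for n
  have q'_Suc: "q' (Suc n) \<le> q' n" for n
  proof (cases "even m")
    case True
    have "X (Suc n) < X n" using pos_less_iff[OF p, of m "Suc n" n] True by (simp add: X_def)
    then have "Y (Suc n) < Y n" using YX[of n] YX[of "Suc n"] inj[of n "Suc n"] by linarith
    then show ?thesis using True by (simp add: q'_def)
  next
    case False
    have "X n < X (Suc n)" using pos_less_iff[OF p, of m n "Suc n"] False by (simp add: X_def)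
    then have "Y n < Y (Suc n)" using YX[of n] YX[of "Suc n"] inj[of n "Suc n"] by linarith
    then show ?thesis using False by (simp add: q'_def)
  qed
  have q'_zero: "q' n = 0" if "n \<ge> N" for n using N[OF that] by (simp add: q'_def)
  have "antimono q'" using q'_Suc by (simp add: antimono_iff_le_Suc)
  then have q'_nonneg: "0 \<le> q' n" for n
    using q'_zero[of "max n N"] antimonoD[of q' n "max n N"] by simp
  have part: "is_partition (\<lambda>n. nat (q' n))"
    by (rule partitionI[where N = N]) (simp_all add: q'_Suc q'_zero nat_mono)
  define q where "q = (if even m then \<lambda>n. nat (q' n) else conjugate (\<lambda>n. nat (q' n)))"
  have q: "is_partition q" using part by (simp add: q_def)
  have Yq: "Y n = a + charge w m + pos m q n" for n
  proof -
    have "pos m q n = (if even m then q' n - int n - 1 else int n - q' n)"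
      using part q'_nonneg[of n] by (simp add: pos_def q_def)
    then show ?thesis by (simp add: q'_def)
  qed
  have "link T m x x' \<longleftrightarrow> (\<exists>n. x = X n \<and> x' = Y n)" for x x'
  proof
    assume lk: "link T m x x'"
    then obtain n where "x - a - charge w (m - 1) = pos m p n" using src[of x] by blast
    then have "x = X n" by (simp add: X_def)
    then show "\<exists>n. x = X n \<and> x' = Y n" using link_unique_right[OF tiling] Y lk by blast
  qed (use Y in blast)
  then show ?thesis using q unfolding X_def Yq by blast
qed

text \<open>Diagonal by diagonal, the left ends of links \<open>k + 1\<close> are the complement of
  the right ends of links \<open>k\<close>, hence the other kind of object of the same partition; on
  diagonal 0 purity supplies the starting half line.\<close>

lemma partitions_of_tiling:
  "k \<le> 2 * l \<Longrightarrow> \<exists>L. L 0 = (\<lambda>_. 0) \<and> (\<forall>m. is_partition (L m)) \<and> (\<forall>m\<in>{1..k}. \<forall>x x'. link T m x x' \<longleftrightarrow>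
    (\<exists>n. x = a + charge w (m - 1) + pos m (L (m - 1)) n \<and> x' = a + charge w m + pos m (L m) n))"
proof (induction k)
  case 0
  show ?case by (intro exI[of _ "\<lambda>_ _. 0"]) simp
next
  case (Suc k)
  then obtain L where L: "L 0 = (\<lambda>_. 0)" "\<And>m. is_partition (L m)"
    and lk: "\<And>m x x'. m \<in> {1..k} \<Longrightarrow> link T m x x' \<longleftrightarrow>
      (\<exists>n. x = a + charge w (m - 1) + pos m (L (m - 1)) n \<and> x' = a + charge w m + pos m (L m) n)"
    by auto
  have m: "Suc k \<in> {1..2 * l}" using Suc.prems by simp
  have "(\<exists>z. link T (Suc k) x z) \<longleftrightarrow> x - a - charge w k \<in> range (pos (Suc k) (L k))" for x
  proof (cases "k = 0")
    case True
    have "\<not> link T 0 z x" for z using link_bounds[OF tiling, of 0 z x] by auto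
    then have "(\<exists>z. link T (Suc 0) x z) \<longleftrightarrow> a \<le> x"
      using covered_links[OF tiling, of x 0] pure_left[of x] by simp
    then show ?thesis using True by (simp add: L(1) range_pos_zero)
  next
    case False
    then have k: "k \<in> {1..k}" "1 \<le> k" "k < 2 * l" using Suc.prems by auto
    have "(\<exists>z. link T k z x) \<longleftrightarrow> (\<exists>n. x - a - charge w k = pos k (L k) n)"
      unfolding lk[OF k(1)] by (auto simp: algebra_simps)
    also have "\<dots> \<longleftrightarrow> x - a - charge w k \<in> range (pos k (L k))" by (simp add: image_iff)
    finally show ?thesis
      unfolding range_pos_Suc[OF L(2)]
      using link_exists[OF tiling k(2,3), of x] link_not_consecutive[OF tiling] by blast
  qed
  then obtain q where q: "is_partition q" "\<And>x x'. link T (Suc k) x x' \<longleftrightarrow>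
      (\<exists>n. x = a + charge w k + pos (Suc k) (L k) n \<and> x' = a + charge w (Suc k) + pos (Suc k) q n)"
    using extend_links[OF m L(2)[of k]] by auto
  show ?case
  proof (intro exI[of _ "L(Suc k := q)"] conjI allI ballI)
    fix j x x' assume "j \<in> {1..Suc k}"
    then consider "j = Suc k" | "j \<in> {1..k}" by force
    then show "link T j x x' \<longleftrightarrow> (\<exists>n. x = a + charge w (j - 1) + pos j ((L(Suc k := q)) (j - 1)) n \<and>
        x' = a + charge w j + pos j ((L(Suc k := q)) j) n)"
    proof cases
      case 1
      then show ?thesis using q(2) by simp
    next
      case 2
      then have "j \<noteq> Suc k" "j - 1 \<noteq> Suc k" by auto
      then show ?thesis using lk[OF 2] by simp
    qed
  qed (use L q(1) in auto)
qed

lemma tiling_eq_tiling_of: "\<exists>L\<in>admissible l w. T = tiling_of l w a L"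
proof -
  obtain L where L: "L 0 = (\<lambda>_. 0)" "\<And>m. is_partition (L m)"
    and lk: "\<And>m x x'. m \<in> {1..2 * l} \<Longrightarrow> link T m x x' \<longleftrightarrow>
      (\<exists>n. x = a + charge w (m - 1) + pos m (L (m - 1)) n \<and> x' = a + charge w m + pos m (L m) n)"
    using partitions_of_tiling[of "2 * l"] by auto
  have two_l: "2 * l \<in> {1..2 * l}" using l by simp
  have "\<not> link T (Suc (2 * l)) x z" for x z using link_bounds[OF tiling, of "Suc (2 * l)" x z] by auto
  then have r: "(\<exists>z. link T (2 * l) z x) \<longleftrightarrow> x \<le> b" for x
    using covered_links[OF tiling, of x "2 * l"] pure_right[of x] by simp
  have "range (pos 0 (L (2 * l))) = {..b - a - charge w (2 * l)}"
  proof (intro set_eqI)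
    fix y
    have "y \<in> range (pos 0 (L (2 * l))) \<longleftrightarrow> (\<exists>n. y + a + charge w (2 * l) = a + charge w (2 * l) + pos (2 * l) (L (2 * l)) n)"
      by (auto simp: pos_def image_iff)
    also have "\<dots> \<longleftrightarrow> (\<exists>z. link T (2 * l) z (y + a + charge w (2 * l)))"
      unfolding lk[OF two_l] by blast
    finally show "y \<in> range (pos 0 (L (2 * l))) \<longleftrightarrow> y \<in> {..b - a - charge w (2 * l)}"
      unfolding r by auto
  qed
  then have zero: "L (2 * l) = (\<lambda>_. 0)" by (rule range_pos_0_atMost[OF L(2)])
  \<comment> \<open>The induction says nothing beyond diagonal \<open>2 * l\<close>, where an
    admissible sequence has to be empty.\<close>
  define L' where "L' m = (if m < 2 * l then L m else (\<lambda>_. 0))" for m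
  have L': "L' m = L m" if "m \<le> 2 * l" for m
    using that zero by (cases "m = 2 * l") (auto simp: L'_def)
  have L'lk: "link T m x x' \<longleftrightarrow>
      (\<exists>n. x = a + charge w (m - 1) + pos m (L' (m - 1)) n \<and> x' = a + charge w m + pos m (L' m) n)"
    if "m \<in> {1..2 * l}" for m x x'
  proof -
    have "L' (m - 1) = L (m - 1)" "L' m = L m" using that by (auto intro!: L')
    then show ?thesis using lk[OF that] by simp
  qed
  have adm: "L' \<in> admissible l w"
    unfolding admissible_iff
  proof (intro conjI allI ballI impI)
    fix m n assume m: "m \<in> {1..2 * l}"
    have "link T m (a + charge w (m - 1) + pos m (L' (m - 1)) n) (a + charge w m + pos m (L' m) n)"
      using L'lk[OF m] by blast
    then show "charge w m + pos m (L' m) n = charge w (m - 1) + pos m (L' (m - 1)) n \<or>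
        charge w m + pos m (L' m) n = charge w (m - 1) + pos m (L' (m - 1)) n + 1"
      unfolding link_def by linarith
  qed (use L l in \<open>auto simp: L'_def\<close>)
  have "T = tiling_of l w a L'"
  proof (intro subset_antisym subsetI)
    fix d assume "d \<in> T"
    then obtain m x x' where m: "m \<in> {1..2 * l}" "d = step_domino m x x'" "link T m x x'"
      using tiling_domino_link[OF tiling] by blast
    then obtain n where "x = a + charge w (m - 1) + pos m (L' (m - 1)) n"
      "x' = a + charge w m + pos m (L' m) n"
      using L'lk[OF m(1), of x x'] by blast
    then show "d \<in> tiling_of l w a L'" using m(1,2) unfolding tiling_of_def by blast
  next
    fix d assume "d \<in> tiling_of l w a L'"
    then obtain m n where m: "m \<in> {1..2 * l}" and d: "d = step_domino m
        (a + charge w (m - 1) + pos m (L' (m - 1)) n) (a + charge w m + pos m (L' m) n)"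
      by (auto simp: tiling_of_def)
    have "link T m (a + charge w (m - 1) + pos m (L' (m - 1)) n) (a + charge w m + pos m (L' m) n)"
      using L'lk[OF m] by blast
    then show "d \<in> T" unfolding d link_def by blast
  qed
  then show ?thesis using adm by blast
qed

end

theorem pure_steep_tilings_eq:
  assumes "1 \<le> l"
  shows "pure_steep_tilings l w = {tiling_of l w a L | a L. L \<in> admissible l w}"
proof (intro subset_antisym subsetI)
  fix T assume "T \<in> pure_steep_tilings l w"
  then have T: "tiling l T" "has_asymptotic_data l w T" "pure l T"
    by (simp_all add: pure_steep_tilings_def)
  then obtain a b where ab: "\<And>i. covered T i i \<longleftrightarrow> i \<ge> a"
    "\<And>i. covered T i (i - 2 * int l) \<longleftrightarrow> i \<le> b" unfolding pure_def by blast
  from tiling_eq_tiling_of[OF T(1,2) assms ab]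
  show "T \<in> {tiling_of l w a L | a L. L \<in> admissible l w}" by blast
next
  fix T assume "T \<in> {tiling_of l w a L | a L. L \<in> admissible l w}"
  then obtain a L where "L \<in> admissible l w" "T = tiling_of l w a L" by blast
  then show "T \<in> pure_steep_tilings l w"
    using tiling_tiling_of steep_tiling_of data_tiling_of pure_tiling_of[OF _ assms]
    by (simp add: pure_steep_tilings_def)
qed

section \<open>Uniqueness of the sequence, translation classes and the minimal tiling\<close>

lemma tiling_of_inject:
  assumes l: "1 \<le> l" and L: "L \<in> admissible l w" and L': "L' \<in> admissible l w"
    and eq: "tiling_of l w a L = tiling_of l w b L'"
  shows "a = b" "L = L'"
proof -
  have occ: "x - a - charge w m \<in> range (pos 0 (L m)) \<longleftrightarrow> x - b - charge w m \<in> range (pos 0 (L' m))"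
    if "m \<le> 2 * l" for x m
    using occupied_tiling_of[OF L l that, of a x] occupied_tiling_of[OF L' l that, of b x] eq by simp
  have "x - a < 0 \<longleftrightarrow> x - b < 0" for x
    using occ[of 0 x] by (simp add: admissible_zero[OF L] admissible_zero[OF L'] range_pos_zero)
  from this[of a] this[of b] show "a = b" by linarith
  show "L = L'"
  proof
    fix m
    show "L m = L' m"
    proof (cases "m \<le> 2 * l")
      case True
      have "x \<in> range (pos 0 (L m)) \<longleftrightarrow> x \<in> range (pos 0 (L' m))" for x
        using occ[OF True, of "x + a + charge w m"] \<open>a = b\<close> by simp
      then show ?thesis
        using range_pos_0_inject admissible_partition L L' by blast
    next
      case False
      then show ?thesis using admissible_zero L L' by simp
    qed
  qed
qed

lemma translate_tiling_of: "translate n ` tiling_of l w a L = tiling_of l w (a + n) L"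
proof -
  have "translate n (step_domino m x x') = step_domino m (x + n) (x' + n)" for m x x'
    by (simp add: step_domino_def)
  moreover have "translate n ` tiling_of l w a L = {translate n (step_domino m (a + charge w (m - 1) + pos m (L (m - 1)) k)
    (a + charge w m + pos m (L m) k)) | m k. m \<in> {1..2 * l}}"
    unfolding tiling_of_def by blast
  ultimately show ?thesis by (simp add: tiling_of_def algebra_simps)
qed

lemma translation_class_tiling_of:
  "translation_class (tiling_of l w a L) = {tiling_of l w b L | b. True}"
proof -
  have "\<exists>n. b = a + n" for b by (metis add.commute diff_add_cancel)
  then show ?thesis unfolding translation_class_def translate_tiling_of by metis
qed

text \<open>The prescribed sites on the two outer diagonals imply purity with \<open>a = 0\<close>,
  so the tiling comes from a sequence; on every diagonal its particles fill a half line, which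
  leaves only the empty partition.\<close>

lemma min_tiling_eq:
  assumes l: "1 \<le> l"
  shows "min_tiling l w = tiling_of l w 0 (\<lambda>_ _. 0)"
  unfolding min_tiling_def
proof (rule the_equality)
  have "occupied (tiling_of l w 0 (\<lambda>_ _. 0)) x (x - int m) \<longleftrightarrow> x < charge w m" if "m \<le> 2 * l" for x m
    using occupied_tiling_of[OF zero_admissible l that] by (simp add: range_pos_zero)
  then show "tiling l (tiling_of l w 0 (\<lambda>_ _. 0)) \<and> steep (tiling_of l w 0 (\<lambda>_ _. 0)) \<and>
      has_asymptotic_data l w (tiling_of l w 0 (\<lambda>_ _. 0)) \<and>
      (\<forall>m\<in>{0..2 * l}. \<forall>i. occupied (tiling_of l w 0 (\<lambda>_ _. 0)) i (i - int m) \<longleftrightarrow> i < charge w m)"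
    using zero_admissible tiling_tiling_of steep_tiling_of data_tiling_of by simp
next
  fix T assume T: "tiling l T \<and> steep T \<and> has_asymptotic_data l w T \<and>
      (\<forall>m\<in>{0..2 * l}. \<forall>i. occupied T i (i - int m) \<longleftrightarrow> i < charge w m)"
  then have tiling: "tiling l T" and data: "has_asymptotic_data l w T"
    and occ: "\<And>m i. m \<le> 2 * l \<Longrightarrow> occupied T i (i - int m) \<longleftrightarrow> i < charge w m" by auto
  have "\<not> link T 0 z x" "\<not> link T (Suc (2 * l)) x z" for x z
    using link_bounds[OF tiling, of 0 z x] link_bounds[OF tiling, of "Suc (2 * l)" x z] by auto
  then have "(\<exists>z. link T 1 i z) \<longleftrightarrow> \<not> i < 0"
    "covered T i i \<longleftrightarrow> (\<exists>z. link T 1 i z)" "covered T i (i - 2 * int l) \<longleftrightarrow> i < charge w (2 * l)" for i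
    using covered_links[OF tiling, of i 0] occupied_links[OF tiling, of i 0] occ[of 0 i]
      covered_links[OF tiling, of i "2 * l"] occupied_links[OF tiling, of i "2 * l"] occ[of "2 * l" i] l
    by auto
  then have "covered T i i \<longleftrightarrow> i \<ge> 0" "covered T i (i - 2 * int l) \<longleftrightarrow> i \<le> charge w (2 * l) - 1" for i
    by auto
  from tiling_eq_tiling_of[OF tiling data l this] obtain L where L: "L \<in> admissible l w"
    "T = tiling_of l w 0 L" by blast
  have "L m = (\<lambda>_. 0)" for m
  proof (cases "m \<le> 2 * l")
    case True
    have "x \<in> range (pos 0 (L m)) \<longleftrightarrow> x < 0" for x
      using occupied_tiling_of[OF L(1) l True, of 0 "x + charge w m"] occ[OF True, of "x + charge w m"] L(2)
      by simp
    then have "range (pos 0 (L m)) = {..- 1}" by (simp add: set_eq_iff) linarith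
    then show ?thesis by (rule range_pos_0_atMost[OF admissible_partition[OF L(1)]])
  next
    case False
    then show ?thesis using admissible_zero[OF L(1)] by simp
  qed
  then show "T = tiling_of l w 0 (\<lambda>_ _. 0)" using L(2) by presburger
qed

section \<open>Flips and boxes\<close>

text \<open>\<open>p r = s\<close> and \<open>conjugate p s = r\<close> together say that
  \<open>(r, s)\<close> is an addable corner of \<open>p\<close>.\<close>

lemma
  assumes p: "is_partition p" and r: "p r = s" and s: "conjugate p s = r"
  shows partition_add_box: "is_partition (p(r := Suc s))"
    and conjugate_add_box: "conjugate (p(r := Suc s)) = (conjugate p)(s := Suc r)"
    and weight_add_box: "weight (p(r := Suc s)) = Suc (weight p)"
proof -
  obtain N where N: "\<forall>n\<ge>N. p n = 0" using p unfolding is_partition_def by blast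
  show q: "is_partition (p(r := Suc s))"
  proof (rule partitionI[where N = "N + Suc r"])
    fix i
    have "s < p i" if "Suc i = r" using less_conjugate_iff[OF p, of i s] s that by simp
    then show "(p(r := Suc s)) (Suc i) \<le> (p(r := Suc s)) i"
      using partition_antimono[OF p, of i "Suc i"] r by auto
  qed (use N in auto)
  show "conjugate (p(r := Suc s)) = (conjugate p)(s := Suc r)"
  proof
    fix j
    have "x < conjugate (p(r := Suc s)) j \<longleftrightarrow> x < ((conjugate p)(s := Suc r)) j" for x
      using less_conjugate_iff[OF q, of x j] less_conjugate_iff[OF p, of x j] r s by (auto simp: less_Suc_eq)
    then show "conjugate (p(r := Suc s)) j = ((conjugate p)(s := Suc r)) j"
      by (metis linorder_neqE_nat order_less_irrefl)
  qed
  have "boxes (p(r := Suc s)) = insert (r, s) (boxes p)"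
    using r by (auto simp: boxes_def split: if_splits)
  then show "weight (p(r := Suc s)) = Suc (weight p)"
    using finite_boxes[OF p] r by (simp add: weight_def boxes_def)
qed

text \<open>
  Adding the box in row \<open>r\<close> and column \<open>s\<close> moves the particle of index \<open>r\<close> and the hole of
  index \<open>s\<close> past each other.
\<close>

lemma pos_add_box:
  assumes "is_partition p" "p r = s" "conjugate p s = r"
  shows "pos m (p(r := Suc s)) n = pos m p n +
      (if n = (if even m then r else s) then if even m then 1 else - 1 else 0)"
    and "pos m p (if even m then r else s) = int s - int r - (if even m then 1 else 0)"
  using assms by (auto simp: pos_def conjugate_add_box)

definition domino_at :: "sign list \<Rightarrow> int \<Rightarrow> (nat \<Rightarrow> nat \<Rightarrow> nat) \<Rightarrow> nat \<times> nat \<Rightarrow> domino" where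
  "domino_at w a L = (\<lambda>(m, n). step_domino m (a + charge w (m - 1) + pos m (L (m - 1)) n)
    (a + charge w m + pos m (L m) n))"

lemma tiling_of_image: "tiling_of l w a L = domino_at w a L ` ({1..2 * l} \<times> UNIV)"
  unfolding tiling_of_def domino_at_def by force

lemma inj_on_domino_at:
  assumes L: "L \<in> admissible l w"
  shows "inj_on (domino_at w a L) ({1..2 * l} \<times> UNIV)"
proof (rule inj_onI)
  fix x y
  assume x: "x \<in> {1..2 * l} \<times> UNIV" and y: "y \<in> {1..2 * l} \<times> UNIV"
    and eq: "domino_at w a L x = domino_at w a L y"
  obtain m n where mn: "x = (m, n)" "m \<in> {1..2 * l}" using x by blast
  obtain m' n' where mn': "y = (m', n')" "m' \<in> {1..2 * l}" using y by blast
  have "m = m'" "a + charge w m + pos m (L m) n = a + charge w m' + pos m' (L m') n'"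
    using eq step_domino_inject[OF admissible_step[OF L mn(2), of a n] admissible_step[OF L mn'(2), of a n'],
        of m m'] unfolding mn(1) mn'(1) domino_at_def prod.case by blast+
  then show "x = y"
    using injD[OF inj_pos[OF admissible_partition[OF L]], of m m n n'] by (simp add: mn mn')
qed

definition hor_pair :: "nat \<Rightarrow> int \<Rightarrow> domino set" where
  "hor_pair k x = {Hor x (x - int k), Hor x (x - int k + 1)}"

definition ver_pair :: "nat \<Rightarrow> int \<Rightarrow> domino set" where
  "ver_pair k x = {Ver x (x - int k), Ver (x + 1) (x - int k)}"

lemma flip_iff: "flip k T T' \<longleftrightarrow> (\<exists>x. hor_pair k x \<subseteq> T \<and> T' = (T - hor_pair k x) \<union> ver_pair k x \<or>
    ver_pair k x \<subseteq> T \<and> T' = (T - ver_pair k x) \<union> hor_pair k x)"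
proof -
  have "i - j = int k \<longleftrightarrow> j = i - int k" for i j by auto
  then show ?thesis by (simp add: flip_def Let_def hor_pair_def ver_pair_def)
qed

text \<open>Both pairs have the ends \<open>x\<close> on diagonal \<open>k - 1\<close> and
  \<open>x + 1\<close> on diagonal \<open>k + 1\<close>. On diagonal \<open>k\<close> the right end
  of link \<open>k\<close> and the left end of link \<open>k + 1\<close> exchange the positions
  \<open>x\<close> and \<open>x + 1\<close>, so the flip exchanges a particle with a neighbouring
  hole.\<close>

lemma pairs_step_domino:
  "hor_pair k x = {step_domino k x (x + 1), step_domino (Suc k) x (x + 1)}"
  "ver_pair k x = {step_domino k x x, step_domino (Suc k) (x + 1) (x + 1)}"
  by (auto simp: hor_pair_def ver_pair_def step_domino_def)

section \<open>Adding one box as one flip\<close>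

context
  fixes l :: nat and w :: "sign list" and L :: "nat \<Rightarrow> nat \<Rightarrow> nat"
    and k :: nat and p :: "nat \<Rightarrow> nat" and r s :: nat
  assumes k: "1 \<le> k" "k < 2 * l" and p: "is_partition p" and r: "p r = s" and s: "conjugate p s = r"
begin

private abbreviation "q \<equiv> p(r := Suc s)"
text \<open>The index of the object that link \<open>m\<close> transports, particle \<open>r\<close>
  or hole \<open>s\<close>. Before the box is added, particle \<open>r\<close> is at
  \<open>x\<close> and hole \<open>s\<close> at \<open>x + 1\<close>; afterwards they have changed
  places.\<close>

private abbreviation "idx m \<equiv> if even (m::nat) then r else s"
private abbreviation "x \<equiv> charge w k + int s - int r - 1"

text \<open>The end on diagonal \<open>k\<close> may be at \<open>x\<close> or at
  \<open>x + 1\<close>, and either way the link moves by 0 or 1. This leaves one position for the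
  other end: \<open>x\<close> on the left, \<open>x + 1\<close> on the right.\<close>

lemma admissible_box_positions:
  assumes "L(k := p) \<in> admissible l w" "L(k := q) \<in> admissible l w"
  shows "charge w (k - 1) + pos k (L (k - 1)) (idx k) = x"
    "charge w (Suc k) + pos (Suc k) (L (Suc k)) (idx (Suc k)) = x + 1"
proof -
  have "k \<in> {1..2 * l}" "Suc k \<in> {1..2 * l}" "k - 1 \<noteq> k" using k by auto
  note a = admissible_step[OF assms(1) this(1), of 0 "idx k"] admissible_step[OF assms(2) this(1), of 0 "idx k"]
    admissible_step[OF assms(1) this(2), of 0 "idx (Suc k)"] admissible_step[OF assms(2) this(2), of 0 "idx (Suc k)"]
  show "charge w (k - 1) + pos k (L (k - 1)) (idx k) = x"
    using a(1,2) \<open>k - 1 \<noteq> k\<close> pos_add_box(1)[OF p r s, of k "idx k"] pos_add_box(2)[OF p r s, of k]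
    by (cases "even k") auto
  show "charge w (Suc k) + pos (Suc k) (L (Suc k)) (idx (Suc k)) = x + 1"
    using a(3,4) pos_add_box(1)[OF p r s, of "Suc k" "idx (Suc k)"] pos_add_box(2)[OF p r s, of "Suc k"]
    by (cases "even k") auto
qed

text \<open>Conversely, with the neighbouring ends at \<open>x\<close> and \<open>x + 1\<close> both
  positions on diagonal \<open>k\<close> are legal moves, and all other steps are untouched.\<close>

lemma admissible_box:
  assumes L: "L \<in> admissible l w" and Lk: "L k = p \<or> L k = q"
    and left: "charge w (k - 1) + pos k (L (k - 1)) (idx k) = x"
    and right: "charge w (Suc k) + pos (Suc k) (L (Suc k)) (idx (Suc k)) = x + 1"
    and p': "p' = p \<or> p' = q"
  shows "L(k := p') \<in> admissible l w"
  unfolding admissible_iff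
proof (intro conjI allI ballI impI)
  fix m show "is_partition ((L(k := p')) m)"
    using p' p partition_add_box[OF p r s] admissible_partition[OF L] by auto
next
  show "(L(k := p')) 0 = (\<lambda>_. 0)" using k admissible_zero[OF L] by simp
next
  fix m assume "2 * l \<le> m"
  then show "(L(k := p')) m = (\<lambda>_. 0)" using k admissible_zero[OF L] by simp
next
  fix m n assume m: "m \<in> {1..2 * l}"
  have st: "charge w m + pos m (L m) n = charge w (m - 1) + pos m (L (m - 1)) n \<or>
      charge w m + pos m (L m) n = charge w (m - 1) + pos m (L (m - 1)) n + 1"
    using admissible_step[OF L m, of 0 n] by simp
  have same: "pos j p' n = pos j (L k) n" if "n \<noteq> idx j" for j
    using that p' Lk pos_add_box(1)[OF p r s, of j n] by auto
  have at: "pos j p' (idx j) = int s - int r - 1 \<or> pos j p' (idx j) = int s - int r" for j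
    using p' pos_add_box[OF p r s, of j] by (auto split: if_splits)
  consider "m = k" | "m = Suc k" | "m \<noteq> k" "m \<noteq> Suc k" by blast
  then show "charge w m + pos m ((L(k := p')) m) n = charge w (m - 1) + pos m ((L(k := p')) (m - 1)) n \<or>
      charge w m + pos m ((L(k := p')) m) n = charge w (m - 1) + pos m ((L(k := p')) (m - 1)) n + 1"
  proof cases
    case 1
    then have "(L(k := p')) m = p'" "(L(k := p')) (m - 1) = L (m - 1)" using k by auto
    then show ?thesis
      using st same[of k] at[of k] left 1 by (cases "n = idx k") auto
  next
    case 2
    then have "(L(k := p')) m = L m" "(L(k := p')) (m - 1) = p'" by auto
    then show ?thesis
      using st same[of "Suc k"] at[of "Suc k"] right 2 by (cases "n = idx (Suc k)") auto
  next
    case 3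
    then have "m - 1 \<noteq> k" using m by auto
    then show ?thesis using st 3 by simp
  qed
qed

text \<open>Only the links \<open>k\<close> and \<open>k + 1\<close> through the exchanged particle
  and hole change. For even \<open>k\<close> link \<open>k\<close> carries the particle, which sits
  at \<open>x\<close> before the box is added, so the vertical pair is the initial one. Injectivity
  of \<open>domino_at\<close> separates the remaining dominos from both pairs.\<close>

lemma tiling_add_box:
  fixes a :: int
  assumes Lp: "L(k := p) \<in> admissible l w" and Lq: "L(k := q) \<in> admissible l w"
  defines "D \<equiv> if even k then ver_pair k (a + x) else hor_pair k (a + x)"
    and "D' \<equiv> if even k then hor_pair k (a + x) else ver_pair k (a + x)"
    and "T \<equiv> tiling_of l w a (L(k := p))" and "T' \<equiv> tiling_of l w a (L(k := q))"
  shows "D \<subseteq> T" "T' = (T - D) \<union> D'" "D' \<subseteq> T'" "T = (T' - D') \<union> D"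
proof -
  let ?I = "{1..2 * l} \<times> (UNIV :: nat set)"
  let ?E = "{(k, idx k), (Suc k, idx (Suc k))}"
  let ?f = "domino_at w a (L(k := p))" and ?g = "domino_at w a (L(k := q))"
  have E: "?E \<subseteq> ?I" using k by auto
  have ne: "k - 1 \<noteq> k" using k by simp
  have "?f i = ?g i" if "i \<in> ?I - ?E" for i
  proof -
    obtain m n where "i = (m, n)" by (cases i)
    then have i: "i = (m, n)" "m \<noteq> 0" using that by auto
    have "pos m ((L(k := p)) m) n = pos m ((L(k := q)) m) n"
      using that i pos_add_box(1)[OF p r s, of m n] by (cases "m = k") auto
    moreover have "pos m ((L(k := p)) (m - 1)) n = pos m ((L(k := q)) (m - 1)) n"
      using that i pos_add_box(1)[OF p r s, of m n] by (cases "m = Suc k") auto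
    ultimately show ?thesis unfolding i(1) domino_at_def prod.case by (simp only:)
  qed
  then have common: "?f ` (?I - ?E) = ?g ` (?I - ?E)" by (rule image_cong[OF refl])
  have left: "a + charge w (k - 1) + pos k (L (k - 1)) (idx k) = a + x"
    and right: "a + charge w (Suc k) + pos (Suc k) (L (Suc k)) (idx (Suc k)) = a + x + 1"
    using admissible_box_positions[OF Lp Lq] by linarith+
  have "?f (k, idx k) = step_domino k (a + x) (a + charge w k + pos k p (idx k))"
    "?g (k, idx k) = step_domino k (a + x) (a + charge w k + pos k q (idx k))"
    "?f (Suc k, idx (Suc k)) = step_domino (Suc k) (a + charge w k + pos (Suc k) p (idx (Suc k))) (a + x + 1)"
    "?g (Suc k, idx (Suc k)) = step_domino (Suc k) (a + charge w k + pos (Suc k) q (idx (Suc k))) (a + x + 1)"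
    by (simp_all only: domino_at_def prod.case fun_upd_other[OF ne] fun_upd_same left
        diff_Suc_1 fun_upd_other[OF n_not_Suc_n[symmetric]] right)
  moreover have "a + charge w k + pos k p (idx k) = (if even k then a + x else a + x + 1)"
    "a + charge w k + pos k q (idx k) = (if even k then a + x + 1 else a + x)"
    "a + charge w k + pos (Suc k) p (idx (Suc k)) = (if even k then a + x + 1 else a + x)"
    "a + charge w k + pos (Suc k) q (idx (Suc k)) = (if even k then a + x else a + x + 1)"
    using pos_add_box[OF p r s, of k] pos_add_box[OF p r s, of "Suc k"] by simp_all
  ultimately have f: "?f ` ?E = D" and g: "?g ` ?E = D'"
    unfolding D_def D'_def pairs_step_domino by (simp_all add: insert_commute)
  have disj: "h ` (?I - ?E) \<inter> h ` ?E = {}" if "inj_on h ?I" for h :: "nat \<times> nat \<Rightarrow> domino"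
    using inj_on_image_Int[OF that, of "?I - ?E" ?E] E by auto
  have split: "h ` ?I = h ` (?I - ?E) \<union> h ` ?E" for h :: "nat \<times> nat \<Rightarrow> domino"
    using E by (metis Un_Diff_cancel2 Un_absorb2 image_Un)
  define C where "C = ?f ` (?I - ?E)"
  have "T = C \<union> D" "T' = C \<union> D'" "C \<inter> D = {}" "C \<inter> D' = {}"
    unfolding T_def T'_def tiling_of_image C_def
    using split[of ?f] split[of ?g] f g common disj[OF inj_on_domino_at[OF Lp]] disj[OF inj_on_domino_at[OF Lq]]
    by metis+
  then show "D \<subseteq> T" "T' = (T - D) \<union> D'" "D' \<subseteq> T'" "T = (T' - D') \<union> D" by blast+
qed

lemma flip_add_box:
  assumes "L(k := p) \<in> admissible l w" "L(k := q) \<in> admissible l w"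
  shows "flip k (tiling_of l w a (L(k := p))) (tiling_of l w a (L(k := q)))"
  unfolding flip_iff using tiling_add_box(1,2)[OF assms, of a] by (cases "even k") auto

end

text \<open>The flipped dominos end on diagonal \<open>k\<close> in a particle and a hole at
  neighbouring sites, and their order decides between adding and removing a box. The translation
  \<open>a\<close> is preserved.\<close>

lemma flip_of_tiling_of:
  assumes L: "L \<in> admissible l w" and fl: "flip k (tiling_of l w a L) T"
  shows "\<exists>L'\<in>admissible l w. T = tiling_of l w a L' \<and> (\<forall>j. j \<noteq> k \<longrightarrow> L' j = L j) \<and>
    weight (L' k) \<le> Suc (weight (L k))"
proof -
  let ?T = "tiling_of l w a L"
  have part: "is_partition (L m)" for m by (rule admissible_partition[OF L])
  obtain y b where b: "(if b then hor_pair k y else ver_pair k y) \<subseteq> ?T"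
    "T = (?T - (if b then hor_pair k y else ver_pair k y)) \<union> (if b then ver_pair k y else hor_pair k y)"
    using fl unfolding flip_iff by (metis (full_types))
  \<comment> \<open>\<open>e\<close> is the right end of link \<open>k\<close> and \<open>f\<close>
    the left end of link \<open>k + 1\<close>; \<open>b\<close> tells whether the flip replaces the
    horizontal pair.\<close>
  define e where "e = (if b then y + 1 else y)"
  define f where "f = (if b then y else y + 1)"
  have "link ?T k y e" "link ?T (Suc k) f (y + 1)"
    using b(1) unfolding pairs_step_domino link_def by (auto simp: e_def f_def)
  then obtain n n' where kl: "k \<in> {1..2 * l}" "Suc k \<in> {1..2 * l}"
    and n: "y = a + charge w (k - 1) + pos k (L (k - 1)) n" "e = a + charge w k + pos k (L k) n"
    and n': "f = a + charge w k + pos (Suc k) (L k) n'"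
      "y + 1 = a + charge w (Suc k) + pos (Suc k) (L (Suc k)) n'"
    unfolding link_tiling_of[OF L] by auto
  have k: "1 \<le> k" "k < 2 * l" using kl by auto
  define r where "r = (if even k then n else n')"
  define s where "s = (if even k then n' else n)"
  have nr: "n = (if even k then r else s)" "n' = (if even (Suc k) then r else s)"
    by (auto simp: r_def s_def)
  have conjugate: "r < conjugate (L k) s \<longleftrightarrow> s < L k r" by (rule less_conjugate_iff[OF part])
  have particle: "a + charge w k + int (L k r) - int r - 1 = (if even k then e else f)"
    using n(2) n'(1) by (auto simp: pos_def r_def)
  have hole: "a + charge w k + int s - int (conjugate (L k) s) = (if even k then f else e)"
    using n(2) n'(1) by (auto simp: pos_def s_def)
  show ?thesis
  proof (cases "b \<longleftrightarrow> odd k")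
    case True
    have "(if even k then f else e) = y + 1" "(if even k then e else f) = y"
      using True by (auto simp: e_def f_def)
    \<comment> \<open>The particle is just left of the hole, so
      \<open>L k r - s = r - conjugate (L k) s\<close> in integers. As \<open>s < L k r\<close> iff
      \<open>r < conjugate (L k) s\<close>, both sides are 0.\<close>
    then have rs: "L k r = s" "conjugate (L k) s = r" and y: "y = a + (charge w k + int s - int r - 1)"
      using particle hole conjugate by (cases "s < L k r"; simp)+
    have left: "charge w (k - 1) + pos k (L (k - 1)) (if even k then r else s) = charge w k + int s - int r - 1"
      and right: "charge w (Suc k) + pos (Suc k) (L (Suc k)) (if even (Suc k) then r else s) =
        charge w k + int s - int r - 1 + 1"
      using n(1) n'(2) y unfolding nr(1)[symmetric] nr(2)[symmetric] by linarith+
    note box = k part[of k] rs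
    have "L(k := (L k)(r := Suc s)) \<in> admissible l w"
      by (rule admissible_box[OF box L disjI1[OF refl] left right disjI2[OF refl]])
    moreover have "L(k := L k) \<in> admissible l w" using L by simp
    ultimately have "T = tiling_of l w a (L(k := (L k)(r := Suc s)))"
      using tiling_add_box(2)[OF box, of L w a] b(2) True y by (cases "even k") simp_all
    then show ?thesis
      using \<open>L(k := (L k)(r := Suc s)) \<in> admissible l w\<close> weight_add_box[OF part rs]
      by (intro bexI[of _ "L(k := (L k)(r := Suc s))"]) auto
  next
    case False
    have "(if even k then f else e) = y" "(if even k then e else f) = y + 1"
      using False by (auto simp: e_def f_def)
    \<comment> \<open>Here the particle is just right of the hole, so the differences
      \<open>L k r - s\<close> and \<open>conjugate (L k) s - r\<close> sum to 2; being positive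
      simultaneously, both are 1 and \<open>(r, s)\<close> is a removable corner.\<close>
    then have rs: "L k r = Suc s" "conjugate (L k) s = Suc r" and y: "y = a + (charge w k + int s - int r - 1)"
      using particle hole conjugate by (cases "s < L k r"; simp)+
    define p where "p = (L k)(r := s)"
    have Lk: "L k = p(r := Suc s)" using rs by (simp add: p_def fun_upd_idem)
    have lt: "L k (Suc r) \<le> s" using rs(2) less_conjugate_iff[OF part, of "Suc r" k s] by simp
    obtain N where N: "\<forall>n\<ge>N. L k n = 0" using part[of k] unfolding is_partition_def by blast
    have pp: "is_partition p"
    proof (rule partitionI[where N = "N + Suc r"])
      show "p (Suc i) \<le> p i" for i
        using partition_antimono[OF part, of i "Suc i" k] lt rs(1) by (auto simp: p_def)
    qed (use N in \<open>auto simp: p_def\<close>)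
    have pr: "p r = s" by (simp add: p_def)
    have "i < conjugate p s \<longleftrightarrow> i < r" for i
      using less_conjugate_iff[OF pp, of i s] less_conjugate_iff[OF part, of i k s] rs
      by (auto simp: p_def less_Suc_eq split: if_splits)
    then have ps: "conjugate p s = r" by (metis linorder_neqE_nat order_less_irrefl)
    have left: "charge w (k - 1) + pos k (L (k - 1)) (if even k then r else s) = charge w k + int s - int r - 1"
      and right: "charge w (Suc k) + pos (Suc k) (L (Suc k)) (if even (Suc k) then r else s) =
        charge w k + int s - int r - 1 + 1"
      using n(1) n'(2) y unfolding nr(1)[symmetric] nr(2)[symmetric] by linarith+
    note box = k pp pr ps
    have adm: "L(k := p) \<in> admissible l w"
      by (rule admissible_box[OF box L disjI2[OF Lk] left right disjI1[OF refl]])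
    have Lq: "L(k := p(r := Suc s)) = L" using Lk by (simp add: fun_upd_idem)
    then have "L(k := p(r := Suc s)) \<in> admissible l w" using L by simp
    then have "T = tiling_of l w a (L(k := p))"
      using tiling_add_box(4)[OF box adm, of a] b(2) False y Lq by (cases "even k") simp_all
    moreover have "weight p \<le> Suc (weight (L k))" using weight_add_box[OF pp pr ps] Lk by simp
    ultimately show ?thesis using adm by (intro bexI[of _ "L(k := p)"]) auto
  qed
qed

section \<open>Flip counts, removable boxes and shortest sequences\<close>

lemma flip_seq_weight:
  "flip_seq T ks T' \<Longrightarrow> L \<in> admissible l w \<Longrightarrow> T = tiling_of l w a L \<Longrightarrow>
    \<exists>L'\<in>admissible l w. T' = tiling_of l w a L' \<and> (\<forall>k. weight (L' k) \<le> weight (L k) + count (mset ks) k)"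
proof (induction arbitrary: L rule: flip_seq.induct)
  case (Nil T)
  then show ?case by auto
next
  case (Cons k T T' ks T'')
  obtain L1 where L1: "L1 \<in> admissible l w" "T' = tiling_of l w a L1" "\<And>j. j \<noteq> k \<Longrightarrow> L1 j = L j"
    "weight (L1 k) \<le> Suc (weight (L k))"
    using flip_of_tiling_of[of L l w k a T'] Cons by auto
  obtain L2 where L2: "L2 \<in> admissible l w" "T'' = tiling_of l w a L2"
    "\<And>j. weight (L2 j) \<le> weight (L1 j) + count (mset ks) j"
    using Cons.IH[OF L1(1,2)] by blast
  have "weight (L2 j) \<le> weight (L j) + count (mset (k # ks)) j" for j
    using L2(3)[of j] L1(3)[of j] L1(4) by (cases "j = k") auto
  then show ?case using L2 by blast
qed

lemma flip_seq_snoc: "flip_seq T ks T' \<Longrightarrow> flip k T' T'' \<Longrightarrow> flip_seq T (ks @ [k]) T''"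
  by (induction rule: flip_seq.induct) (auto intro: flip_seq.intros)

text \<open>The outer partition can lose the box \<open>(r, s)\<close> unless the inner one contains
  this box.\<close>

lemma strip_remove_box_right:
  assumes "strip t m (p(r := Suc s))" "p r = s" "m r \<le> s"
  shows "strip t m p"
proof (cases t)
  case True
  have "p (Suc i) \<le> m i \<and> m i \<le> p i" for i
  proof -
    have "(p(r := Suc s)) (Suc i) \<le> m i" "m i \<le> (p(r := Suc s)) i"
      using assms(1) True by (simp_all add: strip_def hstrip_def)
    then show ?thesis using assms(2,3) by (auto split: if_splits)
  qed
  then show ?thesis using True by (simp add: strip_def hstrip_def)
next
  case False
  have "m i \<le> p i \<and> p i \<le> Suc (m i)" for i
  proof -
    have "m i \<le> (p(r := Suc s)) i" "(p(r := Suc s)) i \<le> Suc (m i)"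
      using assms(1) False by (simp_all add: strip_def vstrip_def)
    then show ?thesis using assms(2,3) by (auto split: if_splits)
  qed
  then show ?thesis using False by (simp add: strip_def vstrip_def)
qed

text \<open>The inner partition can lose the box unless the outer one contains
  \<open>(r + 1, s)\<close>, an obstacle for horizontal strips, or \<open>(r, s + 1)\<close>, one
  for vertical strips.\<close>

lemma strip_remove_box_left:
  assumes "strip t (p(r := Suc s)) m" "p r = s" "m (Suc r) \<le> s" "m r \<le> Suc s"
  shows "strip t p m"
proof (cases t)
  case True
  have "m (Suc i) \<le> p i \<and> p i \<le> m i" for i
  proof -
    have "m (Suc i) \<le> (p(r := Suc s)) i" "(p(r := Suc s)) i \<le> m i"
      using assms(1) True by (simp_all add: strip_def hstrip_def)
    then show ?thesis using assms(2,3) by (auto split: if_splits)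
  qed
  then show ?thesis using True by (simp add: strip_def hstrip_def)
next
  case False
  have "p i \<le> m i \<and> m i \<le> Suc (p i)" for i
  proof -
    have "(p(r := Suc s)) i \<le> m i" "m i \<le> Suc ((p(r := Suc s)) i)"
      using assms(1) False by (simp_all add: strip_def vstrip_def)
    then show ?thesis using assms(2,4) by (auto split: if_splits)
  qed
  then show ?thesis using False by (simp add: strip_def vstrip_def)
qed

text \<open>
  In every case the box that prevents the removal of the box \<open>(r, s)\<close> of the \<open>k\<close>-th partition has
  a larger value of \<open>2 * (r + s) + h k\<close>, so a box maximizing it is removable.
\<close>

lemma removable_box:
  assumes L: "L \<in> admissible l w" and ne: "L \<noteq> (\<lambda>_ _. 0)"
  obtains k p r s where "1 \<le> k" "k < 2 * l" "is_partition p" "p r = s" "conjugate p s = r"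
    "L k = p(r := Suc s)" "L(k := p) \<in> admissible l w"
proof -
  have part: "is_partition (L m)" for m by (rule admissible_partition[OF L])
  define X where "X = (SIGMA k:{..<2 * l}. boxes (L k))"
  \<comment> \<open>\<open>h\<close> is larger by 1 at the inner partition of a step than at the
    outer one. An obstructing box in an inner neighbour is \<open>(r, s)\<close> itself and gains 1;
    one in an outer neighbour loses 1 through \<open>h\<close> but is one place further in the
    diagram, which gains 2.\<close>
  define h where "h k = (\<Sum>m = 1..k. if letter w m = Plus then - 1 else 1 :: int)" for k
  define \<phi> where "\<phi> = (\<lambda>(k, r, s). 2 * (int r + int s) + h k)"
  have finX: "finite X" unfolding X_def using finite_boxes part by blast
  have mem: "(k, r, s) \<in> X \<longleftrightarrow> s < L k r" for k r s
    using admissible_zero(2)[OF L, of k] by (cases "k < 2 * l") (auto simp: X_def boxes_def)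
  obtain k0 r0 where "L k0 r0 \<noteq> 0" using ne by (auto simp: fun_eq_iff)
  then have "(k0, r0, 0) \<in> X" using mem by simp
  then have "X \<noteq> {}" by blast
  then have "Max (\<phi> ` X) \<in> \<phi> ` X" using finX by simp
  then obtain k r s where z: "(k, r, s) \<in> X" "Max (\<phi> ` X) = \<phi> (k, r, s)"
    by (metis imageE prod_cases3)
  have max: "L k' r' \<le> s'" if "\<phi> (k', r', s') > \<phi> (k, r, s)" for k' r' s'
  proof (rule ccontr)
    assume "\<not> L k' r' \<le> s'"
    then have "(k', r', s') \<in> X" using mem by simp
    then have "\<phi> (k', r', s') \<le> Max (\<phi> ` X)" using finX by simp
    then show False using that z(2) by simp
  qed
  have k: "k < 2 * l" "1 \<le> k"
    using z(1) admissible_zero(1)[OF L] by (auto simp: X_def boxes_def intro!: Suc_leI Nat.gr0I)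
  have hk: "h k = h (k - 1) + (if letter w k = Plus then - 1 else 1)"
    "h (Suc k) = h k + (if letter w (Suc k) = Plus then - 1 else 1)"
    using k(2) by (cases k; simp add: h_def)+
  have rs: "L k r = Suc s" using max[of k r "Suc s"] z(1) mem[of k r s] by (simp add: \<phi>_def)
  have lt: "L k (Suc r) \<le> s" using max[of k "Suc r" s] by (simp add: \<phi>_def)
  define p where "p = (L k)(r := s)"
  have Lk: "L k = p(r := Suc s)" using rs by (simp add: p_def fun_upd_idem)
  obtain N where N: "\<forall>n\<ge>N. L k n = 0" using part[of k] unfolding is_partition_def by blast
  have pp: "is_partition p"
  proof (rule partitionI[where N = "N + Suc r"])
    show "p (Suc i) \<le> p i" for i
      using partition_antimono[OF part, of i "Suc i" k] lt rs by (auto simp: p_def)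
  qed (use N in \<open>auto simp: p_def\<close>)
  have pr: "p r = s" by (simp add: p_def)
  have "i < conjugate p s \<longleftrightarrow> i < r" for i
  proof -
    consider "i < r" | "i = r" | "Suc r \<le> i" by linarith
    then show ?thesis
      using less_conjugate_iff[OF pp, of i s] partition_antimono[OF part, of i r k]
        partition_antimono[OF part, of "Suc r" i k] lt rs
      by cases (simp_all add: p_def)
  qed
  then have ps: "conjugate p s = r" by (metis linorder_neqE_nat order_less_irrefl)
  have step: "signed_strip (word_steps w m) (L (m - 1)) (L m)" if "m \<in> {1..2 * l}" for m
    using L that unfolding seqs_def by blast
  have "k \<in> {1..2 * l}" "Suc k \<in> {1..2 * l}" using k by auto
  note steps = step[OF this(1)] step[OF this(2)]
  have new1: "signed_strip (word_steps w k) (L (k - 1)) p"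
  proof (cases "letter w k")
    case Plus
    have "L (k - 1) r \<le> s" using max[of "k - 1" r s] hk Plus by (simp add: \<phi>_def)
    then show ?thesis
      using steps(1) Plus strip_remove_box_right[where p = p and r = r, OF _ pr] Lk by (simp add: signed_strip_def word_steps_def)
  next
    case Minus
    have "L (k - 1) (Suc r) \<le> s" "L (k - 1) r \<le> Suc s"
      using max[of "k - 1" "Suc r" s] max[of "k - 1" r "Suc s"] hk Minus by (simp_all add: \<phi>_def)
    then show ?thesis
      using steps(1) Minus strip_remove_box_left[where p = p and r = r, OF _ pr] Lk by (simp add: signed_strip_def word_steps_def)
  qed
  have new2: "signed_strip (word_steps w (Suc k)) p (L (Suc k))"
  proof (cases "letter w (Suc k)")
    case Minus
    have "L (Suc k) r \<le> s" using max[of "Suc k" r s] hk Minus by (simp add: \<phi>_def)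
    then show ?thesis
      using steps(2) Minus strip_remove_box_right[where p = p and r = r, OF _ pr] Lk by (simp add: signed_strip_def word_steps_def)
  next
    case Plus
    have "L (Suc k) (Suc r) \<le> s" "L (Suc k) r \<le> Suc s"
      using max[of "Suc k" "Suc r" s] max[of "Suc k" r "Suc s"] hk Plus by (simp_all add: \<phi>_def)
    then show ?thesis
      using steps(2) Plus strip_remove_box_left[where p = p and r = r, OF _ pr] Lk by (simp add: signed_strip_def word_steps_def)
  qed
  have "L(k := p) \<in> admissible l w"
    unfolding seqs_def
  proof (intro CollectI conjI allI ballI impI)
    fix m assume m: "m \<in> {1..2 * l}"
    have "m = k \<or> m = Suc k \<or> m \<noteq> k \<and> m - 1 \<noteq> k" by linarith
    then show "signed_strip (word_steps w m) ((L(k := p)) (m - 1)) ((L(k := p)) m)"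
      using new1 new2 step[OF m] k by auto
  qed (use pp part k admissible_zero[OF L] in auto)
  then show ?thesis using that k pp pr ps Lk by blast
qed

lemma flip_seq_exists:
  "L \<in> admissible l w \<Longrightarrow>
    \<exists>ks. flip_seq (tiling_of l w a (\<lambda>_ _. 0)) ks (tiling_of l w a L) \<and> (\<forall>k. count (mset ks) k = weight (L k))"
proof (induction "\<Sum>k<2 * l. weight (L k)" arbitrary: L)
  case 0
  have "L = (\<lambda>_ _. 0)"
  proof (rule ccontr)
    assume "L \<noteq> (\<lambda>_ _. 0)"
    then obtain k p r s where "k < 2 * l" "is_partition p" "p r = s" "conjugate p s = r" "L k = p(r := Suc s)"
      using removable_box[OF 0(2)] by metis
    moreover have "weight (L k) = 0" using 0(1) \<open>k < 2 * l\<close> by simp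
    ultimately show False using weight_add_box[of p r s] by simp
  qed
  moreover have "weight (\<lambda>_. 0) = 0" by (simp add: weight_def boxes_def)
  ultimately show ?case by (intro exI[of _ "[]"]) (auto intro: flip_seq.intros)
next
  case (Suc c)
  have "L \<noteq> (\<lambda>_ _. 0)" using Suc(2) by (auto simp: weight_def boxes_def)
  then obtain k p r s where box: "1 \<le> k" "k < 2 * l" "is_partition p" "p r = s" "conjugate p s = r"
    and Lk: "L k = p(r := Suc s)" and adm: "L(k := p) \<in> admissible l w"
    using removable_box[OF Suc(3)] by metis
  have w: "weight (L k) = Suc (weight p)" using weight_add_box[OF box(3-5)] Lk by simp
  have "(\<Sum>j<2 * l. weight (L j)) = weight (L k) + (\<Sum>j\<in>{..<2 * l} - {k}. weight (L j))"
    using box(2) by (simp add: sum.remove)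
  moreover have "(\<Sum>j<2 * l. weight ((L(k := p)) j)) = weight p + (\<Sum>j\<in>{..<2 * l} - {k}. weight (L j))"
    using box(2) by (simp add: sum.remove)
  ultimately have "c = (\<Sum>j<2 * l. weight ((L(k := p)) j))" using Suc(2) w by linarith
  from Suc(1)[OF this adm] obtain ks where ks:
    "flip_seq (tiling_of l w a (\<lambda>_ _. 0)) ks (tiling_of l w a (L(k := p)))"
    "\<And>j. count (mset ks) j = weight ((L(k := p)) j)" by blast
  have Lq: "L(k := p(r := Suc s)) = L" using Lk by (simp add: fun_upd_idem)
  have "flip k (tiling_of l w a (L(k := p))) (tiling_of l w a L)"
    using flip_add_box[OF box adm, of a] Lq Suc(3) by simp
  from flip_seq_snoc[OF ks(1) this] ks(2) w show ?case
    by (intro exI[of _ "ks @ [k]"]) auto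
qed

text \<open>By \<open>flip_seq_weight\<close> every sequence reaching the class flips diagonal
  \<open>k\<close> at least \<open>weight (L k)\<close> times. \<open>ks0\<close> attains all these
  bounds simultaneously, so a shortest sequence can only be a rearrangement of it.\<close>

lemma flip_monomial_iff:
  assumes l: "1 \<le> l" and L: "L \<in> admissible l w"
  shows "flip_monomial l w (translation_class (tiling_of l w a L)) M \<longleftrightarrow> (\<forall>k. count M k = weight (L k))"
proof -
  let ?C = "translation_class (tiling_of l w a L)"
  obtain ks0 where ks0: "flip_seq (tiling_of l w 0 (\<lambda>_ _. 0)) ks0 (tiling_of l w 0 L)"
    "\<And>k. count (mset ks0) k = weight (L k)" using flip_seq_exists[OF L] by blast
  have reach: "reaches_class l w ks0 ?C"
    unfolding reaches_class_def min_tiling_eq[OF l] translation_class_tiling_of using ks0(1) by blast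
  have sub: "mset ks0 \<subseteq># mset ks" if "reaches_class l w ks ?C" for ks
  proof -
    from that obtain b where b: "flip_seq (tiling_of l w 0 (\<lambda>_ _. 0)) ks (tiling_of l w b L)"
      unfolding reaches_class_def min_tiling_eq[OF l] translation_class_tiling_of by blast
    obtain L' where L': "L' \<in> admissible l w" "tiling_of l w b L = tiling_of l w 0 L'"
      "\<And>k. weight (L' k) \<le> weight (\<lambda>_. 0) + count (mset ks) k"
      using flip_seq_weight[OF b zero_admissible refl] by blast
    \<comment> \<open>Flips never change the translation, so the representative that was reached has
      the one of the minimal tiling and determines its sequence.\<close>
    have "L' = L" using tiling_of_inject(2)[OF l L L'(1,2)] by simp
    moreover have "weight (\<lambda>_. 0) = 0" by (simp add: weight_def boxes_def)
    ultimately show ?thesis using L'(3) ks0(2) by (simp add: subseteq_mset_def)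
  qed
  have eq: "(\<forall>k. count M k = weight (L k)) \<longleftrightarrow> M = mset ks0"
    using ks0(2) by (auto simp: multiset_eq_iff)
  show ?thesis unfolding eq
  proof
    assume "flip_monomial l w ?C M"
    then obtain ks where ks: "reaches_class l w ks ?C" "length ks \<le> length ks0" "M = mset ks"
      unfolding flip_monomial_def using reach by blast
    have "mset ks0 = mset ks"
    proof (rule ccontr)
      assume "mset ks0 \<noteq> mset ks"
      then have "mset ks0 \<subset># mset ks" using sub[OF ks(1)] by (simp add: subset_mset.less_le)
      then have "size (mset ks0) < size (mset ks)" by (rule mset_subset_size)
      then show False using ks(2) by simp
    qed
    then show "M = mset ks0" using ks(3) by simp
  next
    assume "M = mset ks0"
    moreover have "length ks0 \<le> length ks" if "reaches_class l w ks ?C" for ks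
      using size_mset_mono[OF sub[OF that]] by simp
    ultimately show "flip_monomial l w ?C M"
      unfolding flip_monomial_def using reach by blast
  qed
qed

lemma pure_steep_classes_eq:
  assumes "1 \<le> l"
  shows "pure_steep_classes l w = (\<lambda>L. translation_class (tiling_of l w 0 L)) ` admissible l w"
proof -
  have "translation_class (tiling_of l w a L) = translation_class (tiling_of l w 0 L)" for a L
    unfolding translation_class_tiling_of ..
  then show ?thesis
    unfolding pure_steep_classes_def pure_steep_tilings_eq[OF assms] by (auto simp: image_iff)
qed

theorem theorem3:
  fixes l :: nat and w :: "sign list"
  assumes "l \<ge> 1" and "length w = 2 * l"
  shows "(\<forall>C \<in> pure_steep_classes l w. \<exists>!M. flip_monomial l w C M) \<and>
    (\<forall>M. finite {C \<in> pure_steep_classes l w. flip_monomial l w C M}) \<and>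
    steep_gf l w =
      (\<Prod>(i, j) \<in> {(i, j). 1 \<le> i \<and> i < j \<and> j \<le> 2 * l \<and>
          letter w i = Plus \<and> letter w j = Minus \<and> odd (j - i)}.
        1 + (\<Prod>k = i..<j. mfps_X k)) *
      (\<Prod>(i, j) \<in> {(i, j). 1 \<le> i \<and> i < j \<and> j \<le> 2 * l \<and>
          letter w i = Plus \<and> letter w j = Minus \<and> even (j - i)}.
        1 / (1 - (\<Prod>k = i..<j. mfps_X k)))"
    (is "_ \<and> _ \<and> _ = ?rhs")
proof -
  let ?u = "word_steps w"
  let ?cl = "\<lambda>L. translation_class (tiling_of l w 0 L)"
  let ?A = "\<lambda>M. {L \<in> admissible l w. \<forall>k. weight (L k) = count M k}"
  let ?S = "\<lambda>M. {g \<in> fillings (2 * l) ?u. \<forall>k. arc_weight g (inversions (2 * l) ?u) k = count M k}"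
  have inj: "inj_on ?cl (admissible l w)"
  proof (rule inj_onI)
    fix L L' assume L: "L \<in> admissible l w" "L' \<in> admissible l w" and "?cl L = ?cl L'"
    then obtain b where "tiling_of l w 0 L = tiling_of l w b L'"
      unfolding translation_class_tiling_of by blast
    then show "L = L'" using tiling_of_inject(2) assms(1) L by blast
  qed
  have unique: "\<exists>!M. flip_monomial l w C M" if C: "C \<in> pure_steep_classes l w" for C
  proof -
    obtain L where L: "L \<in> admissible l w" "C = ?cl L"
      using C pure_steep_classes_eq[OF assms(1)] by blast
    obtain ks where ks: "\<And>k. count (mset ks) k = weight (L k)"
      using flip_seq_exists[OF L(1)] by blast
    have "flip_monomial l w C M \<longleftrightarrow> M = mset ks" for M
      unfolding L(2) flip_monomial_iff[OF assms(1) L(1)] using ks by (auto simp: multiset_eq_iff)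
    then show ?thesis by simp
  qed
  have classes: "{C \<in> pure_steep_classes l w. flip_monomial l w C M} = ?cl ` ?A M" for M
    unfolding pure_steep_classes_eq[OF assms(1)]
    using flip_monomial_iff[OF assms(1), of _ w 0 M] by force
  obtain f where f: "bij_betw f (admissible l w) (fillings (2 * l) ?u)"
    "\<And>L k. L \<in> admissible l w \<Longrightarrow> weight (L k) = arc_weight (f L) (inversions (2 * l) ?u) k"
    using seqs_fillings by blast
  have bij: "bij_betw f (?A M) (?S M)" for M
  proof (rule bij_betw_imageI)
    show "inj_on f (?A M)" using bij_betw_imp_inj_on[OF f(1)] by (rule inj_on_subset) blast
    show "f ` ?A M = ?S M"
    proof (intro subset_antisym subsetI)
      fix g assume "g \<in> f ` ?A M"
      then show "g \<in> ?S M" using f(2) bij_betwE[OF f(1)] by auto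
    next
      fix g assume g: "g \<in> ?S M"
      then obtain L where L: "L \<in> admissible l w" "g = f L"
        using bij_betw_imp_surj_on[OF f(1)] by blast
      then show "g \<in> f ` ?A M" using g f(2) by auto
    qed
  qed
  \<comment> \<open>Finiteness of the classes with a given monomial is inherited from the fillings
    with prescribed arc weights.\<close>
  have fin: "finite (?A M)" for M
    using coeff_arc_product(1) bij_betw_finite[OF bij] by blast
  have "steep_gf l w = ?rhs"
  proof (rule mfps_eqI)
    fix M :: "nat multiset"
    have "inj_on ?cl (?A M)" using inj by (rule inj_on_subset) blast
    from card_image[OF this] have "mfps_coeff (steep_gf l w) M = int (card (?A M))"
      unfolding steep_gf_def mfps_coeff_Abs classes by (rule arg_cong)
    also have "\<dots> = int (card (?S M))"
      using bij_betw_same_card[OF bij] by (rule arg_cong)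
    also have "\<dots> = mfps_coeff ?rhs M"
    proof -
      \<comment> \<open>In \<open>word_steps\<close> the kind of a step is the parity of its
        position, so odd differences are the inversions with different kinds.\<close>
      have "odd (j - i) \<longleftrightarrow> odd i \<noteq> odd j" if "i < j" for i j :: nat
        using that even_diff_nat[of j i] by auto
      then have "{(i, j). 1 \<le> i \<and> i < j \<and> j \<le> 2 * l \<and> letter w i = Plus \<and> letter w j = Minus \<and> odd (j - i)} =
          {(i, j) \<in> inversions (2 * l) ?u. snd (?u i) \<noteq> snd (?u j)}"
        "{(i, j). 1 \<le> i \<and> i < j \<and> j \<le> 2 * l \<and> letter w i = Plus \<and> letter w j = Minus \<and> even (j - i)} =
          {(i, j) \<in> inversions (2 * l) ?u. snd (?u i) = snd (?u j)}"
        by (auto simp: inversions_def word_steps_def)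
      from coeff_arc_product(2)[of "2 * l" ?u M, folded this] show ?thesis by (rule sym)
    qed
    finally show "mfps_coeff (steep_gf l w) M = mfps_coeff ?rhs M" .
  qed
  moreover have "finite {C \<in> pure_steep_classes l w. flip_monomial l w C M}" for M
    unfolding classes using fin by (rule finite_imageI)
  ultimately show ?thesis using unique by blast
qed

end
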